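(* Let $Q=\bigsqcup_{i\in I}Q_i$ be a graded quandle and let $\Lambda=\prod_{i\in I}\Lambda_i$ be a graded group (not necessarily abelian). For each graded extension $E\colon\Lambda\curvearrowright\tilde Q\xrightarrow{p}Q$ let $\Phi(E)\in H^2(Q,\Lambda)$ be the associated cohomology class. The map $\Phi$ induces a natural bijection $\Phi\colon\mathrm{Ext}(Q,\Lambda)\cong H^2(Q,\Lambda)$. If $\Lambda$ is an abelian group, or more generally a module over some ring $R$, then $\mathrm{Ext}(Q,\Lambda)$ and $H^2(Q,\Lambda)$ each carry a natural $R$-module structure, and $\Phi$ is an isomorphism of $R$-modules.
   Context: A quandle is a set $Q$ with two binary operations $*,\bar{*}$ such that for all $a,b,c\in Q$: $a*a=a$; $(a*b)\bar{*}b=a=(a\bar{*}b)*b$; $(a*b)*c=(a*c)*(b*c)$. Fix an index set $I$. A graded quandle is a quandle partitioned as $Q=\bigsqcup_{i\in I}Q_i$ with $Q_i*Q_j=Q_i$ for all $i,j\in I$. A graded group is a product $\Lambda=\prod_{i\in I}\Lambda_i$ of groups (in the abelian/module case, each $\Lambda_i$ is abelian/an $R$-module). A graded extension $E\colon\Lambda\curvearrowright\tilde Q\xrightarrow{p}Q$ consists of a surjective quandle homomorphism $p\colon\tilde Q\to Q$ (with $\tilde Q_i=p^{-1}(Q_i)$) and a graded left action of $\Lambda$ on $\tilde Q$ (i.e. $\Lambda$ acts on $\tilde Q_i$ through an action of $\Lambda_i$) such that: (E1) $(\lambda\tilde x)*\tilde y=\lambda(\tilde x*\tilde y)$ and $\tilde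 x*(\lambda\tilde y)=\tilde x*\tilde y$ for all $\tilde x,\tilde y\in\tilde Q$, $\lambda\in\Lambda$; (E2) $\Lambda_i$ acts freely and transitively on each fibre $p^{-1}(x)$ with $x\in Q_i$. Two extensions $\Lambda\curvearrowright Q_1\xrightarrow{p_1}Q$ and $\Lambda\curvearrowright Q_2\xrightarrow{p_2}Q$ are equivalent if there is a $\Lambda$-equivariant quandle isomorphism $\phi\colon Q_1\to Q_2$ with $p_1=p_2\phi$; $\mathrm{Ext}(Q,\Lambda)$ is the set of equivalence classes. A $2$-cocycle is a map $f\colon Q\times Q\to\bigsqcup_i\Lambda_i$ with $f(Q_i\times Q)\subset\Lambda_i$, $f(a,a)=1$ and $f(a,b)f(a*b,c)=f(a,c)f(a*c,b*c)$ for all $a,b,c\in Q$. Two cocycles $f,f'$ are cohomologous if there is a map $g$ on $Q$ with $g(Q_i)\subset\Lambda_i$ and $f(a,b)=g(a)^{-1}f'(a,b)g(a*b)$ for all $a,b\in Q$. $H^2(Q,\Lambda)$ is the set of cohomology classes. Definition of $\Phi(E)$: choose a set-theoretic section $s\colon Q\to\tilde Q$ of $p$; the equation $s(a)*s(b)=f(a,b)\cdot s(a*b)$ defines a unique $2$-cocycle $f$, and $\Phi(E)=[f]$ is independent of the choice of $s$. Module structures: for $\Lambda$ abelian, $H^2(Q,\Lambda)$ has the structure induced from pointwise operations on cocycles. On $\mathrm{Ext}(Q,\Lambda)$ the sum of $\Lambda\curvearrowright Q_1\xrightarrow{p_1}Q$ and $\Lambda\curvearrowright Q_2\xrightarrow{p_2}Q$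 is the quotient of the fibred product $Q_1\times_QQ_2$ by $(\lambda a_1,a_2)\sim(a_1,\lambda a_2)$, with componentwise quandle operation, projection $[a_1,a_2]\mapsto p_1(a_1)=p_2(a_2)$ and action $\lambda[a_1,a_2]=[\lambda a_1,a_2]$; a scalar $r\in R$ acts by push-forward along the endomorphism $r\colon\Lambda\to\Lambda$, where the push-forward of $\Lambda\curvearrowright\tilde Q\to Q$ along a homomorphism $h\colon\Lambda\to\Lambda'$ is (in degree $i$) the quotient of $\Lambda'_i\times\tilde Q_i$ by $(\lambda',\lambda\tilde a)\sim(\lambda'h(\lambda),\tilde a)$, with $[\lambda',a]*[\lambda'',b]=[\lambda',a*b]$ and the obvious action and projection. *)

theory Defs
  imports "HOL-Algebra.Module" "HOL-Algebra.Group_Action" "HOL-Library.Disjoint_Sets"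
begin

section \<open>Graded quandles and graded groups\<close>

record 'a quandle = "'a partial_object" +
  qop :: "'a \<Rightarrow> 'a \<Rightarrow> 'a" (infixl "\<triangleright>\<index>" 70)
  qbar :: "'a \<Rightarrow> 'a \<Rightarrow> 'a" (infixl "\<triangleleft>\<index>" 70)

locale quandle =
  fixes Q (structure)
  assumes op_closed: "\<lbrakk>a \<in> carrier Q; b \<in> carrier Q\<rbrakk> \<Longrightarrow> a \<triangleright> b \<in> carrier Q"
    and bar_closed: "\<lbrakk>a \<in> carrier Q; b \<in> carrier Q\<rbrakk> \<Longrightarrow> a \<triangleleft> b \<in> carrier Q"
    and idem: "a \<in> carrier Q \<Longrightarrow> a \<triangleright> a = a"
    and op_bar: "\<lbrakk>a \<in> carrier Q; b \<in> carrier Q\<rbrakk> \<Longrightarrow> (a \<triangleright> b) \<triangleleft> b = a"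
    and bar_op: "\<lbrakk>a \<in> carrier Q; b \<in> carrier Q\<rbrakk> \<Longrightarrow> (a \<triangleleft> b) \<triangleright> b = a"
    and self_distrib: "\<lbrakk>a \<in> carrier Q; b \<in> carrier Q; c \<in> carrier Q\<rbrakk>
      \<Longrightarrow> (a \<triangleright> b) \<triangleright> c = (a \<triangleright> c) \<triangleright> (b \<triangleright> c)"

text \<open>Homomorphisms preserve \<open>\<triangleright>\<close>; preservation of \<open>\<triangleleft>\<close> is then automatic.\<close>

definition quandle_hom :: "('a, 'm) quandle_scheme \<Rightarrow> ('b, 'n) quandle_scheme \<Rightarrow> ('a \<Rightarrow> 'b) set"
  where "quandle_hom Q Q' = {\<phi> \<in> carrier Q \<rightarrow> carrier Q'.
    \<forall>a\<in>carrier Q. \<forall>b\<in>carrier Q. \<phi> (a \<triangleright>\<^bsub>Q\<^esub> b) = \<phi> a \<triangleright>\<^bsub>Q'\<^esub> \<phi> b}"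

record ('a, 'i) graded_quandle = "'a quandle" +
  part :: "'i \<Rightarrow> 'a set"

locale graded_quandle = quandle Q for I :: "'i set" and Q :: "('q, 'i) graded_quandle" (structure) +
  assumes parts_cover: "carrier Q = (\<Union>i\<in>I. part Q i)"
    and parts_disjoint: "disjoint_family_on (part Q) I"
    and parts_op: "\<lbrakk>i \<in> I; j \<in> I\<rbrakk> \<Longrightarrow> {a \<triangleright> b | a b. a \<in> part Q i \<and> b \<in> part Q j} = part Q i"

definition grade :: "'i set \<Rightarrow> ('q, 'i) graded_quandle \<Rightarrow> 'q \<Rightarrow> 'i"
  where "grade I Q a = (THE i. i \<in> I \<and> a \<in> part Q i)"

definition graded_quandle_hom ::
    "'i set \<Rightarrow> ('p, 'i) graded_quandle \<Rightarrow> ('q, 'i) graded_quandle \<Rightarrow> ('p \<Rightarrow> 'q) set"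
  where "graded_quandle_hom I Q' Q = {\<phi> \<in> quandle_hom Q' Q. \<forall>i\<in>I. \<phi> ` part Q' i \<subseteq> part Q i}"

text \<open>
  A graded group \<open>\<Lambda> = (\<Prod>i\<in>I. \<Lambda> i)\<close> is given by the family of its factors. Elements of
  \<open>\<Lambda>\<close> only ever act in degree \<open>i\<close> through their component in \<open>\<Lambda> i\<close>, and graded
  homomorphisms are families of homomorphisms of the factors.
\<close>

definition graded_group :: "'i set \<Rightarrow> ('i \<Rightarrow> ('g, 'm) monoid_scheme) \<Rightarrow> bool"
  where "graded_group I \<Lambda> \<longleftrightarrow> (\<forall>i\<in>I. group (\<Lambda> i))"

definition graded_comm_group :: "'i set \<Rightarrow> ('i \<Rightarrow> ('g, 'm) monoid_scheme) \<Rightarrow> bool"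
  where "graded_comm_group I \<Lambda> \<longleftrightarrow> (\<forall>i\<in>I. comm_group (\<Lambda> i))"

definition graded_hom ::
    "'i set \<Rightarrow> ('i \<Rightarrow> ('g, 'm) monoid_scheme) \<Rightarrow> ('i \<Rightarrow> ('h, 'n) monoid_scheme) \<Rightarrow> ('i \<Rightarrow> 'g \<Rightarrow> 'h) set"
  where "graded_hom I \<Lambda> \<Lambda>' = {h. \<forall>i\<in>I. h i \<in> hom (\<Lambda> i) (\<Lambda>' i)}"


section \<open>Graded extensions\<close>

record ('x, 'q, 'i, 'g) extension = "'x quandle" +
  proj :: "'x \<Rightarrow> 'q"
  act :: "'i \<Rightarrow> 'g \<Rightarrow> 'x \<Rightarrow> 'x"

definition total_part :: "('q, 'i) graded_quandle \<Rightarrow> ('x, 'q, 'i, 'g) extension \<Rightarrow> 'i \<Rightarrow> 'x set"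
  where "total_part Q E i = {x \<in> carrier E. proj E x \<in> part Q i}"

locale graded_extension = quandle E
  for I :: "'i set" and Q :: "('q, 'i) graded_quandle" and \<Lambda> :: "'i \<Rightarrow> ('g, 'm) monoid_scheme"
    and E :: "('x, 'q, 'i, 'g) extension" (structure) +
  assumes proj_hom: "proj E \<in> quandle_hom E Q"
    and proj_surj: "proj E ` carrier E = carrier Q"
    and action: "i \<in> I \<Longrightarrow> group_action (\<Lambda> i) (total_part Q E i) (act E i)"
    and act_op: "\<lbrakk>i \<in> I; l \<in> carrier (\<Lambda> i); x \<in> total_part Q E i; y \<in> carrier E\<rbrakk>
      \<Longrightarrow> act E i l x \<triangleright> y = act E i l (x \<triangleright> y)"
    and op_act: "\<lbrakk>i \<in> I; l \<in> carrier (\<Lambda> i); x \<in> carrier E; y \<in> total_part Q E i\<rbrakk>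
      \<Longrightarrow> x \<triangleright> act E i l y = x \<triangleright> y"
    and act_fibre: "\<lbrakk>i \<in> I; l \<in> carrier (\<Lambda> i); x \<in> total_part Q E i\<rbrakk>
      \<Longrightarrow> proj E (act E i l x) = proj E x"
    and act_free: "\<lbrakk>i \<in> I; l \<in> carrier (\<Lambda> i); x \<in> total_part Q E i; act E i l x = x\<rbrakk>
      \<Longrightarrow> l = \<one>\<^bsub>\<Lambda> i\<^esub>"
    and act_transitive: "\<lbrakk>i \<in> I; x \<in> total_part Q E i; y \<in> total_part Q E i; proj E x = proj E y\<rbrakk>
      \<Longrightarrow> \<exists>l\<in>carrier (\<Lambda> i). act E i l x = y"

definition ext_equiv :: "'i set \<Rightarrow> ('q, 'i) graded_quandle \<Rightarrow> ('i \<Rightarrow> ('g, 'm) monoid_scheme) \<Rightarrow>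
    ('x, 'q, 'i, 'g) extension \<Rightarrow> ('y, 'q, 'i, 'g) extension \<Rightarrow> bool"
  where "ext_equiv I Q \<Lambda> E1 E2 \<longleftrightarrow> (\<exists>\<phi>. \<phi> \<in> quandle_hom E1 E2 \<and>
    bij_betw \<phi> (carrier E1) (carrier E2) \<and>
    (\<forall>x\<in>carrier E1. proj E1 x = proj E2 (\<phi> x)) \<and>
    (\<forall>i\<in>I. \<forall>l\<in>carrier (\<Lambda> i). \<forall>x\<in>total_part Q E1 i. \<phi> (act E1 i l x) = act E2 i l (\<phi> x)))"

text \<open>
  HOL has no set of all extensions irrespective of the type of the total space, so \<open>Ext\<close> is formed
  from the extensions with total space in \<open>'q \<times> 'g\<close>. As \<open>\<Lambda> i\<close> acts simply transitively on the
  fibres over \<open>part Q i\<close>, this type is large enough for every equivalence class to be represented.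
  \<open>ext_class I Q \<Lambda> E\<close> is defined for \<open>E\<close> over any type \<open>'x\<close>; for \<open>'x = 'q \<times> 'g\<close>
  it is literally the equivalence class of \<open>E\<close>.
\<close>

definition ext_class :: "'i set \<Rightarrow> ('q, 'i) graded_quandle \<Rightarrow> ('i \<Rightarrow> ('g, 'm) monoid_scheme) \<Rightarrow>
    ('x, 'q, 'i, 'g) extension \<Rightarrow> ('q \<times> 'g, 'q, 'i, 'g) extension set"
  where "ext_class I Q \<Lambda> E = {E'. graded_extension I Q \<Lambda> E' \<and> ext_equiv I Q \<Lambda> E E'}"

definition Ext :: "'i set \<Rightarrow> ('q, 'i) graded_quandle \<Rightarrow> ('i \<Rightarrow> ('g, 'm) monoid_scheme) \<Rightarrow>
    ('q \<times> 'g, 'q, 'i, 'g) extension set set"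
  where "Ext I Q \<Lambda> = {ext_class I Q \<Lambda> E | E :: ('q \<times> 'g, 'q, 'i, 'g) extension.
    graded_extension I Q \<Lambda> E}"


section \<open>Second cohomology\<close>

text \<open>
  Cochains are extensional functions on \<open>carrier Q \<times> carrier Q\<close>. Values in the disjoint union of
  the \<open>\<Lambda> i\<close> need no tag, since the degree is that of the first argument.
\<close>

definition C2 :: "'i set \<Rightarrow> ('q, 'i) graded_quandle \<Rightarrow> ('i \<Rightarrow> ('g, 'm) monoid_scheme) \<Rightarrow>
    ('q \<times> 'q \<Rightarrow> 'g) set"
  where "C2 I Q \<Lambda> = {f \<in> extensional (carrier Q \<times> carrier Q).
    \<forall>i\<in>I. \<forall>a\<in>part Q i. \<forall>b\<in>carrier Q. f (a, b) \<in> carrier (\<Lambda> i)}"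

definition Z2 :: "'i set \<Rightarrow> ('q, 'i) graded_quandle \<Rightarrow> ('i \<Rightarrow> ('g, 'm) monoid_scheme) \<Rightarrow>
    ('q \<times> 'q \<Rightarrow> 'g) set"
  where "Z2 I Q \<Lambda> = {f \<in> C2 I Q \<Lambda>. \<forall>i\<in>I. \<forall>a\<in>part Q i.
    f (a, a) = \<one>\<^bsub>\<Lambda> i\<^esub> \<and>
    (\<forall>b\<in>carrier Q. \<forall>c\<in>carrier Q.
      f (a, b) \<otimes>\<^bsub>\<Lambda> i\<^esub> f (a \<triangleright>\<^bsub>Q\<^esub> b, c) = f (a, c) \<otimes>\<^bsub>\<Lambda> i\<^esub> f (a \<triangleright>\<^bsub>Q\<^esub> c, b \<triangleright>\<^bsub>Q\<^esub> c))}"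

definition cohomologous :: "'i set \<Rightarrow> ('q, 'i) graded_quandle \<Rightarrow> ('i \<Rightarrow> ('g, 'm) monoid_scheme) \<Rightarrow>
    (('q \<times> 'q \<Rightarrow> 'g) \<times> ('q \<times> 'q \<Rightarrow> 'g)) set"
  where "cohomologous I Q \<Lambda> = {(f, f'). f \<in> Z2 I Q \<Lambda> \<and> f' \<in> Z2 I Q \<Lambda> \<and>
    (\<exists>g :: 'q \<Rightarrow> 'g. (\<forall>i\<in>I. \<forall>a\<in>part Q i. g a \<in> carrier (\<Lambda> i)) \<and>
      (\<forall>i\<in>I. \<forall>a\<in>part Q i. \<forall>b\<in>carrier Q.
        f (a, b) = inv\<^bsub>\<Lambda> i\<^esub> (g a) \<otimes>\<^bsub>\<Lambda> i\<^esub> f' (a, b) \<otimes>\<^bsub>\<Lambda> i\<^esub> g (a \<triangleright>\<^bsub>Q\<^esub> b)))}"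

definition coh_class :: "'i set \<Rightarrow> ('q, 'i) graded_quandle \<Rightarrow> ('i \<Rightarrow> ('g, 'm) monoid_scheme) \<Rightarrow>
    ('q \<times> 'q \<Rightarrow> 'g) \<Rightarrow> ('q \<times> 'q \<Rightarrow> 'g) set"
  where "coh_class I Q \<Lambda> f = cohomologous I Q \<Lambda> `` {f}"

definition H2 :: "'i set \<Rightarrow> ('q, 'i) graded_quandle \<Rightarrow> ('i \<Rightarrow> ('g, 'm) monoid_scheme) \<Rightarrow>
    ('q \<times> 'q \<Rightarrow> 'g) set set"
  where "H2 I Q \<Lambda> = Z2 I Q \<Lambda> // cohomologous I Q \<Lambda>"


section \<open>The map from extensions to cohomology\<close>

definition is_section :: "('q, 'i) graded_quandle \<Rightarrow> ('x, 'q, 'i, 'g) extension \<Rightarrow> ('q \<Rightarrow> 'x) \<Rightarrow> bool"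
  where "is_section Q E s \<longleftrightarrow> (\<forall>a\<in>carrier Q. s a \<in> carrier E \<and> proj E (s a) = a)"

definition section_cochain :: "'i set \<Rightarrow> ('q, 'i) graded_quandle \<Rightarrow> ('i \<Rightarrow> ('g, 'm) monoid_scheme) \<Rightarrow>
    ('x, 'q, 'i, 'g) extension \<Rightarrow> ('q \<Rightarrow> 'x) \<Rightarrow> ('q \<times> 'q \<Rightarrow> 'g) \<Rightarrow> bool"
  where "section_cochain I Q \<Lambda> E s f \<longleftrightarrow> f \<in> C2 I Q \<Lambda> \<and>
    (\<forall>i\<in>I. \<forall>a\<in>part Q i. \<forall>b\<in>carrier Q.
      s a \<triangleright>\<^bsub>E\<^esub> s b = act E i (f (a, b)) (s (a \<triangleright>\<^bsub>Q\<^esub> b)))"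

definition Phi :: "'i set \<Rightarrow> ('q, 'i) graded_quandle \<Rightarrow> ('i \<Rightarrow> ('g, 'm) monoid_scheme) \<Rightarrow>
    ('x, 'q, 'i, 'g) extension \<Rightarrow> ('q \<times> 'q \<Rightarrow> 'g) set"
  where "Phi I Q \<Lambda> E =
    coh_class I Q \<Lambda> (THE f. section_cochain I Q \<Lambda> E (SOME s. is_section Q E s) f)"

definition Phi_Ext :: "'i set \<Rightarrow> ('q, 'i) graded_quandle \<Rightarrow> ('i \<Rightarrow> ('g, 'm) monoid_scheme) \<Rightarrow>
    ('q \<times> 'g, 'q, 'i, 'g) extension set \<Rightarrow> ('q \<times> 'q \<Rightarrow> 'g) set"
  where "Phi_Ext I Q \<Lambda> U = the_elem (Phi I Q \<Lambda> ` U)"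


section \<open>Functoriality\<close>

definition push_rel :: "'i set \<Rightarrow> ('q, 'i) graded_quandle \<Rightarrow> ('i \<Rightarrow> ('g, 'm) monoid_scheme) \<Rightarrow>
    ('i \<Rightarrow> ('h, 'n) monoid_scheme) \<Rightarrow> ('i \<Rightarrow> 'g \<Rightarrow> 'h) \<Rightarrow> ('x, 'q, 'i, 'g) extension \<Rightarrow>
    (('h \<times> 'x) \<times> ('h \<times> 'x)) set"
  where "push_rel I Q \<Lambda> \<Lambda>' h E =
    {((l', act E i l a), (l' \<otimes>\<^bsub>\<Lambda>' i\<^esub> h i l, a)) | i l' l a.
      i \<in> I \<and> l' \<in> carrier (\<Lambda>' i) \<and> l \<in> carrier (\<Lambda> i) \<and> a \<in> total_part Q E i}"

definition push_forward :: "'i set \<Rightarrow> ('q, 'i) graded_quandle \<Rightarrow> ('i \<Rightarrow> ('g, 'm) monoid_scheme) \<Rightarrow>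
    ('i \<Rightarrow> ('h, 'n) monoid_scheme) \<Rightarrow> ('i \<Rightarrow> 'g \<Rightarrow> 'h) \<Rightarrow> ('x, 'q, 'i, 'g) extension \<Rightarrow>
    (('h \<times> 'x) set, 'q, 'i, 'h) extension"
  where "push_forward I Q \<Lambda> \<Lambda>' h E = (let r = push_rel I Q \<Lambda> \<Lambda>' h E in
    \<lparr>carrier = (\<Union>i\<in>I. carrier (\<Lambda>' i) \<times> total_part Q E i) // r,
     qop = (\<lambda>U V. \<Union>(l, a)\<in>U. \<Union>(m, b)\<in>V. r `` {(l, a \<triangleright>\<^bsub>E\<^esub> b)}),
     qbar = (\<lambda>U V. \<Union>(l, a)\<in>U. \<Union>(m, b)\<in>V. r `` {(l, a \<triangleleft>\<^bsub>E\<^esub> b)}),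
     proj = (\<lambda>U. the_elem ((\<lambda>(l, a). proj E a) ` U)),
     act = (\<lambda>i k. \<lambda>U\<in>(carrier (\<Lambda>' i) \<times> total_part Q E i) // r.
       \<Union>(l, a)\<in>U. r `` {(k \<otimes>\<^bsub>\<Lambda>' i\<^esub> l, a)})\<rparr>)"

definition Ext_push :: "'i set \<Rightarrow> ('q, 'i) graded_quandle \<Rightarrow> ('i \<Rightarrow> ('g, 'm) monoid_scheme) \<Rightarrow>
    ('i \<Rightarrow> ('h, 'n) monoid_scheme) \<Rightarrow> ('i \<Rightarrow> 'g \<Rightarrow> 'h) \<Rightarrow>
    ('q \<times> 'g, 'q, 'i, 'g) extension set \<Rightarrow> ('q \<times> 'h, 'q, 'i, 'h) extension set"
  where "Ext_push I Q \<Lambda> \<Lambda>' h U = (\<Union>E\<in>U. ext_class I Q \<Lambda>' (push_forward I Q \<Lambda> \<Lambda>' h E))"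

definition cochain_push :: "'i set \<Rightarrow> ('q, 'i) graded_quandle \<Rightarrow> ('i \<Rightarrow> 'g \<Rightarrow> 'h) \<Rightarrow>
    ('q \<times> 'q \<Rightarrow> 'g) \<Rightarrow> ('q \<times> 'q \<Rightarrow> 'h)"
  where "cochain_push I Q h f = (\<lambda>(a, b)\<in>carrier Q \<times> carrier Q. h (grade I Q a) (f (a, b)))"

definition H2_push :: "'i set \<Rightarrow> ('q, 'i) graded_quandle \<Rightarrow> ('i \<Rightarrow> ('h, 'n) monoid_scheme) \<Rightarrow>
    ('i \<Rightarrow> 'g \<Rightarrow> 'h) \<Rightarrow> ('q \<times> 'q \<Rightarrow> 'g) set \<Rightarrow> ('q \<times> 'q \<Rightarrow> 'h) set"
  where "H2_push I Q \<Lambda>' h c = (\<Union>f\<in>c. coh_class I Q \<Lambda>' (cochain_push I Q h f))"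

definition pull_back :: "('p, 'i) graded_quandle \<Rightarrow> ('p \<Rightarrow> 'q) \<Rightarrow> ('x, 'q, 'i, 'g) extension \<Rightarrow>
    ('p \<times> 'x, 'p, 'i, 'g) extension"
  where "pull_back Q' \<phi> E =
    \<lparr>carrier = {(a, x). a \<in> carrier Q' \<and> x \<in> carrier E \<and> \<phi> a = proj E x},
     qop = (\<lambda>(a, x) (b, y). (a \<triangleright>\<^bsub>Q'\<^esub> b, x \<triangleright>\<^bsub>E\<^esub> y)),
     qbar = (\<lambda>(a, x) (b, y). (a \<triangleleft>\<^bsub>Q'\<^esub> b, x \<triangleleft>\<^bsub>E\<^esub> y)),
     proj = fst,
     act = (\<lambda>i l. \<lambda>(a, x)\<in>{(a, x). a \<in> part Q' i \<and> x \<in> carrier E \<and> \<phi> a = proj E x}.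
       (a, act E i l x))\<rparr>"

definition Ext_pull :: "'i set \<Rightarrow> ('i \<Rightarrow> ('g, 'm) monoid_scheme) \<Rightarrow> ('p, 'i) graded_quandle \<Rightarrow>
    ('p \<Rightarrow> 'q) \<Rightarrow> ('q \<times> 'g, 'q, 'i, 'g) extension set \<Rightarrow> ('p \<times> 'g, 'p, 'i, 'g) extension set"
  where "Ext_pull I \<Lambda> Q' \<phi> U = (\<Union>E\<in>U. ext_class I Q' \<Lambda> (pull_back Q' \<phi> E))"

definition cochain_pull :: "('p, 'i) graded_quandle \<Rightarrow> ('p \<Rightarrow> 'q) \<Rightarrow>
    ('q \<times> 'q \<Rightarrow> 'g) \<Rightarrow> ('p \<times> 'p \<Rightarrow> 'g)"
  where "cochain_pull Q' \<phi> f = (\<lambda>(a, b)\<in>carrier Q' \<times> carrier Q'. f (\<phi> a, \<phi> b))"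

definition H2_pull :: "'i set \<Rightarrow> ('i \<Rightarrow> ('g, 'm) monoid_scheme) \<Rightarrow> ('p, 'i) graded_quandle \<Rightarrow>
    ('p \<Rightarrow> 'q) \<Rightarrow> ('q \<times> 'q \<Rightarrow> 'g) set \<Rightarrow> ('p \<times> 'p \<Rightarrow> 'g) set"
  where "H2_pull I \<Lambda> Q' \<phi> c = (\<Union>f\<in>c. coh_class I Q' \<Lambda> (cochain_pull Q' \<phi> f))"


section \<open>Group structures for abelian coefficients\<close>

definition cochain_mult :: "'i set \<Rightarrow> ('q, 'i) graded_quandle \<Rightarrow> ('i \<Rightarrow> ('g, 'm) monoid_scheme) \<Rightarrow>
    ('q \<times> 'q \<Rightarrow> 'g) \<Rightarrow> ('q \<times> 'q \<Rightarrow> 'g) \<Rightarrow> ('q \<times> 'q \<Rightarrow> 'g)"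
  where "cochain_mult I Q \<Lambda> f f' =
    (\<lambda>(a, b)\<in>carrier Q \<times> carrier Q. f (a, b) \<otimes>\<^bsub>\<Lambda> (grade I Q a)\<^esub> f' (a, b))"

definition cochain_one :: "'i set \<Rightarrow> ('q, 'i) graded_quandle \<Rightarrow> ('i \<Rightarrow> ('g, 'm) monoid_scheme) \<Rightarrow>
    ('q \<times> 'q \<Rightarrow> 'g)"
  where "cochain_one I Q \<Lambda> = (\<lambda>(a, b)\<in>carrier Q \<times> carrier Q. \<one>\<^bsub>\<Lambda> (grade I Q a)\<^esub>)"

definition H2_group :: "'i set \<Rightarrow> ('q, 'i) graded_quandle \<Rightarrow> ('i \<Rightarrow> ('g, 'm) monoid_scheme) \<Rightarrow>
    ('q \<times> 'q \<Rightarrow> 'g) set monoid"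
  where "H2_group I Q \<Lambda> =
    \<lparr>carrier = H2 I Q \<Lambda>,
     mult = (\<lambda>c d. \<Union>f\<in>c. \<Union>f'\<in>d. coh_class I Q \<Lambda> (cochain_mult I Q \<Lambda> f f')),
     one = coh_class I Q \<Lambda> (cochain_one I Q \<Lambda>)\<rparr>"

definition fibre_product :: "('x, 'q, 'i, 'g) extension \<Rightarrow> ('y, 'q, 'i, 'g) extension \<Rightarrow> ('x \<times> 'y) set"
  where "fibre_product E1 E2 =
    {(a1, a2). a1 \<in> carrier E1 \<and> a2 \<in> carrier E2 \<and> proj E1 a1 = proj E2 a2}"

definition sum_rel :: "'i set \<Rightarrow> ('q, 'i) graded_quandle \<Rightarrow> ('i \<Rightarrow> ('g, 'm) monoid_scheme) \<Rightarrow>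
    ('x, 'q, 'i, 'g) extension \<Rightarrow> ('y, 'q, 'i, 'g) extension \<Rightarrow> (('x \<times> 'y) \<times> ('x \<times> 'y)) set"
  where "sum_rel I Q \<Lambda> E1 E2 =
    {((act E1 i l a1, a2), (a1, act E2 i l a2)) | i l a1 a2.
      i \<in> I \<and> l \<in> carrier (\<Lambda> i) \<and> (a1, a2) \<in> fibre_product E1 E2 \<and> a1 \<in> total_part Q E1 i}"

definition ext_sum :: "'i set \<Rightarrow> ('q, 'i) graded_quandle \<Rightarrow> ('i \<Rightarrow> ('g, 'm) monoid_scheme) \<Rightarrow>
    ('x, 'q, 'i, 'g) extension \<Rightarrow> ('y, 'q, 'i, 'g) extension \<Rightarrow> (('x \<times> 'y) set, 'q, 'i, 'g) extension"
  where "ext_sum I Q \<Lambda> E1 E2 = (let r = sum_rel I Q \<Lambda> E1 E2 in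
    \<lparr>carrier = fibre_product E1 E2 // r,
     qop = (\<lambda>U V. \<Union>(a1, a2)\<in>U. \<Union>(b1, b2)\<in>V. r `` {(a1 \<triangleright>\<^bsub>E1\<^esub> b1, a2 \<triangleright>\<^bsub>E2\<^esub> b2)}),
     qbar = (\<lambda>U V. \<Union>(a1, a2)\<in>U. \<Union>(b1, b2)\<in>V. r `` {(a1 \<triangleleft>\<^bsub>E1\<^esub> b1, a2 \<triangleleft>\<^bsub>E2\<^esub> b2)}),
     proj = (\<lambda>U. the_elem ((\<lambda>(a1, a2). proj E1 a1) ` U)),
     act = (\<lambda>i l. \<lambda>U\<in>(fibre_product E1 E2 \<inter> (total_part Q E1 i \<times> total_part Q E2 i)) // r.
       \<Union>(a1, a2)\<in>U. r `` {(act E1 i l a1, a2)})\<rparr>)"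

text \<open>
  The extension of the constant cocycle \<open>1\<close>; its class is the neutral element for \<open>ext_sum\<close>.
\<close>

definition trivial_ext :: "'i set \<Rightarrow> ('q, 'i) graded_quandle \<Rightarrow> ('i \<Rightarrow> ('g, 'm) monoid_scheme) \<Rightarrow>
    ('q \<times> 'g, 'q, 'i, 'g) extension"
  where "trivial_ext I Q \<Lambda> =
    \<lparr>carrier = (\<Union>i\<in>I. part Q i \<times> carrier (\<Lambda> i)),
     qop = (\<lambda>(a, l) (b, m). (a \<triangleright>\<^bsub>Q\<^esub> b, l)),
     qbar = (\<lambda>(a, l) (b, m). (a \<triangleleft>\<^bsub>Q\<^esub> b, l)),
     proj = fst,
     act = (\<lambda>i k. \<lambda>(a, l)\<in>part Q i \<times> carrier (\<Lambda> i). (a, k \<otimes>\<^bsub>\<Lambda> i\<^esub> l))\<rparr>"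

definition Ext_group :: "'i set \<Rightarrow> ('q, 'i) graded_quandle \<Rightarrow> ('i \<Rightarrow> ('g, 'm) monoid_scheme) \<Rightarrow>
    ('q \<times> 'g, 'q, 'i, 'g) extension set monoid"
  where "Ext_group I Q \<Lambda> =
    \<lparr>carrier = Ext I Q \<Lambda>,
     mult = (\<lambda>U V. \<Union>E1\<in>U. \<Union>E2\<in>V. ext_class I Q \<Lambda> (ext_sum I Q \<Lambda> E1 E2)),
     one = ext_class I Q \<Lambda> (trivial_ext I Q \<Lambda>)\<rparr>"


section \<open>Module structures\<close>

text \<open>
  The library locale \<^locale>\<open>module\<close> requires a commutative ring of scalars; here any ring
  (with unit) is allowed, acting from the left.
\<close>

locale left_module = R?: ring R + M?: abelian_group M
  for R :: "('r, 'm) ring_scheme" (structure) and M :: "('r, 'a, 'n) module_scheme" (structure) +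
  assumes smult_closed: "\<lbrakk>r \<in> carrier R; x \<in> carrier M\<rbrakk> \<Longrightarrow> r \<odot>\<^bsub>M\<^esub> x \<in> carrier M"
    and smult_l_distr: "\<lbrakk>r \<in> carrier R; s \<in> carrier R; x \<in> carrier M\<rbrakk>
      \<Longrightarrow> (r \<oplus> s) \<odot>\<^bsub>M\<^esub> x = r \<odot>\<^bsub>M\<^esub> x \<oplus>\<^bsub>M\<^esub> s \<odot>\<^bsub>M\<^esub> x"
    and smult_r_distr: "\<lbrakk>r \<in> carrier R; x \<in> carrier M; y \<in> carrier M\<rbrakk>
      \<Longrightarrow> r \<odot>\<^bsub>M\<^esub> (x \<oplus>\<^bsub>M\<^esub> y) = r \<odot>\<^bsub>M\<^esub> x \<oplus>\<^bsub>M\<^esub> r \<odot>\<^bsub>M\<^esub> y"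
    and smult_assoc1: "\<lbrakk>r \<in> carrier R; s \<in> carrier R; x \<in> carrier M\<rbrakk>
      \<Longrightarrow> (r \<otimes> s) \<odot>\<^bsub>M\<^esub> x = r \<odot>\<^bsub>M\<^esub> (s \<odot>\<^bsub>M\<^esub> x)"
    and smult_one: "x \<in> carrier M \<Longrightarrow> \<one> \<odot>\<^bsub>M\<^esub> x = x"

definition left_module_hom :: "('r, 'm) ring_scheme \<Rightarrow> ('r, 'a, 'n) module_scheme \<Rightarrow>
    ('r, 'b, 'k) module_scheme \<Rightarrow> ('a \<Rightarrow> 'b) set"
  where "left_module_hom R M N = {h \<in> carrier M \<rightarrow> carrier N.
    (\<forall>x\<in>carrier M. \<forall>y\<in>carrier M. h (x \<oplus>\<^bsub>M\<^esub> y) = h x \<oplus>\<^bsub>N\<^esub> h y) \<and>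
    (\<forall>r\<in>carrier R. \<forall>x\<in>carrier M. h (r \<odot>\<^bsub>M\<^esub> x) = r \<odot>\<^bsub>N\<^esub> h x)}"

definition left_module_iso :: "('r, 'm) ring_scheme \<Rightarrow> ('r, 'a, 'n) module_scheme \<Rightarrow>
    ('r, 'b, 'k) module_scheme \<Rightarrow> ('a \<Rightarrow> 'b) set"
  where "left_module_iso R M N = {h \<in> left_module_hom R M N. bij_betw h (carrier M) (carrier N)}"

abbreviation add_grp ::
    "('i \<Rightarrow> ('r, 'g, 'n) module_scheme) \<Rightarrow> ('i \<Rightarrow> ('g, _) monoid_scheme)"
  where "add_grp M \<equiv> (\<lambda>i. add_monoid (M i))"

definition scalar :: "('i \<Rightarrow> ('r, 'g, 'n) module_scheme) \<Rightarrow> 'r \<Rightarrow> 'i \<Rightarrow> 'g \<Rightarrow> 'g"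
  where "scalar M r = (\<lambda>i x. r \<odot>\<^bsub>M i\<^esub> x)"

text \<open>
  The fields \<open>mult\<close> and \<open>one\<close> of the module record are those of a ring and play no role for modules.
\<close>

definition Ext_module :: "'i set \<Rightarrow> ('q, 'i) graded_quandle \<Rightarrow> ('i \<Rightarrow> ('r, 'g, 'n) module_scheme) \<Rightarrow>
    ('r, ('q \<times> 'g, 'q, 'i, 'g) extension set) module"
  where "Ext_module I Q M =
    \<lparr>carrier = Ext I Q (add_grp M), mult = undefined, one = undefined,
     zero = \<one>\<^bsub>Ext_group I Q (add_grp M)\<^esub>,
     add = (\<lambda>U V. U \<otimes>\<^bsub>Ext_group I Q (add_grp M)\<^esub> V),
     smult = (\<lambda>r. Ext_push I Q (add_grp M) (add_grp M) (scalar M r))\<rparr>"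

text \<open>\<open>cochain_push I Q (scalar M r)\<close> is pointwise multiplication of cochains by \<open>r\<close>.\<close>

definition H2_module :: "'i set \<Rightarrow> ('q, 'i) graded_quandle \<Rightarrow> ('i \<Rightarrow> ('r, 'g, 'n) module_scheme) \<Rightarrow>
    ('r, ('q \<times> 'q \<Rightarrow> 'g) set) module"
  where "H2_module I Q M =
    \<lparr>carrier = H2 I Q (add_grp M), mult = undefined, one = undefined,
     zero = \<one>\<^bsub>H2_group I Q (add_grp M)\<^esub>,
     add = (\<lambda>c d. c \<otimes>\<^bsub>H2_group I Q (add_grp M)\<^esub> d),
     smult = (\<lambda>r c. \<Union>f\<in>c. coh_class I Q (add_grp M) (cochain_push I Q (scalar M r) f))\<rparr>"

end

theory Submission
  imports Defs
begin

text \<open>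
  Choosing a section of an extension \<open>E\<close> over \<open>Q\<close> puts coordinates on its total space: since
  \<open>\<Lambda> i\<close> acts simply transitively on each fibre over \<open>part Q i\<close>, every point over \<open>a\<close> is \<open>l\<close> applied
  to the chosen point, for exactly one \<open>l\<close>. In such coordinates the action is left multiplication,
  and the compatibility of the action with the operation forces the latter to be
  \<open>(a, l) \<triangleright> (b, m) = (a \<triangleright> b, l f(a, b))\<close> for a single function \<open>f\<close>; idempotence and
  self-distributivity say that \<open>f\<close> is a normalised cocycle. Conversely
  these formulas turn any cocycle into an extension. The locale \<open>trivialized_extension\<close> packages
  such coordinates, and \<open>extension_section.trivialized_by_section\<close> and
  \<open>trivialized_extension.is_graded_extension\<close> are the two directions.

  An equivariant map over \<open>Q\<close> between two extensions in coordinates is, over each \<open>a\<close>, right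
  multiplication by some \<open>g a\<close>, and it respects the quandle operations exactly when \<open>g\<close> makes the two
  cocycles cohomologous. Hence equivalence of extensions is equality of the classes \<open>Phi\<close>
  (\<open>ext_equiv_iff_Phi\<close>). Independence of the section is the case of the identity map, and the
  equivalence classes of extensions are exactly the fibres of \<open>Phi\<close>, written \<open>ext_with_class c\<close>.

  Push-forward, pull-back and sum of extensions are never checked against the axioms of an extension
  directly. Each is given coordinates built from those of its ingredients, whose cocycle is the
  pushed, pulled or multiplied cocycle. This shows at once that the construction is an extension and
  what its class is. Every structure on \<open>Ext\<close> thereby becomes the one on \<open>H2\<close> transported along
  \<open>ext_with_class\<close>, and all group and module laws are pointwise identities of cochains.

  Throughout, \<open>\<Lambda>at a\<close> denotes the factor of \<open>\<Lambda>\<close> in the degree of the point \<open>a\<close>. As the operation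
  preserves the degree of its left argument, every identity of cochains lives in one such group.
\<close>

section \<open>Degrees\<close>

text \<open>Right translation by \<open>\<phi> b\<close> is injective, and it sends both sides to \<open>\<phi> a\<close>.\<close>

lemma quandle_hom_bar:
  assumes "quandle P" and "quandle Q" and "\<phi> \<in> quandle_hom P Q"
    and "a \<in> carrier P" and "b \<in> carrier P"
  shows "\<phi> (a \<triangleleft>\<^bsub>P\<^esub> b) = \<phi> a \<triangleleft>\<^bsub>Q\<^esub> \<phi> b"
proof -
  interpret P: quandle P by fact
  interpret Q: quandle Q by fact
  have "\<phi> (a \<triangleleft>\<^bsub>P\<^esub> b) \<triangleright>\<^bsub>Q\<^esub> \<phi> b = \<phi> a"
    using assms P.bar_closed[of a b] P.bar_op[of a b] unfolding quandle_hom_def by force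
  then show ?thesis
    using assms Q.op_bar[of "\<phi> (a \<triangleleft>\<^bsub>P\<^esub> b)" "\<phi> b"] P.bar_closed by (auto simp: quandle_hom_def Pi_iff)
qed

context graded_quandle
begin

lemma mem_part_iff: "i \<in> I \<Longrightarrow> a \<in> part Q i \<longleftrightarrow> a \<in> carrier Q \<and> grade I Q a = i"
proof -
  have "grade I Q a = j" if "j \<in> I" "a \<in> part Q j" for a j
    unfolding grade_def using that parts_disjoint
    by (intro the_equality) (auto simp: disjoint_family_on_def)
  then show "i \<in> I \<Longrightarrow> ?thesis"
    unfolding parts_cover by blast
qed

lemma grade_in [simp]: "a \<in> carrier Q \<Longrightarrow> grade I Q a \<in> I"
  using parts_cover mem_part_iff by (metis UN_E)

lemma mem_part_grade [simp]: "a \<in> carrier Q \<Longrightarrow> a \<in> part Q (grade I Q a)"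
  by (simp add: mem_part_iff)

text \<open>
  The definitions quantify over degrees and then over the points of that degree; this turns them into
  statements about single points.
\<close>

lemma ball_parts: "(\<forall>i\<in>I. \<forall>a\<in>part Q i. P i a) \<longleftrightarrow> (\<forall>a\<in>carrier Q. P (grade I Q a) a)"
  by (metis grade_in mem_part_iff)

declare op_closed [simp] bar_closed [simp] op_bar [simp] bar_op [simp] idem [simp]

lemma grade_op [simp]:
  assumes "a \<in> carrier Q" and "b \<in> carrier Q"
  shows "grade I Q (a \<triangleright> b) = grade I Q a"
proof -
  have "a \<triangleright> b \<in> part Q (grade I Q a)"
    using parts_op[of "grade I Q a" "grade I Q b"] assms mem_part_grade grade_in by blast
  then show ?thesis
    using assms by (simp add: mem_part_iff)
qed

lemma grade_bar [simp]:
  assumes "a \<in> carrier Q" and "b \<in> carrier Q"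
  shows "grade I Q (a \<triangleleft> b) = grade I Q a"
  using grade_op[of "a \<triangleleft> b" b] assms by simp

end

lemma graded_quandle_hom_grade:
  assumes "graded_quandle I Q'" and "graded_quandle I Q" and "\<phi> \<in> graded_quandle_hom I Q' Q"
    and "a \<in> carrier Q'"
  shows "\<phi> a \<in> carrier Q" and "grade I Q (\<phi> a) = grade I Q' a"
proof -
  have "\<phi> a \<in> part Q (grade I Q' a)"
    using assms graded_quandle.grade_in[OF assms(1)] graded_quandle.mem_part_grade[OF assms(1)]
    unfolding graded_quandle_hom_def by blast
  then show "\<phi> a \<in> carrier Q" and "grade I Q (\<phi> a) = grade I Q' a"
    using graded_quandle.mem_part_iff[OF assms(2)] graded_quandle.grade_in[OF assms(1,4)] by blast+
qed

section \<open>Cocycles and cohomology classes\<close>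

locale graded_coefficients = graded_quandle I Q
  for I :: "'i set" and Q :: "('q, 'i) graded_quandle" (structure) +
  fixes \<Lambda> :: "'i \<Rightarrow> ('g, 'm) monoid_scheme"
  assumes coefficients: "graded_group I \<Lambda>"
begin

abbreviation \<Lambda>at :: "'q \<Rightarrow> ('g, 'm) monoid_scheme"
  where "\<Lambda>at a \<equiv> \<Lambda> (grade I Q a)"

lemma group_at: "a \<in> carrier Q \<Longrightarrow> group (\<Lambda>at a)"
  using coefficients by (simp add: graded_group_def)

lemma C2_iff: "f \<in> C2 I Q \<Lambda> \<longleftrightarrow> f \<in> extensional (carrier Q \<times> carrier Q) \<and>
    (\<forall>a\<in>carrier Q. \<forall>b\<in>carrier Q. f (a, b) \<in> carrier (\<Lambda>at a))"
  by (simp add: C2_def ball_parts[where P = "\<lambda>i a. \<forall>b\<in>carrier Q. f (a, b) \<in> carrier (\<Lambda> i)"])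

lemma Z2_iff: "f \<in> Z2 I Q \<Lambda> \<longleftrightarrow> f \<in> extensional (carrier Q \<times> carrier Q) \<and>
    (\<forall>a\<in>carrier Q. \<forall>b\<in>carrier Q. f (a, b) \<in> carrier (\<Lambda>at a)) \<and>
    (\<forall>a\<in>carrier Q. f (a, a) = \<one>\<^bsub>\<Lambda>at a\<^esub>) \<and>
    (\<forall>a\<in>carrier Q. \<forall>b\<in>carrier Q. \<forall>c\<in>carrier Q.
      f (a, b) \<otimes>\<^bsub>\<Lambda>at a\<^esub> f (a \<triangleright> b, c) = f (a, c) \<otimes>\<^bsub>\<Lambda>at a\<^esub> f (a \<triangleright> c, b \<triangleright> c))"
  unfolding Z2_def mem_Collect_eq C2_iff ball_parts by blast

lemma Z2I:
  assumes "f \<in> extensional (carrier Q \<times> carrier Q)"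
    and "\<And>a b. \<lbrakk>a \<in> carrier Q; b \<in> carrier Q\<rbrakk> \<Longrightarrow> f (a, b) \<in> carrier (\<Lambda>at a)"
    and "\<And>a. a \<in> carrier Q \<Longrightarrow> f (a, a) = \<one>\<^bsub>\<Lambda>at a\<^esub>"
    and "\<And>a b c. \<lbrakk>a \<in> carrier Q; b \<in> carrier Q; c \<in> carrier Q\<rbrakk>
      \<Longrightarrow> f (a, b) \<otimes>\<^bsub>\<Lambda>at a\<^esub> f (a \<triangleright> b, c) = f (a, c) \<otimes>\<^bsub>\<Lambda>at a\<^esub> f (a \<triangleright> c, b \<triangleright> c)"
  shows "f \<in> Z2 I Q \<Lambda>"
  using assms unfolding Z2_iff by blast

lemma Z2_extensional: "f \<in> Z2 I Q \<Lambda> \<Longrightarrow> f \<in> extensional (carrier Q \<times> carrier Q)"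
  and Z2_closed: "\<lbrakk>f \<in> Z2 I Q \<Lambda>; a \<in> carrier Q; b \<in> carrier Q\<rbrakk> \<Longrightarrow> f (a, b) \<in> carrier (\<Lambda>at a)"
  and Z2_diag: "\<lbrakk>f \<in> Z2 I Q \<Lambda>; a \<in> carrier Q\<rbrakk> \<Longrightarrow> f (a, a) = \<one>\<^bsub>\<Lambda>at a\<^esub>"
  and Z2_cocycle: "\<lbrakk>f \<in> Z2 I Q \<Lambda>; a \<in> carrier Q; b \<in> carrier Q; c \<in> carrier Q\<rbrakk>
    \<Longrightarrow> f (a, b) \<otimes>\<^bsub>\<Lambda>at a\<^esub> f (a \<triangleright> b, c) = f (a, c) \<otimes>\<^bsub>\<Lambda>at a\<^esub> f (a \<triangleright> c, b \<triangleright> c)"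
  unfolding Z2_iff by blast+

lemma Z2_closed_bar:
  "\<lbrakk>f \<in> Z2 I Q \<Lambda>; a \<in> carrier Q; b \<in> carrier Q\<rbrakk> \<Longrightarrow> f (a \<triangleleft> b, b) \<in> carrier (\<Lambda>at a)"
  using Z2_closed[of f "a \<triangleleft> b" b] by simp

lemma Z2_closed_op:
  "\<lbrakk>f \<in> Z2 I Q \<Lambda>; a \<in> carrier Q; b \<in> carrier Q; c \<in> carrier Q\<rbrakk> \<Longrightarrow> f (a \<triangleright> b, c) \<in> carrier (\<Lambda>at a)"
  using Z2_closed[of f "a \<triangleright> b" c] by simp

lemmas Z2_simps = Z2_closed Z2_diag Z2_closed_op Z2_closed_bar

text \<open>
  Multiplied by \<open>g a\<close>, the relation becomes one equation between two products. This is the form in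
  which equivalences of extensions produce it, and it composes without cancelling inverses.
\<close>

lemma cohomologous_iff: "(f, f') \<in> cohomologous I Q \<Lambda> \<longleftrightarrow> f \<in> Z2 I Q \<Lambda> \<and> f' \<in> Z2 I Q \<Lambda> \<and>
    (\<exists>g. (\<forall>a\<in>carrier Q. g a \<in> carrier (\<Lambda>at a)) \<and> (\<forall>a\<in>carrier Q. \<forall>b\<in>carrier Q.
      g a \<otimes>\<^bsub>\<Lambda>at a\<^esub> f (a, b) = f' (a, b) \<otimes>\<^bsub>\<Lambda>at a\<^esub> g (a \<triangleright> b)))"
proof -
  have "f (a, b) = inv\<^bsub>\<Lambda>at a\<^esub> (g a) \<otimes>\<^bsub>\<Lambda>at a\<^esub> f' (a, b) \<otimes>\<^bsub>\<Lambda>at a\<^esub> g (a \<triangleright> b) \<longleftrightarrow>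
      g a \<otimes>\<^bsub>\<Lambda>at a\<^esub> f (a, b) = f' (a, b) \<otimes>\<^bsub>\<Lambda>at a\<^esub> g (a \<triangleright> b)"
    if "f \<in> Z2 I Q \<Lambda>" "f' \<in> Z2 I Q \<Lambda>" "\<forall>a\<in>carrier Q. g a \<in> carrier (\<Lambda>at a)"
      "a \<in> carrier Q" "b \<in> carrier Q" for g a b
  proof -
    interpret group "\<Lambda>at a" by (rule group_at) fact
    have "g (a \<triangleright> b) \<in> carrier (\<Lambda>at a)"
      using that(3) op_closed[OF that(4,5)] that by (metis grade_op)
    then show ?thesis
      using that by (auto simp: m_assoc inv_solve_left Z2_simps)
  qed
  then show ?thesis
    unfolding cohomologous_def ball_parts by (simp cong: conj_cong)
qed

lemma cohomologousI:
  assumes "f \<in> Z2 I Q \<Lambda>" and "f' \<in> Z2 I Q \<Lambda>"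
    and "\<And>a. a \<in> carrier Q \<Longrightarrow> g a \<in> carrier (\<Lambda>at a)"
    and "\<And>a b. \<lbrakk>a \<in> carrier Q; b \<in> carrier Q\<rbrakk>
      \<Longrightarrow> g a \<otimes>\<^bsub>\<Lambda>at a\<^esub> f (a, b) = f' (a, b) \<otimes>\<^bsub>\<Lambda>at a\<^esub> g (a \<triangleright> b)"
  shows "(f, f') \<in> cohomologous I Q \<Lambda>"
  using assms unfolding cohomologous_iff by blast

lemma cohomologousE:
  assumes "(f, f') \<in> cohomologous I Q \<Lambda>"
  obtains g where "f \<in> Z2 I Q \<Lambda>" and "f' \<in> Z2 I Q \<Lambda>"
    and "\<And>a. a \<in> carrier Q \<Longrightarrow> g a \<in> carrier (\<Lambda>at a)"
    and "\<And>a b. \<lbrakk>a \<in> carrier Q; b \<in> carrier Q\<rbrakk> \<Longrightarrow> g (a \<triangleright> b) \<in> carrier (\<Lambda>at a)"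
    and "\<And>a b. \<lbrakk>a \<in> carrier Q; b \<in> carrier Q\<rbrakk>
      \<Longrightarrow> g a \<otimes>\<^bsub>\<Lambda>at a\<^esub> f (a, b) = f' (a, b) \<otimes>\<^bsub>\<Lambda>at a\<^esub> g (a \<triangleright> b)"
  using assms grade_op op_closed unfolding cohomologous_iff by metis

lemma equiv_cohomologous: "equiv (Z2 I Q \<Lambda>) (cohomologous I Q \<Lambda>)"
proof (rule equivI)
  show "cohomologous I Q \<Lambda> \<subseteq> Z2 I Q \<Lambda> \<times> Z2 I Q \<Lambda>"
    by (auto simp: cohomologous_def)
  show "refl_on (Z2 I Q \<Lambda>) (cohomologous I Q \<Lambda>)"
  proof (rule refl_onI)
    fix f assume f: "f \<in> Z2 I Q \<Lambda>"
    show "(f, f) \<in> cohomologous I Q \<Lambda>"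
    proof (rule cohomologousI[where g = "\<lambda>a. \<one>\<^bsub>\<Lambda>at a\<^esub>"])
      fix a b assume a: "a \<in> carrier Q" and b: "b \<in> carrier Q"
      interpret group "\<Lambda>at a" by (rule group_at) fact
      show "\<one>\<^bsub>\<Lambda>at a\<^esub> \<otimes>\<^bsub>\<Lambda>at a\<^esub> f (a, b) = f (a, b) \<otimes>\<^bsub>\<Lambda>at a\<^esub> \<one>\<^bsub>\<Lambda>at (a \<triangleright> b)\<^esub>"
        using Z2_simps[OF f] a b by simp
    qed (use f group_at in \<open>auto simp: group.is_monoid monoid.one_closed\<close>)
  qed
  show "sym (cohomologous I Q \<Lambda>)"
  proof (rule symI)
    fix f f' assume "(f, f') \<in> cohomologous I Q \<Lambda>"
    then obtain g where g: "f \<in> Z2 I Q \<Lambda>" "f' \<in> Z2 I Q \<Lambda>"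
      "\<And>a. a \<in> carrier Q \<Longrightarrow> g a \<in> carrier (\<Lambda>at a)"
      "\<And>a b. \<lbrakk>a \<in> carrier Q; b \<in> carrier Q\<rbrakk> \<Longrightarrow> g (a \<triangleright> b) \<in> carrier (\<Lambda>at a)"
      "\<And>a b. \<lbrakk>a \<in> carrier Q; b \<in> carrier Q\<rbrakk>
        \<Longrightarrow> g a \<otimes>\<^bsub>\<Lambda>at a\<^esub> f (a, b) = f' (a, b) \<otimes>\<^bsub>\<Lambda>at a\<^esub> g (a \<triangleright> b)"
      by (erule cohomologousE)
    show "(f', f) \<in> cohomologous I Q \<Lambda>"
    proof (rule cohomologousI[where g = "\<lambda>a. inv\<^bsub>\<Lambda>at a\<^esub> g a"])
      fix a b assume ab: "a \<in> carrier Q" "b \<in> carrier Q"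
      interpret group "\<Lambda>at a" by (rule group_at) fact
      have "g a \<otimes>\<^bsub>\<Lambda>at a\<^esub> f (a, b) \<otimes>\<^bsub>\<Lambda>at a\<^esub> inv\<^bsub>\<Lambda>at a\<^esub> g (a \<triangleright> b) = f' (a, b)"
        using Z2_simps[OF g(1)] Z2_simps[OF g(2)] g(3,4) ab by (simp add: g(5) m_assoc)
      then show "inv\<^bsub>\<Lambda>at a\<^esub> g a \<otimes>\<^bsub>\<Lambda>at a\<^esub> f' (a, b) = f (a, b) \<otimes>\<^bsub>\<Lambda>at a\<^esub> inv\<^bsub>\<Lambda>at (a \<triangleright> b)\<^esub> g (a \<triangleright> b)"
        using Z2_simps[OF g(1)] Z2_simps[OF g(2)] g(3,4) ab by (simp add: m_assoc inv_solve_left')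
    qed (use g group_at group.inv_closed in auto)
  qed
  show "trans (cohomologous I Q \<Lambda>)"
  proof (rule transI)
    fix f f' f'' assume "(f, f') \<in> cohomologous I Q \<Lambda>" and "(f', f'') \<in> cohomologous I Q \<Lambda>"
    then obtain g g' where g: "f \<in> Z2 I Q \<Lambda>" "f' \<in> Z2 I Q \<Lambda>"
      "\<And>a. a \<in> carrier Q \<Longrightarrow> g a \<in> carrier (\<Lambda>at a)"
      "\<And>a b. \<lbrakk>a \<in> carrier Q; b \<in> carrier Q\<rbrakk> \<Longrightarrow> g (a \<triangleright> b) \<in> carrier (\<Lambda>at a)"
      "\<And>a b. \<lbrakk>a \<in> carrier Q; b \<in> carrier Q\<rbrakk>
        \<Longrightarrow> g a \<otimes>\<^bsub>\<Lambda>at a\<^esub> f (a, b) = f' (a, b) \<otimes>\<^bsub>\<Lambda>at a\<^esub> g (a \<triangleright> b)"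
      and g': "f'' \<in> Z2 I Q \<Lambda>"
      "\<And>a. a \<in> carrier Q \<Longrightarrow> g' a \<in> carrier (\<Lambda>at a)"
      "\<And>a b. \<lbrakk>a \<in> carrier Q; b \<in> carrier Q\<rbrakk> \<Longrightarrow> g' (a \<triangleright> b) \<in> carrier (\<Lambda>at a)"
      "\<And>a b. \<lbrakk>a \<in> carrier Q; b \<in> carrier Q\<rbrakk>
        \<Longrightarrow> g' a \<otimes>\<^bsub>\<Lambda>at a\<^esub> f' (a, b) = f'' (a, b) \<otimes>\<^bsub>\<Lambda>at a\<^esub> g' (a \<triangleright> b)"
      by (elim cohomologousE) blast
    note [simp] = Z2_simps[OF g(1)] Z2_simps[OF g(2)] Z2_simps[OF g'(1)]
    show "(f, f'') \<in> cohomologous I Q \<Lambda>"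
    proof (rule cohomologousI[where g = "\<lambda>a. g' a \<otimes>\<^bsub>\<Lambda>at a\<^esub> g a"])
      fix a b assume ab: "a \<in> carrier Q" "b \<in> carrier Q"
      interpret group "\<Lambda>at a" by (rule group_at) fact
      have "g' a \<otimes>\<^bsub>\<Lambda>at a\<^esub> g a \<otimes>\<^bsub>\<Lambda>at a\<^esub> f (a, b) = g' a \<otimes>\<^bsub>\<Lambda>at a\<^esub> f' (a, b) \<otimes>\<^bsub>\<Lambda>at a\<^esub> g (a \<triangleright> b)"
        using g g'(1-3) ab by (simp add: m_assoc)
      also have "\<dots> = f'' (a, b) \<otimes>\<^bsub>\<Lambda>at a\<^esub> (g' (a \<triangleright> b) \<otimes>\<^bsub>\<Lambda>at a\<^esub> g (a \<triangleright> b))"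
        using g(1-4) g' ab by (simp flip: m_assoc)
      finally show "g' a \<otimes>\<^bsub>\<Lambda>at a\<^esub> g a \<otimes>\<^bsub>\<Lambda>at a\<^esub> f (a, b)
          = f'' (a, b) \<otimes>\<^bsub>\<Lambda>at a\<^esub> (g' (a \<triangleright> b) \<otimes>\<^bsub>\<Lambda>at (a \<triangleright> b)\<^esub> g (a \<triangleright> b))"
        using ab by simp
    qed (use g g' group_at in \<open>auto simp: group.is_monoid monoid.m_closed\<close>)
  qed
qed

lemma coh_class_eq_iff:
  assumes "f \<in> Z2 I Q \<Lambda>" and "f' \<in> Z2 I Q \<Lambda>"
  shows "coh_class I Q \<Lambda> f = coh_class I Q \<Lambda> f' \<longleftrightarrow> (f, f') \<in> cohomologous I Q \<Lambda>"
  unfolding coh_class_def by (rule eq_equiv_class_iff[OF equiv_cohomologous assms])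

lemma H2_eq: "H2 I Q \<Lambda> = coh_class I Q \<Lambda> ` Z2 I Q \<Lambda>"
  by (auto simp: H2_def coh_class_def quotient_def)

lemma coh_class_in_H2 [simp]: "f \<in> Z2 I Q \<Lambda> \<Longrightarrow> coh_class I Q \<Lambda> f \<in> H2 I Q \<Lambda>"
  by (simp add: H2_eq)

lemma mem_coh_classD:
  "f' \<in> coh_class I Q \<Lambda> f \<Longrightarrow> f' \<in> Z2 I Q \<Lambda> \<and> (f, f') \<in> cohomologous I Q \<Lambda>"
  by (auto simp: coh_class_def cohomologous_def)

lemma mem_coh_class_self: "f \<in> Z2 I Q \<Lambda> \<Longrightarrow> f \<in> coh_class I Q \<Lambda> f"
  unfolding coh_class_def by (rule equiv_class_self[OF equiv_cohomologous])

end

section \<open>Extensions in coordinates\<close>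

lemma group_action_intro:
  assumes "group G"
    and ext: "\<And>g. g \<in> carrier G \<Longrightarrow> \<psi> g \<in> extensional X"
    and closed: "\<And>g x. \<lbrakk>g \<in> carrier G; x \<in> X\<rbrakk> \<Longrightarrow> \<psi> g x \<in> X"
    and one: "\<And>x. x \<in> X \<Longrightarrow> \<psi> \<one>\<^bsub>G\<^esub> x = x"
    and mult: "\<And>g h x. \<lbrakk>g \<in> carrier G; h \<in> carrier G; x \<in> X\<rbrakk> \<Longrightarrow> \<psi> (g \<otimes>\<^bsub>G\<^esub> h) x = \<psi> g (\<psi> h x)"
  shows "group_action G X \<psi>"
proof -
  interpret group G by fact
  have inverse: "\<psi> (inv\<^bsub>G\<^esub> g) (\<psi> g x) = x" "\<psi> g (\<psi> (inv\<^bsub>G\<^esub> g) x) = x"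
    if "g \<in> carrier G" "x \<in> X" for g x
    using that by (simp_all add: one flip: mult)
  have bij: "\<psi> g \<in> Bij X" if g: "g \<in> carrier G" for g
    unfolding Bij_def using ext[OF g]
    by (auto intro!: bij_betw_byWitness[where f' = "\<psi> (inv\<^bsub>G\<^esub> g)"] simp: g inverse closed)
  have "\<psi> \<in> hom G (BijGroup X)"
  proof (rule homI)
    fix g h assume gh: "g \<in> carrier G" "h \<in> carrier G"
    have "\<psi> (g \<otimes>\<^bsub>G\<^esub> h) = compose X (\<psi> g) (\<psi> h)"
      by (rule extensionalityI[where A = X]) (use gh in \<open>auto simp: ext mult compose_def\<close>)
    then show "\<psi> (g \<otimes>\<^bsub>G\<^esub> h) = \<psi> g \<otimes>\<^bsub>BijGroup X\<^esub> \<psi> h"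
      using gh by (simp add: BijGroup_def bij)
  qed (simp add: BijGroup_def bij)
  then show ?thesis
    by (intro group_action.intro group_hom.intro group_hom_axioms.intro assms(1) group_BijGroup)
qed

text \<open>
  Coordinates on the total space: \<open>t a\<close> identifies the structure group of degree \<open>grade I Q a\<close>
  with the fibre over \<open>a\<close>, so that the action becomes left multiplication and the quandle operation
  is twisted by the cocycle \<open>f\<close>. Such coordinates make \<open>E\<close> a graded extension and determine its
  cohomology class; conversely every section of a graded extension gives rise to them. Each
  construction of extensions below is therefore analysed by exhibiting coordinates on it.
\<close>

locale trivialized_extension = graded_coefficients I Q \<Lambda>
  for I :: "'i set" and Q :: "('q, 'i) graded_quandle" (structure)
    and \<Lambda> :: "'i \<Rightarrow> ('g, 'm) monoid_scheme" +
  fixes E :: "('x, 'q, 'i, 'g) extension" and f :: "'q \<times> 'q \<Rightarrow> 'g" and t :: "'q \<Rightarrow> 'g \<Rightarrow> 'x"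
  assumes cocycle: "f \<in> Z2 I Q \<Lambda>"
    and t_closed [simp]: "\<lbrakk>a \<in> carrier Q; l \<in> carrier (\<Lambda>at a)\<rbrakk> \<Longrightarrow> t a l \<in> carrier E"
    and proj_t [simp]: "\<lbrakk>a \<in> carrier Q; l \<in> carrier (\<Lambda>at a)\<rbrakk> \<Longrightarrow> proj E (t a l) = a"
    and t_surj: "x \<in> carrier E \<Longrightarrow> \<exists>a\<in>carrier Q. \<exists>l\<in>carrier (\<Lambda>at a). x = t a l"
    and t_inj: "\<lbrakk>a \<in> carrier Q; l \<in> carrier (\<Lambda>at a); m \<in> carrier (\<Lambda>at a); t a l = t a m\<rbrakk> \<Longrightarrow> l = m"
    and t_op [simp]: "\<lbrakk>a \<in> carrier Q; b \<in> carrier Q; l \<in> carrier (\<Lambda>at a); m \<in> carrier (\<Lambda>at b)\<rbrakk>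
      \<Longrightarrow> t a l \<triangleright>\<^bsub>E\<^esub> t b m = t (a \<triangleright> b) (l \<otimes>\<^bsub>\<Lambda>at a\<^esub> f (a, b))"
    and t_bar [simp]: "\<lbrakk>a \<in> carrier Q; b \<in> carrier Q; l \<in> carrier (\<Lambda>at a); m \<in> carrier (\<Lambda>at b)\<rbrakk>
      \<Longrightarrow> t a l \<triangleleft>\<^bsub>E\<^esub> t b m = t (a \<triangleleft> b) (l \<otimes>\<^bsub>\<Lambda>at a\<^esub> inv\<^bsub>\<Lambda>at a\<^esub> f (a \<triangleleft> b, b))"
    and act_t [simp]: "\<lbrakk>a \<in> carrier Q; k \<in> carrier (\<Lambda>at a); l \<in> carrier (\<Lambda>at a)\<rbrakk>
      \<Longrightarrow> act E (grade I Q a) k (t a l) = t a (k \<otimes>\<^bsub>\<Lambda>at a\<^esub> l)"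
    and act_extensional: "\<lbrakk>i \<in> I; k \<in> carrier (\<Lambda> i)\<rbrakk> \<Longrightarrow> act E i k \<in> extensional (total_part Q E i)"
begin

lemmas [simp] = cocycle Z2_simps[OF cocycle]

lemma t_cases:
  assumes "x \<in> carrier E"
  obtains a l where "a \<in> carrier Q" and "l \<in> carrier (\<Lambda>at a)" and "x = t a l"
  using t_surj[OF assms] by blast

lemma total_part_cases:
  assumes "i \<in> I" and "x \<in> total_part Q E i"
  obtains a l where "a \<in> carrier Q" and "i = grade I Q a" and "l \<in> carrier (\<Lambda>at a)" and "x = t a l"
  using assms mem_part_iff by (auto simp: total_part_def elim!: t_cases)

lemma t_total_part [simp]:
  "\<lbrakk>a \<in> carrier Q; l \<in> carrier (\<Lambda>at a)\<rbrakk> \<Longrightarrow> t a l \<in> total_part Q E (grade I Q a)"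
  by (simp add: total_part_def)

text \<open>
  Self-distributivity of \<open>Q\<close> matches the base points and the cocycle identity matches the
  coordinates; idempotence uses the normalisation of \<open>f\<close> in the same way.
\<close>

lemma is_quandle: "quandle E"
proof
  fix x y assume "x \<in> carrier E" "y \<in> carrier E"
  then obtain a l b m where x: "a \<in> carrier Q" "l \<in> carrier (\<Lambda>at a)" "x = t a l"
    and y: "b \<in> carrier Q" "m \<in> carrier (\<Lambda>at b)" "y = t b m"
    by (elim t_cases)
  interpret group "\<Lambda>at a" by (rule group_at) fact
  show "x \<triangleright>\<^bsub>E\<^esub> y \<in> carrier E" "x \<triangleleft>\<^bsub>E\<^esub> y \<in> carrier E"
    using x(1,2) y(1,2) by (simp_all add: x y)
  show "(x \<triangleright>\<^bsub>E\<^esub> y) \<triangleleft>\<^bsub>E\<^esub> y = x" "(x \<triangleleft>\<^bsub>E\<^esub> y) \<triangleright>\<^bsub>E\<^esub> y = x"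
    using x(1,2) y(1,2) by (simp_all add: x y m_assoc)
next
  fix x assume "x \<in> carrier E"
  then obtain a l where x: "a \<in> carrier Q" "l \<in> carrier (\<Lambda>at a)" "x = t a l"
    by (elim t_cases)
  interpret group "\<Lambda>at a" by (rule group_at) fact
  show "x \<triangleright>\<^bsub>E\<^esub> x = x"
    using x(1,2) by (simp add: x)
next
  fix x y z assume "x \<in> carrier E" "y \<in> carrier E" "z \<in> carrier E"
  then obtain a l b m c n where x: "a \<in> carrier Q" "l \<in> carrier (\<Lambda>at a)" "x = t a l"
    and y: "b \<in> carrier Q" "m \<in> carrier (\<Lambda>at b)" "y = t b m"
    and z: "c \<in> carrier Q" "n \<in> carrier (\<Lambda>at c)" "z = t c n"
    by (elim t_cases)
  interpret a: group "\<Lambda>at a" by (rule group_at) fact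
  interpret b: group "\<Lambda>at b" by (rule group_at) fact
  show "(x \<triangleright>\<^bsub>E\<^esub> y) \<triangleright>\<^bsub>E\<^esub> z = (x \<triangleright>\<^bsub>E\<^esub> z) \<triangleright>\<^bsub>E\<^esub> (y \<triangleright>\<^bsub>E\<^esub> z)"
    using x(1,2) y(1,2) z(1,2) Z2_cocycle[OF cocycle, of a b c]
    by (simp add: x y z a.m_assoc flip: self_distrib[of a b c])
qed

lemma is_graded_extension: "graded_extension I Q \<Lambda> E"
proof (intro graded_extension.intro graded_extension_axioms.intro is_quandle)
  have proj_op: "proj E (x \<triangleright>\<^bsub>E\<^esub> y) = proj E x \<triangleright> proj E y" "proj E x \<in> carrier Q"
    if xy: "x \<in> carrier E" "y \<in> carrier E" for x y
  proof -
    obtain a l b m where x: "a \<in> carrier Q" "l \<in> carrier (\<Lambda>at a)" "x = t a l"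
      and y: "b \<in> carrier Q" "m \<in> carrier (\<Lambda>at b)" "y = t b m"
      using xy by (elim t_cases)
    interpret group "\<Lambda>at a" by (rule group_at) fact
    show "proj E (x \<triangleright>\<^bsub>E\<^esub> y) = proj E x \<triangleright> proj E y" "proj E x \<in> carrier Q"
      using x(1,2) y(1,2) by (simp_all add: x y)
  qed
  then show "proj E \<in> quandle_hom E Q"
    by (auto simp: quandle_hom_def)
  show "proj E ` carrier E = carrier Q"
  proof
    show "carrier Q \<subseteq> proj E ` carrier E"
    proof
      fix a assume a: "a \<in> carrier Q"
      interpret group "\<Lambda>at a" by (rule group_at) fact
      show "a \<in> proj E ` carrier E"
        using a by (intro image_eqI[of _ _ "t a \<one>\<^bsub>\<Lambda>at a\<^esub>"]) simp_all
    qed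
  qed (use proj_op in auto)
  show "group_action (\<Lambda> i) (total_part Q E i) (act E i)" if i: "i \<in> I" for i
  proof (rule group_action_intro)
    interpret group "\<Lambda> i" using coefficients i by (simp add: graded_group_def)
    show "group (\<Lambda> i)" ..
    show "act E i k \<in> extensional (total_part Q E i)" if "k \<in> carrier (\<Lambda> i)" for k
      using i that by (rule act_extensional)
    fix x assume "x \<in> total_part Q E i"
    then obtain a l where x: "a \<in> carrier Q" "i = grade I Q a" "l \<in> carrier (\<Lambda>at a)" "x = t a l"
      using i by (elim total_part_cases) auto
    interpret a: group "\<Lambda>at a" by (rule group_at) fact
    show "act E i \<one>\<^bsub>\<Lambda> i\<^esub> x = x"
      using x by simp
    fix k k' assume k: "k \<in> carrier (\<Lambda> i)" "k' \<in> carrier (\<Lambda> i)"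
    then show "act E i (k \<otimes>\<^bsub>\<Lambda> i\<^esub> k') x = act E i k (act E i k' x)"
      using x by (simp add: a.m_assoc)
  next
    fix k x assume k: "k \<in> carrier (\<Lambda> i)" and "x \<in> total_part Q E i"
    then obtain a l where x: "a \<in> carrier Q" "i = grade I Q a" "l \<in> carrier (\<Lambda>at a)" "x = t a l"
      using i by (elim total_part_cases) auto
    interpret group "\<Lambda>at a" by (rule group_at) fact
    show "act E i k x \<in> total_part Q E i"
      using k x by simp
  qed
next
  fix i k x y assume i: "i \<in> I" and k: "k \<in> carrier (\<Lambda> i)"
    and "x \<in> total_part Q E i" and "y \<in> carrier E"
  then obtain a l b m where x: "a \<in> carrier Q" "i = grade I Q a" "l \<in> carrier (\<Lambda>at a)" "x = t a l"
    and y: "b \<in> carrier Q" "m \<in> carrier (\<Lambda>at b)" "y = t b m"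
    using i by (elim total_part_cases t_cases) auto
  interpret group "\<Lambda>at a" by (rule group_at) fact
  have "act E (grade I Q a) k (t (a \<triangleright> b) (l \<otimes>\<^bsub>\<Lambda>at a\<^esub> f (a, b)))
      = t (a \<triangleright> b) (k \<otimes>\<^bsub>\<Lambda>at a\<^esub> (l \<otimes>\<^bsub>\<Lambda>at a\<^esub> f (a, b)))"
    using act_t[of "a \<triangleright> b" k "l \<otimes>\<^bsub>\<Lambda>at a\<^esub> f (a, b)"] x y k by simp
  then show "act E i k x \<triangleright>\<^bsub>E\<^esub> y = act E i k (x \<triangleright>\<^bsub>E\<^esub> y)"
    using x y k by (simp add: m_assoc)
next
  fix i k x y assume i: "i \<in> I" and k: "k \<in> carrier (\<Lambda> i)"
    and "x \<in> carrier E" and "y \<in> total_part Q E i"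
  then obtain a l b m where x: "a \<in> carrier Q" "l \<in> carrier (\<Lambda>at a)" "x = t a l"
    and y: "b \<in> carrier Q" "i = grade I Q b" "m \<in> carrier (\<Lambda>at b)" "y = t b m"
    using i by (elim total_part_cases t_cases) auto
  interpret group "\<Lambda>at b" by (rule group_at) fact
  show "x \<triangleright>\<^bsub>E\<^esub> act E i k y = x \<triangleright>\<^bsub>E\<^esub> y"
    using x y k by simp
next
  fix i k x assume i: "i \<in> I" and k: "k \<in> carrier (\<Lambda> i)" and "x \<in> total_part Q E i"
  then obtain a l where x: "a \<in> carrier Q" "i = grade I Q a" "l \<in> carrier (\<Lambda>at a)" "x = t a l"
    using i by (elim total_part_cases) auto
  interpret group "\<Lambda>at a" by (rule group_at) fact
  show "proj E (act E i k x) = proj E x"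
    using x k by simp
  show "k = \<one>\<^bsub>\<Lambda> i\<^esub>" if "act E i k x = x"
    using t_inj[of a "k \<otimes>\<^bsub>\<Lambda>at a\<^esub> l" l] that x k by simp
next
  fix i x y assume i: "i \<in> I" and p: "proj E x = proj E y"
    and xy: "x \<in> total_part Q E i" "y \<in> total_part Q E i"
  obtain a l where x: "a \<in> carrier Q" "i = grade I Q a" "l \<in> carrier (\<Lambda>at a)" "x = t a l"
    using i xy(1) by (elim total_part_cases) auto
  obtain b m where y: "b \<in> carrier Q" "i = grade I Q b" "m \<in> carrier (\<Lambda>at b)" "y = t b m"
    using i xy(2) by (elim total_part_cases) auto
  interpret group "\<Lambda>at b" by (rule group_at) fact
  have "a = b"
    using p x y by simp
  then show "\<exists>k\<in>carrier (\<Lambda> i). act E i k x = y"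
    using x y by (intro bexI[of _ "m \<otimes>\<^bsub>\<Lambda>at a\<^esub> inv\<^bsub>\<Lambda>at a\<^esub> l"]) (simp_all add: m_assoc)
qed

end

context graded_coefficients
begin

lemma is_section_exists:
  assumes "graded_extension I Q \<Lambda> E"
  shows "\<exists>s. is_section Q E s"
proof -
  have "\<forall>a\<in>carrier Q. \<exists>x. x \<in> carrier E \<and> proj E x = a"
    using graded_extension.proj_surj[OF assms] by (metis imageE)
  then show ?thesis
    unfolding is_section_def by (rule bchoice)
qed

lemma section_cochain_iff: "section_cochain I Q \<Lambda> E s f \<longleftrightarrow> f \<in> C2 I Q \<Lambda> \<and>
    (\<forall>a\<in>carrier Q. \<forall>b\<in>carrier Q. s a \<triangleright>\<^bsub>E\<^esub> s b = act E (grade I Q a) (f (a, b)) (s (a \<triangleright> b)))"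
  unfolding section_cochain_def
  by (simp add: ball_parts[where P = "\<lambda>i a. \<forall>b\<in>carrier Q. s a \<triangleright>\<^bsub>E\<^esub> s b = act E i (f (a, b)) (s (a \<triangleright> b))"])

end

text \<open>
  The axioms of an extension, restated with the degree read off from the point that is acted upon
  instead of being a separate parameter.
\<close>

locale coefficient_extension = graded_coefficients I Q \<Lambda> + E: graded_extension I Q \<Lambda> E
  for I :: "'i set" and Q :: "('q, 'i) graded_quandle" (structure)
    and \<Lambda> :: "'i \<Rightarrow> ('g, 'm) monoid_scheme" and E :: "('x, 'q, 'i, 'g) extension"
begin

abbreviation deg :: "'x \<Rightarrow> 'i"
  where "deg x \<equiv> grade I Q (proj E x)"

declare E.op_closed [simp] E.bar_closed [simp]

lemma proj_closed [simp]: "x \<in> carrier E \<Longrightarrow> proj E x \<in> carrier Q"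
  using E.proj_hom by (auto simp: quandle_hom_def)

lemma proj_op [simp]:
  "\<lbrakk>x \<in> carrier E; y \<in> carrier E\<rbrakk> \<Longrightarrow> proj E (x \<triangleright>\<^bsub>E\<^esub> y) = proj E x \<triangleright> proj E y"
  using E.proj_hom by (auto simp: quandle_hom_def)

lemma mem_total_part [simp]: "x \<in> carrier E \<Longrightarrow> x \<in> total_part Q E (deg x)"
  by (simp add: total_part_def)

lemma act_closed_total: "\<lbrakk>x \<in> carrier E; k \<in> carrier (\<Lambda> (deg x))\<rbrakk> \<Longrightarrow> act E (deg x) k x \<in> total_part Q E (deg x)"
  using group_action.element_image[OF E.action, of "deg x" k x] by simp

lemma act_closed [simp]: "\<lbrakk>x \<in> carrier E; k \<in> carrier (\<Lambda> (deg x))\<rbrakk> \<Longrightarrow> act E (deg x) k x \<in> carrier E"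
  using act_closed_total by (simp add: total_part_def)

lemma proj_act [simp]:
  "\<lbrakk>x \<in> carrier E; k \<in> carrier (\<Lambda> (deg x))\<rbrakk> \<Longrightarrow> proj E (act E (deg x) k x) = proj E x"
  by (simp add: E.act_fibre)

lemma act_mult:
  "\<lbrakk>x \<in> carrier E; k \<in> carrier (\<Lambda> (deg x)); l \<in> carrier (\<Lambda> (deg x))\<rbrakk>
    \<Longrightarrow> act E (deg x) (k \<otimes>\<^bsub>\<Lambda> (deg x)\<^esub> l) x = act E (deg x) k (act E (deg x) l x)"
  using group_action.composition_rule[OF E.action, of "deg x" x k l] by simp

lemma act_one [simp]: "x \<in> carrier E \<Longrightarrow> act E (deg x) \<one>\<^bsub>\<Lambda> (deg x)\<^esub> x = x"
  using group_action.id_eq_one[OF E.action, of "deg x"] by (metis grade_in mem_total_part proj_closed restrict_apply')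

text \<open>Freeness is assumed as triviality of stabilisers; this is the form that compares coordinates.\<close>

lemma act_inj:
  assumes "x \<in> carrier E" and "k \<in> carrier (\<Lambda> (deg x))" and "l \<in> carrier (\<Lambda> (deg x))"
    and "act E (deg x) k x = act E (deg x) l x"
  shows "k = l"
proof -
  interpret group "\<Lambda> (deg x)" using assms by (simp add: group_at)
  have "act E (deg x) (inv\<^bsub>\<Lambda> (deg x)\<^esub> l \<otimes>\<^bsub>\<Lambda> (deg x)\<^esub> k) x = x"
    using assms act_mult[of x "inv\<^bsub>\<Lambda> (deg x)\<^esub> l" k] act_mult[of x "inv\<^bsub>\<Lambda> (deg x)\<^esub> l" l] by simp
  then have "inv\<^bsub>\<Lambda> (deg x)\<^esub> l \<otimes>\<^bsub>\<Lambda> (deg x)\<^esub> k = \<one>\<^bsub>\<Lambda> (deg x)\<^esub>"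
    using assms E.act_free[of "deg x" "inv\<^bsub>\<Lambda> (deg x)\<^esub> l \<otimes>\<^bsub>\<Lambda> (deg x)\<^esub> k" x] by simp
  then show ?thesis
    using assms inv_equality inv_inv by (metis inv_closed)
qed

lemma act_trans:
  assumes "x \<in> carrier E" and "y \<in> carrier E" and "proj E x = proj E y"
  shows "\<exists>l\<in>carrier (\<Lambda> (deg x)). act E (deg x) l x = y"
  by (metis assms grade_in proj_closed mem_total_part E.act_transitive)

end

locale extension_section = coefficient_extension I Q \<Lambda> E
  for I :: "'i set" and Q :: "('q, 'i) graded_quandle" (structure)
    and \<Lambda> :: "'i \<Rightarrow> ('g, 'm) monoid_scheme" and E :: "('x, 'q, 'i, 'g) extension" +
  fixes s :: "'q \<Rightarrow> 'x"
  assumes is_section: "is_section Q E s"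
begin

lemma s_closed [simp]: "a \<in> carrier Q \<Longrightarrow> s a \<in> carrier E"
  and proj_s [simp]: "a \<in> carrier Q \<Longrightarrow> proj E (s a) = a"
  using is_section by (auto simp: is_section_def)

lemma section_cochain_unique: "\<exists>!f. section_cochain I Q \<Lambda> E s f"
proof -
  have ex: "\<exists>l. l \<in> carrier (\<Lambda>at a) \<and> s a \<triangleright>\<^bsub>E\<^esub> s b = act E (grade I Q a) l (s (a \<triangleright> b))"
    if "a \<in> carrier Q" "b \<in> carrier Q" for a b
    using act_trans[of "s (a \<triangleright> b)" "s a \<triangleright>\<^bsub>E\<^esub> s b"] that by auto
  define f where "f = (\<lambda>(a, b)\<in>carrier Q \<times> carrier Q.
    SOME l. l \<in> carrier (\<Lambda>at a) \<and> s a \<triangleright>\<^bsub>E\<^esub> s b = act E (grade I Q a) l (s (a \<triangleright> b)))"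
  have f: "f (a, b) \<in> carrier (\<Lambda>at a) \<and> s a \<triangleright>\<^bsub>E\<^esub> s b = act E (grade I Q a) (f (a, b)) (s (a \<triangleright> b))"
    if "a \<in> carrier Q" "b \<in> carrier Q" for a b
    unfolding f_def using that someI_ex[OF ex[OF that]] by simp
  have "section_cochain I Q \<Lambda> E s f"
    unfolding section_cochain_iff C2_iff using f by (simp add: f_def)
  moreover have "f1 = f2" if "section_cochain I Q \<Lambda> E s f1" "section_cochain I Q \<Lambda> E s f2" for f1 f2
  proof (rule extensionalityI)
    show "f1 \<in> extensional (carrier Q \<times> carrier Q)" "f2 \<in> extensional (carrier Q \<times> carrier Q)"
      using that by (auto simp: section_cochain_iff C2_iff)
    fix p assume "p \<in> carrier Q \<times> carrier Q"
    then obtain a b where p: "p = (a, b)" "a \<in> carrier Q" "b \<in> carrier Q"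
      by auto
    show "f1 p = f2 p"
      using that act_inj[of "s (a \<triangleright> b)" "f1 (a, b)" "f2 (a, b)"] p
      by (simp add: section_cochain_iff C2_iff)
  qed
  ultimately show ?thesis
    by blast
qed

text \<open>
  Both the normalisation and the cocycle identity are read off from the quandle axioms of \<open>E\<close>,
  because the action is free: comparing the coordinates of \<open>s a \<triangleright> s a = s a\<close> and of the two sides
  of self-distributivity for \<open>s a\<close>, \<open>s b\<close>, \<open>s c\<close>.
\<close>

lemma trivialized_by_section:
  assumes "section_cochain I Q \<Lambda> E s f"
  shows "trivialized_extension I Q \<Lambda> E f (\<lambda>a l. act E (grade I Q a) l (s a))"
proof -
  define t where "t = (\<lambda>a l. act E (grade I Q a) l (s a))"
  have f_ext: "f \<in> extensional (carrier Q \<times> carrier Q)"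
    and f [simp]: "\<And>a b. \<lbrakk>a \<in> carrier Q; b \<in> carrier Q\<rbrakk> \<Longrightarrow> f (a, b) \<in> carrier (\<Lambda>at a)"
    and s_op: "\<And>a b. \<lbrakk>a \<in> carrier Q; b \<in> carrier Q\<rbrakk> \<Longrightarrow> s a \<triangleright>\<^bsub>E\<^esub> s b = t (a \<triangleright> b) (f (a, b))"
    using assms unfolding section_cochain_iff C2_iff t_def by auto
  have f_op [simp]: "f (a \<triangleright> b, c) \<in> carrier (\<Lambda>at a)" and f_bar [simp]: "f (a \<triangleleft> b, c) \<in> carrier (\<Lambda>at a)"
    if "a \<in> carrier Q" "b \<in> carrier Q" "c \<in> carrier Q" for a b c
    using that f[of "a \<triangleright> b" c] f[of "a \<triangleleft> b" c] by simp_all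
  have t [simp]: "t a l \<in> carrier E" "proj E (t a l) = a"
    if "a \<in> carrier Q" "l \<in> carrier (\<Lambda>at a)" for a l
    using that act_closed[of "s a" l] proj_act[of "s a" l] by (simp_all add: t_def)
  have t_one [simp]: "t a \<one>\<^bsub>\<Lambda>at a\<^esub> = s a" if "a \<in> carrier Q" for a
    using that act_one[of "s a"] by (simp add: t_def)
  have act_t: "act E (grade I Q a) k (t a l) = t a (k \<otimes>\<^bsub>\<Lambda>at a\<^esub> l)"
    if "a \<in> carrier Q" "k \<in> carrier (\<Lambda>at a)" "l \<in> carrier (\<Lambda>at a)" for a k l
    using that act_mult[of "s a" k l] by (simp add: t_def)
  have t_inj: "l = m" if "a \<in> carrier Q" "l \<in> carrier (\<Lambda>at a)" "m \<in> carrier (\<Lambda>at a)" "t a l = t a m" for a l m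
    using that act_inj[of "s a" l m] by (simp add: t_def)
  have t_op: "t a l \<triangleright>\<^bsub>E\<^esub> t b m = t (a \<triangleright> b) (l \<otimes>\<^bsub>\<Lambda>at a\<^esub> f (a, b))"
    if "a \<in> carrier Q" "b \<in> carrier Q" "l \<in> carrier (\<Lambda>at a)" "m \<in> carrier (\<Lambda>at b)" for a b l m
  proof -
    \<comment> \<open>the action on the right factor is invisible, the one on the left factor can be pulled out\<close>
    have "t a l \<triangleright>\<^bsub>E\<^esub> t b m = t a l \<triangleright>\<^bsub>E\<^esub> s b"
      using that E.op_act[of "grade I Q b" m "t a l" "s b"] mem_total_part[of "s b"] act_closed[of "s a" l]
      by (simp add: t_def del: mem_total_part)
    also have "\<dots> = act E (grade I Q a) l (s a \<triangleright>\<^bsub>E\<^esub> s b)"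
      using that E.act_op[of "grade I Q a" l "s a" "s b"] mem_total_part[of "s a"] by (simp add: t_def del: mem_total_part)
    also have "\<dots> = t (a \<triangleright> b) (l \<otimes>\<^bsub>\<Lambda>at a\<^esub> f (a, b))"
      using that act_t[of "a \<triangleright> b" l "f (a, b)"] by (simp add: s_op)
    finally show ?thesis .
  qed
  have f_Z2: "f \<in> Z2 I Q \<Lambda>"
  proof (rule Z2I)
    fix a assume a: "a \<in> carrier Q"
    interpret group "\<Lambda>at a" by (rule group_at) fact
    have "t a (f (a, a)) = t a \<one>\<^bsub>\<Lambda>at a\<^esub>"
      using a E.idem[of "s a"] s_op[of a a] by simp
    then show "f (a, a) = \<one>\<^bsub>\<Lambda>at a\<^esub>"
      using a t_inj[of a "f (a, a)" "\<one>\<^bsub>\<Lambda>at a\<^esub>"] by simp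
    fix b c assume bc: "b \<in> carrier Q" "c \<in> carrier Q"
    interpret b: group "\<Lambda>at b" by (rule group_at) fact
    interpret c: group "\<Lambda>at c" by (rule group_at) fact
    let ?d = "(a \<triangleright> b) \<triangleright> c"
    have "t ?d (f (a, b) \<otimes>\<^bsub>\<Lambda>at a\<^esub> f (a \<triangleright> b, c)) = (s a \<triangleright>\<^bsub>E\<^esub> s b) \<triangleright>\<^bsub>E\<^esub> s c"
      using a bc t_op[of "a \<triangleright> b" c "f (a, b)" "\<one>\<^bsub>\<Lambda>at c\<^esub>"] by (simp add: s_op)
    also have "\<dots> = (s a \<triangleright>\<^bsub>E\<^esub> s c) \<triangleright>\<^bsub>E\<^esub> (s b \<triangleright>\<^bsub>E\<^esub> s c)"
      using a bc E.self_distrib[of "s a" "s b" "s c"] by simp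
    also have "\<dots> = t ?d (f (a, c) \<otimes>\<^bsub>\<Lambda>at a\<^esub> f (a \<triangleright> c, b \<triangleright> c))"
      using a bc t_op[of "a \<triangleright> c" "b \<triangleright> c" "f (a, c)" "f (b, c)"] by (simp add: s_op flip: self_distrib[of a b c])
    finally show "f (a, b) \<otimes>\<^bsub>\<Lambda>at a\<^esub> f (a \<triangleright> b, c) = f (a, c) \<otimes>\<^bsub>\<Lambda>at a\<^esub> f (a \<triangleright> c, b \<triangleright> c)"
      by (rule t_inj[rotated 3]) (use a bc in simp_all)
  qed (simp_all add: f_ext)
  show ?thesis
    unfolding t_def[symmetric]
  proof (unfold_locales, goal_cases)
    case 1
    show ?case by (rule f_Z2)
  next
    case (4 x)
    then obtain l where "l \<in> carrier (\<Lambda> (deg x))" "act E (deg x) l (s (proj E x)) = x"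
      using act_trans[of "s (proj E x)" x] by auto
    then show ?case
      using 4 by (intro bexI[of _ "proj E x"] bexI[of _ l]) (simp_all add: t_def)
  next
    case (7 a b l m)
    interpret group "\<Lambda>at a" by (rule group_at) fact
    \<comment> \<open>the inverse operation is determined by the operation itself\<close>
    have "t (a \<triangleleft> b) (l \<otimes>\<^bsub>\<Lambda>at a\<^esub> inv\<^bsub>\<Lambda>at a\<^esub> f (a \<triangleleft> b, b)) \<triangleright>\<^bsub>E\<^esub> t b m = t a l"
      using 7 by (simp add: t_op m_assoc)
    then show ?case
      using 7 E.op_bar[of "t (a \<triangleleft> b) (l \<otimes>\<^bsub>\<Lambda>at a\<^esub> inv\<^bsub>\<Lambda>at a\<^esub> f (a \<triangleleft> b, b))" "t b m"] by simp
  next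
    case (9 i k)
    then show ?case
      using group_action.bij_prop0[OF E.action] by (auto simp: Bij_def)
  qed (use t_inj t_op act_t in simp_all)
qed

end

section \<open>Equivalence of extensions is cohomology of cocycles\<close>

context trivialized_extension
begin

definition coord :: "'x \<Rightarrow> 'g"
  where "coord x = (THE l. l \<in> carrier (\<Lambda>at (proj E x)) \<and> x = t (proj E x) l)"

lemma coord_t [simp]: "\<lbrakk>a \<in> carrier Q; l \<in> carrier (\<Lambda>at a)\<rbrakk> \<Longrightarrow> coord (t a l) = l"
  unfolding coord_def using t_inj by (intro the_equality) auto

end

context graded_coefficients
begin

text \<open>Right multiplication by \<open>g a\<close> over each \<open>a\<close> commutes with the action and intertwines the operations.\<close>

lemma ext_equiv_if_cohomologous:
  assumes E: "trivialized_extension I Q \<Lambda> E f t" and E': "trivialized_extension I Q \<Lambda> E' f' t'"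
    and "(f, f') \<in> cohomologous I Q \<Lambda>"
  shows "ext_equiv I Q \<Lambda> E E'"
proof -
  interpret E: trivialized_extension I Q \<Lambda> E f t by fact
  interpret E': trivialized_extension I Q \<Lambda> E' f' t' by fact
  have "(f', f) \<in> cohomologous I Q \<Lambda>"
    using assms(3) equiv_cohomologous by (meson equivE symD)
  then obtain g where [simp]: "f' \<in> Z2 I Q \<Lambda>" "f \<in> Z2 I Q \<Lambda>"
    "\<And>a. a \<in> carrier Q \<Longrightarrow> g a \<in> carrier (\<Lambda>at a)"
    "\<And>a b. \<lbrakk>a \<in> carrier Q; b \<in> carrier Q\<rbrakk> \<Longrightarrow> g (a \<triangleright> b) \<in> carrier (\<Lambda>at a)"
    and g: "\<And>a b. \<lbrakk>a \<in> carrier Q; b \<in> carrier Q\<rbrakk>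
      \<Longrightarrow> g a \<otimes>\<^bsub>\<Lambda>at a\<^esub> f' (a, b) = f (a, b) \<otimes>\<^bsub>\<Lambda>at a\<^esub> g (a \<triangleright> b)"
    by (erule cohomologousE)
  define \<phi> where "\<phi> x = t' (proj E x) (E.coord x \<otimes>\<^bsub>\<Lambda>at (proj E x)\<^esub> g (proj E x))" for x
  have \<phi>_t: "\<phi> (t a l) = t' a (l \<otimes>\<^bsub>\<Lambda>at a\<^esub> g a)" if "a \<in> carrier Q" "l \<in> carrier (\<Lambda>at a)" for a l
    using that by (simp add: \<phi>_def)
  have \<phi>: "\<phi> x \<in> carrier E'" "proj E' (\<phi> x) = proj E x" if x: "x \<in> carrier E" for x
  proof -
    obtain a l where al: "a \<in> carrier Q" "l \<in> carrier (\<Lambda>at a)" "x = t a l"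
      using x by (elim E.t_cases)
    interpret group "\<Lambda>at a" by (rule group_at) fact
    show "\<phi> x \<in> carrier E'" "proj E' (\<phi> x) = proj E x"
      using al(1,2) by (simp_all add: al \<phi>_t)
  qed
  have hom: "\<phi> \<in> quandle_hom E E'"
  proof -
    have "\<phi> (x \<triangleright>\<^bsub>E\<^esub> y) = \<phi> x \<triangleright>\<^bsub>E'\<^esub> \<phi> y" if xy: "x \<in> carrier E" "y \<in> carrier E" for x y
    proof -
      obtain a l b m where x: "a \<in> carrier Q" "l \<in> carrier (\<Lambda>at a)" "x = t a l"
        and y: "b \<in> carrier Q" "m \<in> carrier (\<Lambda>at b)" "y = t b m"
        using xy by (elim E.t_cases)
      interpret a: group "\<Lambda>at a" by (rule group_at) fact
      interpret b: group "\<Lambda>at b" by (rule group_at) fact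
      show ?thesis
        using x(1,2) y(1,2) by (simp add: x y \<phi>_t a.m_assoc g)
    qed
    then show ?thesis
      using \<phi> by (auto simp: quandle_hom_def)
  qed
  have inj: "x = y" if xy: "x \<in> carrier E" "y \<in> carrier E" and eq: "\<phi> x = \<phi> y" for x y
  proof -
    obtain a l b m where x: "a \<in> carrier Q" "l \<in> carrier (\<Lambda>at a)" "x = t a l"
      and y: "b \<in> carrier Q" "m \<in> carrier (\<Lambda>at b)" "y = t b m"
      using xy by (elim E.t_cases)
    have ab: "a = b"
      using \<phi>(2)[OF xy(1)] \<phi>(2)[OF xy(2)] eq x y by simp
    interpret group "\<Lambda>at b" by (rule group_at) fact
    have "l \<otimes>\<^bsub>\<Lambda>at b\<^esub> g b = m \<otimes>\<^bsub>\<Lambda>at b\<^esub> g b"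
      using E'.t_inj[of b "l \<otimes>\<^bsub>\<Lambda>at b\<^esub> g b" "m \<otimes>\<^bsub>\<Lambda>at b\<^esub> g b"] eq x y ab by (simp add: \<phi>_t)
    then show ?thesis
      using x y ab by simp
  qed
  have surj: "\<exists>x\<in>carrier E. \<phi> x = z" if z: "z \<in> carrier E'" for z
  proof -
    obtain a l where al: "a \<in> carrier Q" "l \<in> carrier (\<Lambda>at a)" "z = t' a l"
      using z by (elim E'.t_cases)
    interpret group "\<Lambda>at a" by (rule group_at) fact
    show ?thesis
      by (rule bexI[of _ "t a (l \<otimes>\<^bsub>\<Lambda>at a\<^esub> inv\<^bsub>\<Lambda>at a\<^esub> g a)"])
        (use al in \<open>simp_all add: \<phi>_t m_assoc\<close>)
  qed
  have bij: "bij_betw \<phi> (carrier E) (carrier E')"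
    unfolding bij_betw_def inj_on_def using inj surj \<phi>(1) by blast
  have equivariant: "\<phi> (act E i k x) = act E' i k (\<phi> x)"
    if i: "i \<in> I" and k: "k \<in> carrier (\<Lambda> i)" and x: "x \<in> total_part Q E i" for i k x
  proof -
    obtain a l where al: "a \<in> carrier Q" "i = grade I Q a" "l \<in> carrier (\<Lambda>at a)" "x = t a l"
      using i x by (elim E.total_part_cases) auto
    interpret group "\<Lambda>at a" by (rule group_at) fact
    show ?thesis
      using al k by (simp add: \<phi>_t m_assoc)
  qed
  show ?thesis
    unfolding ext_equiv_def using hom bij \<phi>(2) equivariant by (intro exI[of _ \<phi>]) simp
qed

text \<open>
  An equivalence carries the unit section of \<open>E\<close> to \<open>\<lambda>a. t' a (g a)\<close> for some \<open>g\<close>, and by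
  equivariance it is right multiplication by \<open>g a\<close> in the coordinates over \<open>a\<close>; compatibility with
  the quandle operations says that \<open>g\<close> relates the two cocycles.
\<close>

lemma cohomologous_if_ext_equiv:
  assumes E: "trivialized_extension I Q \<Lambda> E f t" and E': "trivialized_extension I Q \<Lambda> E' f' t'"
    and "ext_equiv I Q \<Lambda> E E'"
  shows "(f, f') \<in> cohomologous I Q \<Lambda>"
proof -
  interpret E: trivialized_extension I Q \<Lambda> E f t by fact
  interpret E': trivialized_extension I Q \<Lambda> E' f' t' by fact
  obtain \<phi> where hom: "\<phi> \<in> quandle_hom E E'"
    and proj: "\<And>x. x \<in> carrier E \<Longrightarrow> proj E' (\<phi> x) = proj E x"
    and equivariant: "\<And>i k x. \<lbrakk>i \<in> I; k \<in> carrier (\<Lambda> i); x \<in> total_part Q E i\<rbrakk>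
      \<Longrightarrow> \<phi> (act E i k x) = act E' i k (\<phi> x)"
    using assms(3) unfolding ext_equiv_def by metis
  define u where "u a = t a \<one>\<^bsub>\<Lambda>at a\<^esub>" for a
  have one [simp]: "\<one>\<^bsub>\<Lambda>at a\<^esub> \<in> carrier (\<Lambda>at a)" if "a \<in> carrier Q" for a
    using that by (simp add: group_at group.is_monoid monoid.one_closed)
  have [simp]: "u a \<in> carrier E" if "a \<in> carrier Q" for a
    using that by (simp add: u_def)
  have "\<exists>l. l \<in> carrier (\<Lambda>at a) \<and> \<phi> (u a) = t' a l" if a: "a \<in> carrier Q" for a
  proof -
    have "\<phi> (u a) \<in> carrier E'" "proj E' (\<phi> (u a)) = a"
      using a hom proj[of "u a"] by (auto simp: u_def quandle_hom_def)
    then show ?thesis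
      using E'.t_surj[of "\<phi> (u a)"] by auto
  qed
  then obtain g where g [simp]: "\<And>a. a \<in> carrier Q \<Longrightarrow> g a \<in> carrier (\<Lambda>at a)"
    and \<phi>_u: "\<And>a. a \<in> carrier Q \<Longrightarrow> \<phi> (u a) = t' a (g a)"
    by metis
  have g_op [simp]: "g (a \<triangleright> b) \<in> carrier (\<Lambda>at a)" if "a \<in> carrier Q" "b \<in> carrier Q" for a b
    using g[of "a \<triangleright> b"] that by simp
  have \<phi>_t: "\<phi> (t a l) = t' a (l \<otimes>\<^bsub>\<Lambda>at a\<^esub> g a)" if "a \<in> carrier Q" "l \<in> carrier (\<Lambda>at a)" for a l
  proof -
    interpret group "\<Lambda>at a" by (rule group_at) fact
    have "\<phi> (act E (grade I Q a) l (u a)) = act E' (grade I Q a) l (\<phi> (u a))"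
      using that by (intro equivariant) (simp_all add: u_def)
    then show ?thesis
      using that by (simp add: \<phi>_u) (simp add: u_def)
  qed
  show ?thesis
  proof (rule equivE[OF equiv_cohomologous], erule symD)
    show "(f', f) \<in> cohomologous I Q \<Lambda>"
    proof (rule cohomologousI[where g = g])
      fix a b assume ab: "a \<in> carrier Q" "b \<in> carrier Q"
      interpret group "\<Lambda>at a" by (rule group_at) fact
      have "t' (a \<triangleright> b) (g a \<otimes>\<^bsub>\<Lambda>at a\<^esub> f' (a, b)) = \<phi> (u a) \<triangleright>\<^bsub>E'\<^esub> \<phi> (u b)"
        using ab by (simp add: \<phi>_u)
      also have "\<dots> = \<phi> (u a \<triangleright>\<^bsub>E\<^esub> u b)"
        using ab hom by (simp add: quandle_hom_def)
      also have "\<dots> = t' (a \<triangleright> b) (f (a, b) \<otimes>\<^bsub>\<Lambda>at a\<^esub> g (a \<triangleright> b))"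
        using ab by (simp add: u_def \<phi>_t)
      finally show "g a \<otimes>\<^bsub>\<Lambda>at a\<^esub> f' (a, b) = f (a, b) \<otimes>\<^bsub>\<Lambda>at a\<^esub> g (a \<triangleright> b)"
        by (rule E'.t_inj[rotated 3]) (use ab in simp_all)
    qed simp_all
  qed
qed

lemma ext_equiv_refl: "ext_equiv I Q \<Lambda> E E"
  unfolding ext_equiv_def quandle_hom_def by (intro exI[of _ id]) simp

lemma section_data:
  assumes "graded_extension I Q \<Lambda> E" and "is_section Q E s"
  shows "\<exists>!f. section_cochain I Q \<Lambda> E s f"
    and "section_cochain I Q \<Lambda> E s f
      \<Longrightarrow> trivialized_extension I Q \<Lambda> E f (\<lambda>a l. act E (grade I Q a) l (s a))"
proof -
  interpret extension_section I Q \<Lambda> E s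
    by (intro extension_section.intro coefficient_extension.intro extension_section_axioms.intro
        graded_coefficients_axioms assms)
  show "\<exists>!f. section_cochain I Q \<Lambda> E s f"
    by (rule section_cochain_unique)
  show "section_cochain I Q \<Lambda> E s f
      \<Longrightarrow> trivialized_extension I Q \<Lambda> E f (\<lambda>a l. act E (grade I Q a) l (s a))"
    by (rule trivialized_by_section)
qed

lemma trivialization_exists:
  assumes "graded_extension I Q \<Lambda> E"
  obtains f t where "trivialized_extension I Q \<Lambda> E f t"
  using assms section_data is_section_exists by meson

text \<open>
  Any two coordinate systems on \<open>E\<close> are related by the identity equivalence, so \<open>Phi\<close> may be
  computed from arbitrary coordinates, in particular from an arbitrary section.
\<close>

lemma Phi_trivialized:
  assumes "trivialized_extension I Q \<Lambda> E f t"
  shows "Phi I Q \<Lambda> E = coh_class I Q \<Lambda> f"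
proof -
  have E: "graded_extension I Q \<Lambda> E"
    using assms by (rule trivialized_extension.is_graded_extension)
  define s where "s = (SOME s. is_section Q E s)"
  have s: "is_section Q E s"
    unfolding s_def using is_section_exists[OF E] by (rule someI_ex)
  define f' where "f' = (THE f. section_cochain I Q \<Lambda> E s f)"
  have "section_cochain I Q \<Lambda> E s f'"
    unfolding f'_def by (rule theI'[OF section_data(1)[OF E s]])
  from section_data(2)[OF E s this] have "(f', f) \<in> cohomologous I Q \<Lambda>"
    by (rule cohomologous_if_ext_equiv[OF _ assms ext_equiv_refl])
  then show ?thesis
    unfolding Phi_def s_def[symmetric] f'_def[symmetric] coh_class_def
    by (rule equiv_class_eq[OF equiv_cohomologous])
qed

lemma Phi_section:
  assumes "graded_extension I Q \<Lambda> E" and "is_section Q E s" and "section_cochain I Q \<Lambda> E s f"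
  shows "f \<in> Z2 I Q \<Lambda>" and "Phi I Q \<Lambda> E = coh_class I Q \<Lambda> f"
  using section_data(2)[OF assms] Phi_trivialized trivialized_extension.cocycle by blast+

lemma Phi_in_H2:
  assumes "graded_extension I Q \<Lambda> E"
  shows "Phi I Q \<Lambda> E \<in> H2 I Q \<Lambda>"
proof -
  obtain f t where "trivialized_extension I Q \<Lambda> E f t"
    using assms by (rule trivialization_exists)
  then show ?thesis
    by (simp add: Phi_trivialized trivialized_extension.cocycle)
qed

lemma ext_equiv_iff_Phi:
  assumes "graded_extension I Q \<Lambda> E" and "graded_extension I Q \<Lambda> E'"
  shows "ext_equiv I Q \<Lambda> E E' \<longleftrightarrow> Phi I Q \<Lambda> E = Phi I Q \<Lambda> E'"
proof -
  obtain f t where E: "trivialized_extension I Q \<Lambda> E f t"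
    using assms(1) by (rule trivialization_exists)
  obtain f' t' where E': "trivialized_extension I Q \<Lambda> E' f' t'"
    using assms(2) by (rule trivialization_exists)
  have "Phi I Q \<Lambda> E = Phi I Q \<Lambda> E' \<longleftrightarrow> (f, f') \<in> cohomologous I Q \<Lambda>"
    using E E' by (simp add: Phi_trivialized coh_class_eq_iff trivialized_extension.cocycle)
  then show ?thesis
    using cohomologous_if_ext_equiv[OF E E'] ext_equiv_if_cohomologous[OF E E'] by blast
qed

section \<open>The bijection between extension classes and cohomology classes\<close>

text \<open>
  Every cocycle is realised by an extension: the coordinate formulas, read as definitions on pairs,
  have \<open>Pair\<close> as coordinates.
\<close>

definition cocycle_ext :: "('q \<times> 'q \<Rightarrow> 'g) \<Rightarrow> ('q \<times> 'g, 'q, 'i, 'g) extension"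
  where "cocycle_ext f =
    \<lparr>carrier = (SIGMA a : carrier Q. carrier (\<Lambda>at a)),
     qop = (\<lambda>(a, l) (b, m). (a \<triangleright> b, l \<otimes>\<^bsub>\<Lambda>at a\<^esub> f (a, b))),
     qbar = (\<lambda>(a, l) (b, m). (a \<triangleleft> b, l \<otimes>\<^bsub>\<Lambda>at a\<^esub> inv\<^bsub>\<Lambda>at a\<^esub> f (a \<triangleleft> b, b))),
     proj = fst,
     act = (\<lambda>i k. \<lambda>(a, l)\<in>(SIGMA a : part Q i. carrier (\<Lambda> i)). (a, k \<otimes>\<^bsub>\<Lambda> i\<^esub> l))\<rparr>"

lemma trivialized_cocycle_ext:
  assumes "f \<in> Z2 I Q \<Lambda>"
  shows "trivialized_extension I Q \<Lambda> (cocycle_ext f) f Pair"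
proof (unfold_locales, goal_cases)
  case 1
  show ?case by fact
next
  case (9 i k)
  have "total_part Q (cocycle_ext f) i = (SIGMA a : part Q i. carrier (\<Lambda> i))"
    using 9 by (auto simp: total_part_def cocycle_ext_def mem_part_iff)
  then show ?case
    by (simp add: cocycle_ext_def)
qed (auto simp: cocycle_ext_def mem_part_iff)

lemma trivialized_trivial_ext:
  "trivialized_extension I Q \<Lambda> (trivial_ext I Q \<Lambda>) (cochain_one I Q \<Lambda>) Pair"
proof -
  have one: "cochain_one I Q \<Lambda> (a, b) = \<one>\<^bsub>\<Lambda>at a\<^esub>" if "a \<in> carrier Q" "b \<in> carrier Q" for a b
    using that by (simp add: cochain_one_def)
  have carrier: "(a, l) \<in> carrier (trivial_ext I Q \<Lambda>) \<longleftrightarrow> a \<in> carrier Q \<and> l \<in> carrier (\<Lambda>at a)" for a l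
    using grade_in by (auto simp: trivial_ext_def mem_part_iff)
  have "cochain_one I Q \<Lambda> \<in> Z2 I Q \<Lambda>"
    by (rule Z2I) (use group_at in \<open>simp_all add: one group.is_monoid monoid.one_closed\<close>,
        simp add: cochain_one_def)
  then show ?thesis
  proof (unfold_locales, goal_cases)
    case (9 i k)
    have "total_part Q (trivial_ext I Q \<Lambda>) i = part Q i \<times> carrier (\<Lambda> i)"
      using 9 by (auto simp: total_part_def carrier mem_part_iff) (auto simp: trivial_ext_def)
    then show ?case
      by (simp add: trivial_ext_def)
  qed (auto simp: carrier one group_at group.is_monoid monoid.r_one monoid.inv_one, auto simp: trivial_ext_def mem_part_iff)
qed

text \<open>
  This is the inverse of \<open>Phi_Ext\<close>: as equivalence of extensions is equality of their cohomology
  classes, these fibres of \<open>Phi\<close> are precisely the equivalence classes of extensions.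
\<close>

definition ext_with_class :: "('q \<times> 'q \<Rightarrow> 'g) set \<Rightarrow> ('q \<times> 'g, 'q, 'i, 'g) extension set"
  where "ext_with_class c = {E. graded_extension I Q \<Lambda> E \<and> Phi I Q \<Lambda> E = c}"

lemma ext_class_eq: "graded_extension I Q \<Lambda> E \<Longrightarrow> ext_class I Q \<Lambda> E = ext_with_class (Phi I Q \<Lambda> E)"
  using ext_equiv_iff_Phi by (auto simp: ext_class_def ext_with_class_def)

lemma ext_with_class_nonempty:
  assumes "c \<in> H2 I Q \<Lambda>"
  shows "\<exists>E. E \<in> ext_with_class c"
proof -
  obtain f where "f \<in> Z2 I Q \<Lambda>" "c = coh_class I Q \<Lambda> f"
    using assms by (auto simp: H2_eq)
  then have "cocycle_ext f \<in> ext_with_class c"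
    using trivialized_cocycle_ext[of f] Phi_trivialized trivialized_extension.is_graded_extension
    by (auto simp: ext_with_class_def)
  then show ?thesis ..
qed

lemma Phi_Ext_ext_with_class [simp]:
  assumes "c \<in> H2 I Q \<Lambda>"
  shows "Phi_Ext I Q \<Lambda> (ext_with_class c) = c"
proof -
  have "Phi I Q \<Lambda> ` ext_with_class c = {c}"
    using ext_with_class_nonempty[OF assms] by (auto simp: ext_with_class_def)
  then show ?thesis
    by (simp add: Phi_Ext_def)
qed

lemma Ext_eq: "Ext I Q \<Lambda> = ext_with_class ` H2 I Q \<Lambda>"
proof
  show "Ext I Q \<Lambda> \<subseteq> ext_with_class ` H2 I Q \<Lambda>"
    by (auto simp: Ext_def ext_class_eq Phi_in_H2)
  show "ext_with_class ` H2 I Q \<Lambda> \<subseteq> Ext I Q \<Lambda>"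
  proof
    fix U assume "U \<in> ext_with_class ` H2 I Q \<Lambda>"
    then obtain c E where "U = ext_with_class c" "E \<in> ext_with_class c"
      using ext_with_class_nonempty by blast
    then have "graded_extension I Q \<Lambda> E" "U = ext_with_class (Phi I Q \<Lambda> E)"
      by (simp_all add: ext_with_class_def)
    then show "U \<in> Ext I Q \<Lambda>"
      by (auto simp: Ext_def simp flip: ext_class_eq)
  qed
qed

lemma inj_ext_with_class: "inj_on ext_with_class (H2 I Q \<Lambda>)"
  by (metis Phi_Ext_ext_with_class inj_onI)

lemma bij_Phi_Ext: "bij_betw (Phi_Ext I Q \<Lambda>) (Ext I Q \<Lambda>) (H2 I Q \<Lambda>)"
  by (rule bij_betw_byWitness[where f' = ext_with_class]) (auto simp: Ext_eq)

lemma ext_class_in_Ext: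
  assumes "graded_extension I Q \<Lambda> E"
  shows "ext_class I Q \<Lambda> E \<in> Ext I Q \<Lambda>" and "Phi_Ext I Q \<Lambda> (ext_class I Q \<Lambda> E) = Phi I Q \<Lambda> E"
  using assms by (simp_all add: ext_class_eq Ext_eq Phi_in_H2)

lemma ext_equiv_iff_ext_class:
  assumes "graded_extension I Q \<Lambda> E" and "graded_extension I Q \<Lambda> E'"
  shows "ext_equiv I Q \<Lambda> E E' \<longleftrightarrow> ext_class I Q \<Lambda> E = ext_class I Q \<Lambda> E'"
  using assms by (metis ext_class_in_Ext(2) ext_class_eq ext_equiv_iff_Phi)

text \<open>
  Operations on \<open>Ext\<close> are unions over all representatives; once the result depends only on the
  class \<open>Phi\<close> of a representative, this evaluates them.
\<close>

lemma UN_ext_with_class: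
  assumes "c \<in> H2 I Q \<Lambda>" and "\<And>E. graded_extension I Q \<Lambda> E \<Longrightarrow> Phi I Q \<Lambda> E = c \<Longrightarrow> F E = W"
  shows "(\<Union>E\<in>ext_with_class c. F E) = W"
  using ext_with_class_nonempty[OF assms(1)] assms(2) by (auto simp: ext_with_class_def)

end

section \<open>Change of coefficients\<close>

lemma UN_const: "A \<noteq> {} \<Longrightarrow> (\<And>x. x \<in> A \<Longrightarrow> F x = W) \<Longrightarrow> (\<Union>x\<in>A. F x) = W"
  by auto

lemma UN_const_pair:
  assumes "p \<in> A" and "\<And>x y. (x, y) \<in> A \<Longrightarrow> F x y = W"
  shows "(\<Union>(x, y)\<in>A. F x y) = W"
  by (rule UN_const) (use assms in \<open>auto simp del: UN_iff\<close>)

lemma UN_const_pair2: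
  assumes "p \<in> A" and "q \<in> B" and "\<And>x y u v. \<lbrakk>(x, y) \<in> A; (u, v) \<in> B\<rbrakk> \<Longrightarrow> F x y u v = W"
  shows "(\<Union>(x, y)\<in>A. \<Union>(u, v)\<in>B. F x y u v) = W"
  by (rule UN_const_pair[OF assms(1)], rule UN_const_pair[OF assms(2)], rule assms(3))

context graded_coefficients
begin

text \<open>
  Operations on \<open>H2\<close> are unions over all cocycles in a class; this computes them on one cocycle.
\<close>

lemma UN_coh_class:
  assumes "f \<in> Z2 I Q \<Lambda>" and "\<And>f'. (f, f') \<in> cohomologous I Q \<Lambda> \<Longrightarrow> F f' = F f"
  shows "(\<Union>f'\<in>coh_class I Q \<Lambda> f. F f') = F f"
proof (rule UN_const)
  show "coh_class I Q \<Lambda> f \<noteq> {}"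
    using mem_coh_class_self[OF assms(1)] by blast
qed (use assms(2) mem_coh_classD in blast)

end

locale coefficient_hom = graded_coefficients I Q \<Lambda> + target: graded_coefficients I Q \<Lambda>'
  for I :: "'i set" and Q :: "('q, 'i) graded_quandle" (structure)
    and \<Lambda> :: "'i \<Rightarrow> ('g, 'm) monoid_scheme" and \<Lambda>' :: "'i \<Rightarrow> ('h, 'n) monoid_scheme" +
  fixes h :: "'i \<Rightarrow> 'g \<Rightarrow> 'h"
  assumes graded_hom: "h \<in> graded_hom I \<Lambda> \<Lambda>'"
begin

lemma hom_at: "a \<in> carrier Q \<Longrightarrow> h (grade I Q a) \<in> hom (\<Lambda>at a) (\<Lambda>' (grade I Q a))"
  using graded_hom by (simp add: graded_hom_def)

lemma h_closed [simp]:
  "\<lbrakk>a \<in> carrier Q; l \<in> carrier (\<Lambda>at a)\<rbrakk> \<Longrightarrow> h (grade I Q a) l \<in> carrier (\<Lambda>' (grade I Q a))"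
  by (rule hom_in_carrier[OF hom_at])

lemma h_mult [simp]: "\<lbrakk>a \<in> carrier Q; l \<in> carrier (\<Lambda>at a); m \<in> carrier (\<Lambda>at a)\<rbrakk> \<Longrightarrow>
    h (grade I Q a) (l \<otimes>\<^bsub>\<Lambda>at a\<^esub> m) = h (grade I Q a) l \<otimes>\<^bsub>\<Lambda>' (grade I Q a)\<^esub> h (grade I Q a) m"
  by (rule hom_mult[OF hom_at])

lemma h_one [simp]: "a \<in> carrier Q \<Longrightarrow> h (grade I Q a) \<one>\<^bsub>\<Lambda>at a\<^esub> = \<one>\<^bsub>\<Lambda>' (grade I Q a)\<^esub>"
  by (rule hom_one[OF hom_at group_at target.group_at])

lemma h_inv: "\<lbrakk>a \<in> carrier Q; l \<in> carrier (\<Lambda>at a)\<rbrakk> \<Longrightarrow>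
    h (grade I Q a) (inv\<^bsub>\<Lambda>at a\<^esub> l) = inv\<^bsub>\<Lambda>' (grade I Q a)\<^esub> h (grade I Q a) l"
  using group_hom.hom_inv[of "\<Lambda>at a" "\<Lambda>' (grade I Q a)" "h (grade I Q a)"] hom_at group_at target.group_at
  by (simp add: group_hom_def group_hom_axioms_def)

lemma cochain_push_apply [simp]:
  "\<lbrakk>a \<in> carrier Q; b \<in> carrier Q\<rbrakk> \<Longrightarrow> cochain_push I Q h f (a, b) = h (grade I Q a) (f (a, b))"
  by (simp add: cochain_push_def)

lemma cochain_push_Z2:
  assumes f: "f \<in> Z2 I Q \<Lambda>"
  shows "cochain_push I Q h f \<in> Z2 I Q \<Lambda>'"
proof (rule target.Z2I)
  note [simp] = Z2_simps[OF f]
  fix a b c assume abc: "a \<in> carrier Q" "b \<in> carrier Q" "c \<in> carrier Q"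
  have "h (grade I Q a) (f (a, b) \<otimes>\<^bsub>\<Lambda>at a\<^esub> f (a \<triangleright> b, c))
      = h (grade I Q a) (f (a, c) \<otimes>\<^bsub>\<Lambda>at a\<^esub> f (a \<triangleright> c, b \<triangleright> c))"
    using f abc by (simp only: Z2_cocycle)
  then show "cochain_push I Q h f (a, b) \<otimes>\<^bsub>\<Lambda>' (grade I Q a)\<^esub> cochain_push I Q h f (a \<triangleright> b, c)
      = cochain_push I Q h f (a, c) \<otimes>\<^bsub>\<Lambda>' (grade I Q a)\<^esub> cochain_push I Q h f (a \<triangleright> c, b \<triangleright> c)"
    using abc by simp
qed (simp_all add: Z2_simps[OF f], simp add: cochain_push_def)

lemma cochain_push_cohomologous:
  assumes "(f, f') \<in> cohomologous I Q \<Lambda>"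
  shows "(cochain_push I Q h f, cochain_push I Q h f') \<in> cohomologous I Q \<Lambda>'"
proof -
  obtain g where f: "f \<in> Z2 I Q \<Lambda>" "f' \<in> Z2 I Q \<Lambda>"
    and g [simp]: "\<And>a. a \<in> carrier Q \<Longrightarrow> g a \<in> carrier (\<Lambda>at a)"
      "\<And>a b. \<lbrakk>a \<in> carrier Q; b \<in> carrier Q\<rbrakk> \<Longrightarrow> g (a \<triangleright> b) \<in> carrier (\<Lambda>at a)"
    and eq: "\<And>a b. \<lbrakk>a \<in> carrier Q; b \<in> carrier Q\<rbrakk>
      \<Longrightarrow> g a \<otimes>\<^bsub>\<Lambda>at a\<^esub> f (a, b) = f' (a, b) \<otimes>\<^bsub>\<Lambda>at a\<^esub> g (a \<triangleright> b)"
    using assms by (erule cohomologousE)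
  note [simp] = Z2_simps[OF f(1)] Z2_simps[OF f(2)]
  show ?thesis
  proof (rule target.cohomologousI[where g = "\<lambda>a. h (grade I Q a) (g a)"])
    fix a b assume ab: "a \<in> carrier Q" "b \<in> carrier Q"
    have "h (grade I Q a) (g a \<otimes>\<^bsub>\<Lambda>at a\<^esub> f (a, b)) = h (grade I Q a) (f' (a, b) \<otimes>\<^bsub>\<Lambda>at a\<^esub> g (a \<triangleright> b))"
      using eq ab by simp
    then show "h (grade I Q a) (g a) \<otimes>\<^bsub>\<Lambda>' (grade I Q a)\<^esub> cochain_push I Q h f (a, b)
        = cochain_push I Q h f' (a, b) \<otimes>\<^bsub>\<Lambda>' (grade I Q a)\<^esub> h (grade I Q (a \<triangleright> b)) (g (a \<triangleright> b))"
      using f ab by simp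
  qed (use f in \<open>simp_all add: cochain_push_Z2\<close>)
qed

lemma H2_push_coh_class:
  assumes "f \<in> Z2 I Q \<Lambda>"
  shows "H2_push I Q \<Lambda>' h (coh_class I Q \<Lambda> f) = coh_class I Q \<Lambda>' (cochain_push I Q h f)"
  unfolding H2_push_def
proof (rule UN_coh_class[OF assms])
  fix f' assume "(f, f') \<in> cohomologous I Q \<Lambda>"
  from cochain_push_cohomologous[OF this]
  show "coh_class I Q \<Lambda>' (cochain_push I Q h f') = coh_class I Q \<Lambda>' (cochain_push I Q h f)"
    unfolding coh_class_def by (rule equiv_class_eq[OF target.equiv_cohomologous, symmetric])
qed

lemma H2_push_closed [simp]: "c \<in> H2 I Q \<Lambda> \<Longrightarrow> H2_push I Q \<Lambda>' h c \<in> H2 I Q \<Lambda>'"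
  by (auto simp: H2_eq H2_push_coh_class cochain_push_Z2)

text \<open>
  Over \<open>a\<close> the class of \<open>(l, t a m)\<close> in the push-forward depends only on \<open>l h(m)\<close>, and this value
  is its coordinate. The classes are thus the fibres \<open>push_coord t a n\<close> of \<open>(l, t a m) \<mapsto> l h(m)\<close>.
\<close>

definition push_coord :: "('q \<Rightarrow> 'g \<Rightarrow> 'x) \<Rightarrow> 'q \<Rightarrow> 'h \<Rightarrow> ('h \<times> 'x) set"
  where "push_coord t a n = {(l, t a m) | l m. l \<in> carrier (\<Lambda>' (grade I Q a)) \<and> m \<in> carrier (\<Lambda>at a) \<and>
    l \<otimes>\<^bsub>\<Lambda>' (grade I Q a)\<^esub> h (grade I Q a) m = n}"

lemma push_class:
  assumes "trivialized_extension I Q \<Lambda> E f t"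
    and a: "a \<in> carrier Q" and l: "l \<in> carrier (\<Lambda>' (grade I Q a))" and m: "m \<in> carrier (\<Lambda>at a)"
  shows "push_rel I Q \<Lambda> \<Lambda>' h E `` {(l, t a m)} =
    push_coord t a (l \<otimes>\<^bsub>\<Lambda>' (grade I Q a)\<^esub> h (grade I Q a) m)"
proof -
  interpret E: trivialized_extension I Q \<Lambda> E f t by fact
  interpret group "\<Lambda>at a" using a by (rule group_at)
  interpret t: group "\<Lambda>' (grade I Q a)" using a by (rule target.group_at)
  show ?thesis
  proof (intro equalityI subsetI)
    fix q assume "q \<in> push_rel I Q \<Lambda> \<Lambda>' h E `` {(l, t a m)}"
    then obtain i k x where i: "i \<in> I" and k: "k \<in> carrier (\<Lambda> i)" and x: "x \<in> total_part Q E i"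
      and tam: "t a m = act E i k x" and q: "q = (l \<otimes>\<^bsub>\<Lambda>' i\<^esub> h i k, x)"
      by (auto simp: push_rel_def)
    obtain b m' where b: "b \<in> carrier Q" "i = grade I Q b" "m' \<in> carrier (\<Lambda>at b)" "x = t b m'"
      using i x by (rule E.total_part_cases)
    interpret b: group "\<Lambda>at b" using b(1) by (rule group_at)
    have tam': "t a m = t b (k \<otimes>\<^bsub>\<Lambda>at b\<^esub> m')"
      using tam b k by auto
    then have ab: "a = b"
      using a m b k E.proj_t[of a m] E.proj_t[of b "k \<otimes>\<^bsub>\<Lambda>at b\<^esub> m'"] by auto
    then have b': "i = grade I Q a" "k \<in> carrier (\<Lambda>at a)" "m' \<in> carrier (\<Lambda>at a)" "x = t a m'"
      using b k by auto
    have "m = k \<otimes>\<^bsub>\<Lambda>at a\<^esub> m'"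
      using tam' a m b' E.t_inj[of a m "k \<otimes>\<^bsub>\<Lambda>at a\<^esub> m'"] unfolding ab[symmetric] by simp
    then show "q \<in> push_coord t a (l \<otimes>\<^bsub>\<Lambda>' (grade I Q a)\<^esub> h (grade I Q a) m)"
      using a b' l unfolding push_coord_def
      by (simp add: q t.m_assoc) (rule exI[of _ m'], simp add: t.m_assoc)
  next
    fix q assume "q \<in> push_coord t a (l \<otimes>\<^bsub>\<Lambda>' (grade I Q a)\<^esub> h (grade I Q a) m)"
    then obtain l' m' where q: "q = (l', t a m')" "l' \<in> carrier (\<Lambda>' (grade I Q a))" "m' \<in> carrier (\<Lambda>at a)"
      and eq: "l' \<otimes>\<^bsub>\<Lambda>' (grade I Q a)\<^esub> h (grade I Q a) m' = l \<otimes>\<^bsub>\<Lambda>' (grade I Q a)\<^esub> h (grade I Q a) m"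
      by (auto simp: push_coord_def)
    \<comment> \<open>the only group element that can move \<open>t a m'\<close> to \<open>t a m\<close>\<close>
    define k where "k = m \<otimes>\<^bsub>\<Lambda>at a\<^esub> inv\<^bsub>\<Lambda>at a\<^esub> m'"
    have k: "k \<in> carrier (\<Lambda>at a)" "act E (grade I Q a) k (t a m') = t a m"
      using a m q by (simp_all add: k_def m_assoc)
    have "l \<otimes>\<^bsub>\<Lambda>' (grade I Q a)\<^esub> h (grade I Q a) k
        = (l \<otimes>\<^bsub>\<Lambda>' (grade I Q a)\<^esub> h (grade I Q a) m) \<otimes>\<^bsub>\<Lambda>' (grade I Q a)\<^esub> inv\<^bsub>\<Lambda>' (grade I Q a)\<^esub> h (grade I Q a) m'"
      using a l m q by (simp add: k_def h_inv t.m_assoc)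
    also have "\<dots> = l'"
      using a q by (simp add: t.m_assoc flip: eq)
    finally have "l \<otimes>\<^bsub>\<Lambda>' (grade I Q a)\<^esub> h (grade I Q a) k = l'" .
    then show "q \<in> push_rel I Q \<Lambda> \<Lambda>' h E `` {(l, t a m)}"
      using a l q k unfolding push_rel_def
      by (auto intro!: exI[of _ "grade I Q a"] exI[of _ l] exI[of _ k] exI[of _ "t a m'"])
  qed
qed

lemma push_quotient:
  assumes "trivialized_extension I Q \<Lambda> E f t" and i: "i \<in> I"
  shows "(carrier (\<Lambda>' i) \<times> total_part Q E i) // push_rel I Q \<Lambda> \<Lambda>' h E =
    {push_coord t a n | a n. a \<in> carrier Q \<and> grade I Q a = i \<and> n \<in> carrier (\<Lambda>' i)}" (is "?L = ?R")
proof -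
  interpret E: trivialized_extension I Q \<Lambda> E f t by fact
  show ?thesis
  proof (intro equalityI subsetI)
    fix U assume "U \<in> ?L"
    then obtain l x where l: "l \<in> carrier (\<Lambda>' i)" and x: "x \<in> total_part Q E i"
      and U: "U = push_rel I Q \<Lambda> \<Lambda>' h E `` {(l, x)}"
      by (auto simp: quotient_def)
    obtain a m where a: "a \<in> carrier Q" "i = grade I Q a" "m \<in> carrier (\<Lambda>at a)" "x = t a m"
      using i x by (rule E.total_part_cases)
    interpret t: group "\<Lambda>' (grade I Q a)" using a(1) by (rule target.group_at)
    have "U = push_coord t a (l \<otimes>\<^bsub>\<Lambda>' (grade I Q a)\<^esub> h (grade I Q a) m)"
      using push_class[OF assms(1) a(1), of l m] a l U by simp
    then show "U \<in> ?R"
      using a l h_closed[of a m] t.m_closed[of l "h (grade I Q a) m"] by blast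
  next
    fix U assume "U \<in> ?R"
    then obtain a n where a: "a \<in> carrier Q" "i = grade I Q a" "n \<in> carrier (\<Lambda>' i)" "U = push_coord t a n"
      by blast
    interpret group "\<Lambda>at a" using a(1) by (rule group_at)
    interpret t: group "\<Lambda>' (grade I Q a)" using a(1) by (rule target.group_at)
    have "U = push_rel I Q \<Lambda> \<Lambda>' h E `` {(n, t a \<one>\<^bsub>\<Lambda>at a\<^esub>)}"
      using push_class[OF assms(1) a(1), of n "\<one>\<^bsub>\<Lambda>at a\<^esub>"] a by simp
    moreover have "(n, t a \<one>\<^bsub>\<Lambda>at a\<^esub>) \<in> carrier (\<Lambda>' i) \<times> total_part Q E i"
      using a E.t_total_part[of a "\<one>\<^bsub>\<Lambda>at a\<^esub>"] by simp
    ultimately show "U \<in> ?L"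
      by (simp add: quotientI)
  qed
qed

text \<open>
  As every operation of the push-forward is a union over representatives, it suffices that all
  representatives give the same class. The homomorphism property of \<open>h\<close> turns the cocycle \<open>f\<close>, which
  \<open>E\<close> contributes inside the argument of \<open>h\<close>, into a right factor \<open>h(f(a, b))\<close>.
\<close>

lemma trivialized_push_forward:
  assumes "trivialized_extension I Q \<Lambda> E f t"
  shows "trivialized_extension I Q \<Lambda>' (push_forward I Q \<Lambda> \<Lambda>' h E) (cochain_push I Q h f) (push_coord t)"
proof -
  interpret E: trivialized_extension I Q \<Lambda> E f t by fact
  let ?r = "push_rel I Q \<Lambda> \<Lambda>' h E" and ?P = "push_forward I Q \<Lambda> \<Lambda>' h E"
  have nonempty: "(n, t a \<one>\<^bsub>\<Lambda>at a\<^esub>) \<in> push_coord t a n"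
    if a: "a \<in> carrier Q" and n: "n \<in> carrier (\<Lambda>' (grade I Q a))" for a n
  proof -
    interpret group "\<Lambda>at a" using a by (rule group_at)
    interpret t: group "\<Lambda>' (grade I Q a)" using a by (rule target.group_at)
    show ?thesis using a n by (auto simp: push_coord_def)
  qed
  have quotient_UN: "(\<Union>i\<in>I. A i) // ?r = (\<Union>i\<in>I. A i // ?r)" for A
    by (auto simp: quotient_def)
  have carrier: "carrier ?P = {push_coord t a n | a n. a \<in> carrier Q \<and> n \<in> carrier (\<Lambda>' (grade I Q a))}"
    unfolding push_forward_def Let_def partial_object.simps quotient_UN
    by (auto simp: push_quotient[OF assms]) (use grade_in in blast)
  have proj: "proj ?P (push_coord t a n) = a" if a: "a \<in> carrier Q" and n: "n \<in> carrier (\<Lambda>' (grade I Q a))" for a n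
  proof -
    have "(\<lambda>(l, x). proj E x) ` push_coord t a n = {a}"
      using a nonempty[OF a n] by (force simp: push_coord_def)
    then show ?thesis
      by (simp add: push_forward_def Let_def)
  qed
  have total: "total_part Q ?P i = (carrier (\<Lambda>' i) \<times> total_part Q E i) // ?r" if i: "i \<in> I" for i
  proof -
    have "total_part Q ?P i =
        {push_coord t a n | a n. a \<in> carrier Q \<and> grade I Q a = i \<and> n \<in> carrier (\<Lambda>' i)}"
      using i by (auto simp: total_part_def carrier proj mem_part_iff) blast
    then show ?thesis
      by (simp add: push_quotient[OF assms i])
  qed
  show ?thesis
  proof (unfold_locales, goal_cases)
    case 1
    show ?case by (simp add: cochain_push_Z2)
  next
    case (5 a l m)
    interpret group "\<Lambda>at a" using 5(1) by (rule group_at)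
    interpret t: group "\<Lambda>' (grade I Q a)" using 5(1) by (rule target.group_at)
    have "(l, t a \<one>\<^bsub>\<Lambda>at a\<^esub>) \<in> push_coord t a m"
      using nonempty[OF 5(1,2)] 5(4) by simp
    then obtain k where k: "k \<in> carrier (\<Lambda>at a)" "t a \<one>\<^bsub>\<Lambda>at a\<^esub> = t a k"
      and eq: "l \<otimes>\<^bsub>\<Lambda>' (grade I Q a)\<^esub> h (grade I Q a) k = m"
      by (auto simp: push_coord_def)
    have "\<one>\<^bsub>\<Lambda>at a\<^esub> = k"
      by (rule E.t_inj[OF 5(1) _ k]) simp
    then show ?case
      using eq 5 by auto
  next
    case (6 a b l m)
    note ab = 6(1,2)
    interpret group "\<Lambda>at a" using 6(1) by (rule group_at)
    interpret t: group "\<Lambda>' (grade I Q a)" using 6(1) by (rule target.group_at)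
    have "?r `` {(l1, x \<triangleright>\<^bsub>E\<^esub> y)} = push_coord t (a \<triangleright> b) (l \<otimes>\<^bsub>\<Lambda>' (grade I Q a)\<^esub> h (grade I Q a) (f (a, b)))"
      if "(l1, x) \<in> push_coord t a l" and "(m1, y) \<in> push_coord t b m" for l1 x m1 y
    proof -
      obtain u where u: "l1 \<in> carrier (\<Lambda>' (grade I Q a))" "u \<in> carrier (\<Lambda>at a)" "x = t a u"
        "l = l1 \<otimes>\<^bsub>\<Lambda>' (grade I Q a)\<^esub> h (grade I Q a) u"
        using \<open>(l1, x) \<in> push_coord t a l\<close> by (auto simp: push_coord_def)
      obtain v where v: "v \<in> carrier (\<Lambda>at b)" "y = t b v"
        using \<open>(m1, y) \<in> push_coord t b m\<close> by (auto simp: push_coord_def)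
      show ?thesis
        using u(1,2) v(1) ab push_class[OF assms, of "a \<triangleright> b" l1 "u \<otimes>\<^bsub>\<Lambda>at a\<^esub> f (a, b)"]
        by (simp add: u(3,4) v(2) t.m_assoc h_inv)
    qed
    from UN_const_pair2[where F = "\<lambda>l1 x m1 y. ?r `` {(l1, x \<triangleright>\<^bsub>E\<^esub> y)}",
        OF nonempty[OF 6(1,3)] nonempty[OF 6(2,4)] this]
    show ?case
      using 6 by (simp add: push_forward_def Let_def)
  next
    case (7 a b l m)
    note ab = 7(1,2)
    interpret group "\<Lambda>at a" using 7(1) by (rule group_at)
    interpret t: group "\<Lambda>' (grade I Q a)" using 7(1) by (rule target.group_at)
    have "?r `` {(l1, x \<triangleleft>\<^bsub>E\<^esub> y)} = push_coord t (a \<triangleleft> b) (l \<otimes>\<^bsub>\<Lambda>' (grade I Q a)\<^esub> inv\<^bsub>\<Lambda>' (grade I Q a)\<^esub> h (grade I Q a) (f (a \<triangleleft> b, b)))"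
      if "(l1, x) \<in> push_coord t a l" and "(m1, y) \<in> push_coord t b m" for l1 x m1 y
    proof -
      obtain u where u: "l1 \<in> carrier (\<Lambda>' (grade I Q a))" "u \<in> carrier (\<Lambda>at a)" "x = t a u"
        "l = l1 \<otimes>\<^bsub>\<Lambda>' (grade I Q a)\<^esub> h (grade I Q a) u"
        using \<open>(l1, x) \<in> push_coord t a l\<close> by (auto simp: push_coord_def)
      obtain v where v: "v \<in> carrier (\<Lambda>at b)" "y = t b v"
        using \<open>(m1, y) \<in> push_coord t b m\<close> by (auto simp: push_coord_def)
      show ?thesis
        using u(1,2) v(1) ab push_class[OF assms, of "a \<triangleleft> b" l1 "u \<otimes>\<^bsub>\<Lambda>at a\<^esub> inv\<^bsub>\<Lambda>at a\<^esub> f (a \<triangleleft> b, b)"]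
        by (simp add: u(3,4) v(2) t.m_assoc h_inv)
    qed
    from UN_const_pair2[where F = "\<lambda>l1 x m1 y. ?r `` {(l1, x \<triangleleft>\<^bsub>E\<^esub> y)}",
        OF nonempty[OF 7(1,3)] nonempty[OF 7(2,4)] this]
    show ?case
      using 7 by (simp add: push_forward_def Let_def)
  next
    case (8 a k l)
    interpret group "\<Lambda>at a" using 8(1) by (rule group_at)
    interpret t: group "\<Lambda>' (grade I Q a)" using 8(1) by (rule target.group_at)
    have "?r `` {(k \<otimes>\<^bsub>\<Lambda>' (grade I Q a)\<^esub> l1, x)} = push_coord t a (k \<otimes>\<^bsub>\<Lambda>' (grade I Q a)\<^esub> l)"
      if "(l1, x) \<in> push_coord t a l" for l1 x
    proof -
      obtain u where u: "l1 \<in> carrier (\<Lambda>' (grade I Q a))" "u \<in> carrier (\<Lambda>at a)" "x = t a u"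
        "l = l1 \<otimes>\<^bsub>\<Lambda>' (grade I Q a)\<^esub> h (grade I Q a) u"
        using \<open>(l1, x) \<in> push_coord t a l\<close> by (auto simp: push_coord_def)
      show ?thesis
        using u(1,2) 8(1,2) push_class[OF assms, of a "k \<otimes>\<^bsub>\<Lambda>' (grade I Q a)\<^esub> l1" u]
        by (simp add: u(3,4) t.m_assoc)
    qed
    then have "(\<Union>(l1, x)\<in>push_coord t a l. ?r `` {(k \<otimes>\<^bsub>\<Lambda>' (grade I Q a)\<^esub> l1, x)})
        = push_coord t a (k \<otimes>\<^bsub>\<Lambda>' (grade I Q a)\<^esub> l)"
      by (rule UN_const_pair[OF nonempty[OF 8(1,3)]])
    moreover have "push_coord t a l \<in> (carrier (\<Lambda>' (grade I Q a)) \<times> total_part Q E (grade I Q a)) // ?r"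
      using 8 push_quotient[OF assms] by auto
    ultimately show ?case
      by (simp add: push_forward_def Let_def)
  next
    case (9 i k)
    then show ?case
      unfolding total[OF 9(1)] by (simp add: push_forward_def Let_def)
  qed (auto simp: carrier proj)
qed

lemma push_forward_extension:
  assumes "graded_extension I Q \<Lambda> E"
  shows "graded_extension I Q \<Lambda>' (push_forward I Q \<Lambda> \<Lambda>' h E)"
    and "Phi I Q \<Lambda>' (push_forward I Q \<Lambda> \<Lambda>' h E) = H2_push I Q \<Lambda>' h (Phi I Q \<Lambda> E)"
proof -
  obtain f t where E: "trivialized_extension I Q \<Lambda> E f t"
    using assms by (rule trivialization_exists)
  show "graded_extension I Q \<Lambda>' (push_forward I Q \<Lambda> \<Lambda>' h E)"
    using trivialized_push_forward[OF E] by (rule trivialized_extension.is_graded_extension)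
  show "Phi I Q \<Lambda>' (push_forward I Q \<Lambda> \<Lambda>' h E) = H2_push I Q \<Lambda>' h (Phi I Q \<Lambda> E)"
    using trivialized_push_forward[OF E] E
    by (simp add: Phi_trivialized target.Phi_trivialized H2_push_coh_class trivialized_extension.cocycle)
qed

lemma Ext_push_ext_with_class:
  assumes "c \<in> H2 I Q \<Lambda>"
  shows "Ext_push I Q \<Lambda> \<Lambda>' h (ext_with_class c) = target.ext_with_class (H2_push I Q \<Lambda>' h c)"
  unfolding Ext_push_def
  by (rule UN_ext_with_class[OF assms]) (simp add: target.ext_class_eq push_forward_extension)

end

section \<open>Change of the quandle\<close>

locale quandle_base_change = graded_coefficients I Q \<Lambda> + source: graded_quandle I Q'
  for I :: "'i set" and Q :: "('q, 'i) graded_quandle" (structure)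
    and \<Lambda> :: "'i \<Rightarrow> ('g, 'm) monoid_scheme" and Q' :: "('p, 'i) graded_quandle" +
  fixes \<phi> :: "'p \<Rightarrow> 'q"
  assumes base_hom: "\<phi> \<in> graded_quandle_hom I Q' Q"
begin

sublocale pulled: graded_coefficients I Q' \<Lambda>
  by (intro graded_coefficients.intro source.graded_quandle_axioms graded_coefficients_axioms.intro coefficients)

lemma \<phi>_closed [simp]: "a \<in> carrier Q' \<Longrightarrow> \<phi> a \<in> carrier Q"
  and grade_\<phi> [simp]: "a \<in> carrier Q' \<Longrightarrow> grade I Q (\<phi> a) = grade I Q' a"
  using graded_quandle_hom_grade[OF source.graded_quandle_axioms graded_quandle_axioms base_hom] by blast+

lemma \<phi>_op [simp]: "\<lbrakk>a \<in> carrier Q'; b \<in> carrier Q'\<rbrakk> \<Longrightarrow> \<phi> (a \<triangleright>\<^bsub>Q'\<^esub> b) = \<phi> a \<triangleright> \<phi> b"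
  using base_hom by (simp add: graded_quandle_hom_def quandle_hom_def)

lemma \<phi>_bar [simp]: "\<lbrakk>a \<in> carrier Q'; b \<in> carrier Q'\<rbrakk> \<Longrightarrow> \<phi> (a \<triangleleft>\<^bsub>Q'\<^esub> b) = \<phi> a \<triangleleft> \<phi> b"
  using base_hom quandle_hom_bar[OF source.quandle_axioms quandle_axioms]
  by (simp add: graded_quandle_hom_def)

lemma cochain_pull_apply [simp]:
  "\<lbrakk>a \<in> carrier Q'; b \<in> carrier Q'\<rbrakk> \<Longrightarrow> cochain_pull Q' \<phi> f (a, b) = f (\<phi> a, \<phi> b)"
  by (simp add: cochain_pull_def)

lemma Z2_\<phi>:
  assumes "f \<in> Z2 I Q \<Lambda>" and "a \<in> carrier Q'" and "b \<in> carrier Q'"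
  shows "f (\<phi> a, \<phi> b) \<in> carrier (\<Lambda> (grade I Q' a))"
  using Z2_closed[OF assms(1), of "\<phi> a" "\<phi> b"] assms by simp

lemma cochain_pull_Z2:
  assumes f: "f \<in> Z2 I Q \<Lambda>"
  shows "cochain_pull Q' \<phi> f \<in> Z2 I Q' \<Lambda>"
proof (rule pulled.Z2I)
  fix a b c assume "a \<in> carrier Q'" "b \<in> carrier Q'" "c \<in> carrier Q'"
  then show "cochain_pull Q' \<phi> f (a, b) \<otimes>\<^bsub>\<Lambda> (grade I Q' a)\<^esub> cochain_pull Q' \<phi> f (a \<triangleright>\<^bsub>Q'\<^esub> b, c)
      = cochain_pull Q' \<phi> f (a, c) \<otimes>\<^bsub>\<Lambda> (grade I Q' a)\<^esub> cochain_pull Q' \<phi> f (a \<triangleright>\<^bsub>Q'\<^esub> c, b \<triangleright>\<^bsub>Q'\<^esub> c)"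
    using Z2_cocycle[OF f, of "\<phi> a" "\<phi> b" "\<phi> c"] by simp
qed (simp_all add: Z2_diag[OF f] Z2_\<phi>[OF f], simp add: cochain_pull_def)

lemma cochain_pull_cohomologous:
  assumes "(f, f') \<in> cohomologous I Q \<Lambda>"
  shows "(cochain_pull Q' \<phi> f, cochain_pull Q' \<phi> f') \<in> cohomologous I Q' \<Lambda>"
proof -
  obtain g where f: "f \<in> Z2 I Q \<Lambda>" "f' \<in> Z2 I Q \<Lambda>"
    and g: "\<And>a. a \<in> carrier Q \<Longrightarrow> g a \<in> carrier (\<Lambda>at a)"
      "\<And>a b. \<lbrakk>a \<in> carrier Q; b \<in> carrier Q\<rbrakk> \<Longrightarrow> g (a \<triangleright> b) \<in> carrier (\<Lambda>at a)"
    and eq: "\<And>a b. \<lbrakk>a \<in> carrier Q; b \<in> carrier Q\<rbrakk>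
      \<Longrightarrow> g a \<otimes>\<^bsub>\<Lambda>at a\<^esub> f (a, b) = f' (a, b) \<otimes>\<^bsub>\<Lambda>at a\<^esub> g (a \<triangleright> b)"
    using assms by (erule cohomologousE)
  show ?thesis
  proof (rule pulled.cohomologousI[where g = "\<lambda>a. g (\<phi> a)"])
    show "g (\<phi> a) \<in> carrier (\<Lambda> (grade I Q' a))" if "a \<in> carrier Q'" for a
      using g(1)[of "\<phi> a"] that by simp
    show "g (\<phi> a) \<otimes>\<^bsub>\<Lambda> (grade I Q' a)\<^esub> cochain_pull Q' \<phi> f (a, b)
        = cochain_pull Q' \<phi> f' (a, b) \<otimes>\<^bsub>\<Lambda> (grade I Q' a)\<^esub> g (\<phi> (a \<triangleright>\<^bsub>Q'\<^esub> b))"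
      if "a \<in> carrier Q'" "b \<in> carrier Q'" for a b
      using eq[of "\<phi> a" "\<phi> b"] that by simp
  qed (use f cochain_pull_Z2 in blast)+
qed

lemma H2_pull_coh_class:
  assumes "f \<in> Z2 I Q \<Lambda>"
  shows "H2_pull I \<Lambda> Q' \<phi> (coh_class I Q \<Lambda> f) = coh_class I Q' \<Lambda> (cochain_pull Q' \<phi> f)"
  unfolding H2_pull_def
proof (rule UN_coh_class[OF assms])
  fix f' assume "(f, f') \<in> cohomologous I Q \<Lambda>"
  from cochain_pull_cohomologous[OF this]
  show "coh_class I Q' \<Lambda> (cochain_pull Q' \<phi> f') = coh_class I Q' \<Lambda> (cochain_pull Q' \<phi> f)"
    unfolding coh_class_def by (rule equiv_class_eq[OF pulled.equiv_cohomologous, symmetric])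
qed

lemma H2_pull_closed [simp]: "c \<in> H2 I Q \<Lambda> \<Longrightarrow> H2_pull I \<Lambda> Q' \<phi> c \<in> H2 I Q' \<Lambda>"
  by (auto simp: H2_eq H2_pull_coh_class cochain_pull_Z2)

text \<open>The fibre of the pull-back over \<open>a\<close> is the fibre of \<open>E\<close> over \<open>\<phi> a\<close>, with its coordinates.\<close>

lemma trivialized_pull_back:
  assumes "trivialized_extension I Q \<Lambda> E f t"
  shows "trivialized_extension I Q' \<Lambda> (pull_back Q' \<phi> E) (cochain_pull Q' \<phi> f) (\<lambda>a l. (a, t (\<phi> a) l))"
proof -
  interpret E: trivialized_extension I Q \<Lambda> E f t by fact
  have [simp]: "t (\<phi> a) l \<in> carrier E" "proj E (t (\<phi> a) l) = \<phi> a"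
    if "a \<in> carrier Q'" "l \<in> carrier (\<Lambda> (grade I Q' a))" for a l
    using that E.t_closed[of "\<phi> a" l] E.proj_t[of "\<phi> a" l] by simp_all
  show ?thesis
  proof (unfold_locales, goal_cases)
    case 1
    show ?case by (simp add: cochain_pull_Z2)
  next
    case (4 p)
    then obtain a x where p: "p = (a, x)" "a \<in> carrier Q'" "x \<in> carrier E" "\<phi> a = proj E x"
      by (auto simp: pull_back_def)
    obtain b l where "b \<in> carrier Q" "l \<in> carrier (\<Lambda>at b)" "x = t b l"
      using p(3) by (rule E.t_cases)
    then show ?case
      using p by auto
  next
    case (5 a l m)
    then show ?case
      using E.t_inj[of "\<phi> a" l m] by simp
  next
    case (6 a b l m)
    then show ?case
      using E.t_op[of "\<phi> a" "\<phi> b" l m] by (simp add: pull_back_def)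
  next
    case (7 a b l m)
    then show ?case
      using E.t_bar[of "\<phi> a" "\<phi> b" l m] by (simp add: pull_back_def)
  next
    case (8 a k l)
    then show ?case
      using E.act_t[of "\<phi> a" k l] by (simp add: pull_back_def)
  next
    case (9 i k)
    have "total_part Q' (pull_back Q' \<phi> E) i = {(a, x). a \<in> part Q' i \<and> x \<in> carrier E \<and> \<phi> a = proj E x}"
      using 9 by (auto simp: total_part_def pull_back_def source.mem_part_iff)
    then show ?case
      by (simp add: pull_back_def)
  qed (simp_all add: pull_back_def)
qed

lemma pull_back_extension:
  assumes "graded_extension I Q \<Lambda> E"
  shows "graded_extension I Q' \<Lambda> (pull_back Q' \<phi> E)"
    and "Phi I Q' \<Lambda> (pull_back Q' \<phi> E) = H2_pull I \<Lambda> Q' \<phi> (Phi I Q \<Lambda> E)"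
proof -
  obtain f t where E: "trivialized_extension I Q \<Lambda> E f t"
    using assms by (rule trivialization_exists)
  show "graded_extension I Q' \<Lambda> (pull_back Q' \<phi> E)"
    using trivialized_pull_back[OF E] by (rule trivialized_extension.is_graded_extension)
  show "Phi I Q' \<Lambda> (pull_back Q' \<phi> E) = H2_pull I \<Lambda> Q' \<phi> (Phi I Q \<Lambda> E)"
    using trivialized_pull_back[OF E] E
    by (simp add: Phi_trivialized pulled.Phi_trivialized H2_pull_coh_class trivialized_extension.cocycle)
qed

lemma Ext_pull_ext_with_class:
  assumes "c \<in> H2 I Q \<Lambda>"
  shows "Ext_pull I \<Lambda> Q' \<phi> (ext_with_class c) = pulled.ext_with_class (H2_pull I \<Lambda> Q' \<phi> c)"
  unfolding Ext_pull_def
  by (rule UN_ext_with_class[OF assms]) (simp add: pulled.ext_class_eq pull_back_extension)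

end

section \<open>Sums for abelian coefficients\<close>

locale graded_comm_coefficients = graded_coefficients I Q \<Lambda>
  for I :: "'i set" and Q :: "('q, 'i) graded_quandle" (structure)
    and \<Lambda> :: "'i \<Rightarrow> ('g, 'm) monoid_scheme" +
  assumes comm_coefficients: "graded_comm_group I \<Lambda>"
begin

lemma comm_group_at: "a \<in> carrier Q \<Longrightarrow> comm_group (\<Lambda>at a)"
  using comm_coefficients by (simp add: graded_comm_group_def)

lemma cochain_mult_apply [simp]:
  "\<lbrakk>a \<in> carrier Q; b \<in> carrier Q\<rbrakk> \<Longrightarrow> cochain_mult I Q \<Lambda> f f' (a, b) = f (a, b) \<otimes>\<^bsub>\<Lambda>at a\<^esub> f' (a, b)"
  by (simp add: cochain_mult_def)

lemma cochain_mult_extensional: "cochain_mult I Q \<Lambda> f f' \<in> extensional (carrier Q \<times> carrier Q)"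
  by (simp add: cochain_mult_def)

lemma cochain_mult_Z2:
  assumes f: "f \<in> Z2 I Q \<Lambda>" and f': "f' \<in> Z2 I Q \<Lambda>"
  shows "cochain_mult I Q \<Lambda> f f' \<in> Z2 I Q \<Lambda>"
proof (rule Z2I[OF cochain_mult_extensional])
  note [simp] = Z2_simps[OF f] Z2_simps[OF f']
  fix a assume a: "a \<in> carrier Q"
  interpret comm_group "\<Lambda>at a" using a by (rule comm_group_at)
  show "cochain_mult I Q \<Lambda> f f' (a, a) = \<one>\<^bsub>\<Lambda>at a\<^esub>"
    using a by simp
  fix b assume b: "b \<in> carrier Q"
  show "cochain_mult I Q \<Lambda> f f' (a, b) \<in> carrier (\<Lambda>at a)"
    using a b by simp
  fix c assume c: "c \<in> carrier Q"
  have "(f (a, b) \<otimes>\<^bsub>\<Lambda>at a\<^esub> f' (a, b)) \<otimes>\<^bsub>\<Lambda>at a\<^esub> (f (a \<triangleright> b, c) \<otimes>\<^bsub>\<Lambda>at a\<^esub> f' (a \<triangleright> b, c))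
      = (f (a, b) \<otimes>\<^bsub>\<Lambda>at a\<^esub> f (a \<triangleright> b, c)) \<otimes>\<^bsub>\<Lambda>at a\<^esub> (f' (a, b) \<otimes>\<^bsub>\<Lambda>at a\<^esub> f' (a \<triangleright> b, c))"
    using a b c by (simp add: m_ac)
  also have "\<dots> = (f (a, c) \<otimes>\<^bsub>\<Lambda>at a\<^esub> f (a \<triangleright> c, b \<triangleright> c)) \<otimes>\<^bsub>\<Lambda>at a\<^esub> (f' (a, c) \<otimes>\<^bsub>\<Lambda>at a\<^esub> f' (a \<triangleright> c, b \<triangleright> c))"
    by (simp only: Z2_cocycle[OF f a b c] Z2_cocycle[OF f' a b c])
  also have "\<dots> = (f (a, c) \<otimes>\<^bsub>\<Lambda>at a\<^esub> f' (a, c)) \<otimes>\<^bsub>\<Lambda>at a\<^esub> (f (a \<triangleright> c, b \<triangleright> c) \<otimes>\<^bsub>\<Lambda>at a\<^esub> f' (a \<triangleright> c, b \<triangleright> c))"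
    using a b c by (simp add: m_ac)
  finally show "cochain_mult I Q \<Lambda> f f' (a, b) \<otimes>\<^bsub>\<Lambda>at a\<^esub> cochain_mult I Q \<Lambda> f f' (a \<triangleright> b, c)
      = cochain_mult I Q \<Lambda> f f' (a, c) \<otimes>\<^bsub>\<Lambda>at a\<^esub> cochain_mult I Q \<Lambda> f f' (a \<triangleright> c, b \<triangleright> c)"
    using a b c by simp
qed

lemma cochain_mult_cohomologous:
  assumes "(f1, f1') \<in> cohomologous I Q \<Lambda>" and "(f2, f2') \<in> cohomologous I Q \<Lambda>"
  shows "(cochain_mult I Q \<Lambda> f1 f2, cochain_mult I Q \<Lambda> f1' f2') \<in> cohomologous I Q \<Lambda>"
proof -
  obtain g1 where f1: "f1 \<in> Z2 I Q \<Lambda>" "f1' \<in> Z2 I Q \<Lambda>"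
    and g1 [simp]: "\<And>a. a \<in> carrier Q \<Longrightarrow> g1 a \<in> carrier (\<Lambda>at a)"
      "\<And>a b. \<lbrakk>a \<in> carrier Q; b \<in> carrier Q\<rbrakk> \<Longrightarrow> g1 (a \<triangleright> b) \<in> carrier (\<Lambda>at a)"
    and eq1: "\<And>a b. \<lbrakk>a \<in> carrier Q; b \<in> carrier Q\<rbrakk>
      \<Longrightarrow> g1 a \<otimes>\<^bsub>\<Lambda>at a\<^esub> f1 (a, b) = f1' (a, b) \<otimes>\<^bsub>\<Lambda>at a\<^esub> g1 (a \<triangleright> b)"
    using assms(1) by (erule cohomologousE)
  obtain g2 where f2: "f2 \<in> Z2 I Q \<Lambda>" "f2' \<in> Z2 I Q \<Lambda>"
    and g2 [simp]: "\<And>a. a \<in> carrier Q \<Longrightarrow> g2 a \<in> carrier (\<Lambda>at a)"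
      "\<And>a b. \<lbrakk>a \<in> carrier Q; b \<in> carrier Q\<rbrakk> \<Longrightarrow> g2 (a \<triangleright> b) \<in> carrier (\<Lambda>at a)"
    and eq2: "\<And>a b. \<lbrakk>a \<in> carrier Q; b \<in> carrier Q\<rbrakk>
      \<Longrightarrow> g2 a \<otimes>\<^bsub>\<Lambda>at a\<^esub> f2 (a, b) = f2' (a, b) \<otimes>\<^bsub>\<Lambda>at a\<^esub> g2 (a \<triangleright> b)"
    using assms(2) by (erule cohomologousE)
  note [simp] = Z2_simps[OF f1(1)] Z2_simps[OF f1(2)] Z2_simps[OF f2(1)] Z2_simps[OF f2(2)]
  show ?thesis
  proof (rule cohomologousI[where g = "\<lambda>a. g1 a \<otimes>\<^bsub>\<Lambda>at a\<^esub> g2 a"])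
    fix a assume a: "a \<in> carrier Q"
    interpret comm_group "\<Lambda>at a" using a by (rule comm_group_at)
    show "g1 a \<otimes>\<^bsub>\<Lambda>at a\<^esub> g2 a \<in> carrier (\<Lambda>at a)"
      using a by simp
    fix b assume b: "b \<in> carrier Q"
    have "(g1 a \<otimes>\<^bsub>\<Lambda>at a\<^esub> g2 a) \<otimes>\<^bsub>\<Lambda>at a\<^esub> (f1 (a, b) \<otimes>\<^bsub>\<Lambda>at a\<^esub> f2 (a, b))
        = (g1 a \<otimes>\<^bsub>\<Lambda>at a\<^esub> f1 (a, b)) \<otimes>\<^bsub>\<Lambda>at a\<^esub> (g2 a \<otimes>\<^bsub>\<Lambda>at a\<^esub> f2 (a, b))"
      using a b by (simp add: m_ac)
    also have "\<dots> = (f1' (a, b) \<otimes>\<^bsub>\<Lambda>at a\<^esub> g1 (a \<triangleright> b)) \<otimes>\<^bsub>\<Lambda>at a\<^esub> (f2' (a, b) \<otimes>\<^bsub>\<Lambda>at a\<^esub> g2 (a \<triangleright> b))"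
      by (simp only: eq1[OF a b] eq2[OF a b])
    also have "\<dots> = (f1' (a, b) \<otimes>\<^bsub>\<Lambda>at a\<^esub> f2' (a, b)) \<otimes>\<^bsub>\<Lambda>at a\<^esub> (g1 (a \<triangleright> b) \<otimes>\<^bsub>\<Lambda>at a\<^esub> g2 (a \<triangleright> b))"
      using a b by (simp add: m_ac)
    finally show "(g1 a \<otimes>\<^bsub>\<Lambda>at a\<^esub> g2 a) \<otimes>\<^bsub>\<Lambda>at a\<^esub> cochain_mult I Q \<Lambda> f1 f2 (a, b)
        = cochain_mult I Q \<Lambda> f1' f2' (a, b) \<otimes>\<^bsub>\<Lambda>at a\<^esub> (g1 (a \<triangleright> b) \<otimes>\<^bsub>\<Lambda>at (a \<triangleright> b)\<^esub> g2 (a \<triangleright> b))"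
      using a b by simp
  qed (use f1 f2 cochain_mult_Z2 in blast)+
qed

lemma H2_mult_coh_class:
  assumes "f \<in> Z2 I Q \<Lambda>" and "f' \<in> Z2 I Q \<Lambda>"
  shows "coh_class I Q \<Lambda> f \<otimes>\<^bsub>H2_group I Q \<Lambda>\<^esub> coh_class I Q \<Lambda> f' = coh_class I Q \<Lambda> (cochain_mult I Q \<Lambda> f f')"
proof -
  have eq: "coh_class I Q \<Lambda> (cochain_mult I Q \<Lambda> f1 f2) = coh_class I Q \<Lambda> (cochain_mult I Q \<Lambda> f f')"
    if "(f, f1) \<in> cohomologous I Q \<Lambda>" "(f', f2) \<in> cohomologous I Q \<Lambda>" for f1 f2
    unfolding coh_class_def
    by (rule equiv_class_eq[OF equiv_cohomologous cochain_mult_cohomologous[OF that], symmetric])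
  have refl: "(f, f) \<in> cohomologous I Q \<Lambda>" "(f', f') \<in> cohomologous I Q \<Lambda>"
    using assms by (simp_all flip: coh_class_eq_iff)
  have inner: "(\<Union>f2\<in>coh_class I Q \<Lambda> f'. coh_class I Q \<Lambda> (cochain_mult I Q \<Lambda> f1 f2)) =
      coh_class I Q \<Lambda> (cochain_mult I Q \<Lambda> f f')" if f1: "(f, f1) \<in> cohomologous I Q \<Lambda>" for f1
  proof -
    have "(\<Union>f2\<in>coh_class I Q \<Lambda> f'. coh_class I Q \<Lambda> (cochain_mult I Q \<Lambda> f1 f2)) =
        coh_class I Q \<Lambda> (cochain_mult I Q \<Lambda> f1 f')"
    proof (rule UN_coh_class[OF assms(2)])
      fix f2 assume "(f', f2) \<in> cohomologous I Q \<Lambda>"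
      then show "coh_class I Q \<Lambda> (cochain_mult I Q \<Lambda> f1 f2) = coh_class I Q \<Lambda> (cochain_mult I Q \<Lambda> f1 f')"
        by (simp only: eq[OF f1] eq[OF f1 refl(2)])
    qed
    also have "\<dots> = coh_class I Q \<Lambda> (cochain_mult I Q \<Lambda> f f')"
      by (rule eq[OF f1 refl(2)])
    finally show ?thesis .
  qed
  have "(\<Union>f1\<in>coh_class I Q \<Lambda> f. \<Union>f2\<in>coh_class I Q \<Lambda> f'. coh_class I Q \<Lambda> (cochain_mult I Q \<Lambda> f1 f2)) =
      (\<Union>f2\<in>coh_class I Q \<Lambda> f'. coh_class I Q \<Lambda> (cochain_mult I Q \<Lambda> f f2))"
    by (rule UN_coh_class[OF assms(1)]) (simp only: inner inner[OF refl(1)])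
  then show ?thesis
    unfolding H2_group_def monoid.simps inner[OF refl(1)] .
qed

text \<open>
  In the sum, \<open>(t1 a l, t2 a m)\<close> and \<open>(t1 a l', t2 a m')\<close> are identified exactly when
  \<open>l m = l' m'\<close>; commutativity is what makes this value invariant under the relation.
\<close>

definition sum_coord :: "('q \<Rightarrow> 'g \<Rightarrow> 'x) \<Rightarrow> ('q \<Rightarrow> 'g \<Rightarrow> 'y) \<Rightarrow> 'q \<Rightarrow> 'g \<Rightarrow> ('x \<times> 'y) set"
  where "sum_coord t1 t2 a n = {(t1 a l, t2 a m) | l m. l \<in> carrier (\<Lambda>at a) \<and> m \<in> carrier (\<Lambda>at a) \<and>
    l \<otimes>\<^bsub>\<Lambda>at a\<^esub> m = n}"

lemma mem_sum_coordE:
  assumes "(x, y) \<in> sum_coord t1 t2 a n"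
  obtains l m where "l \<in> carrier (\<Lambda>at a)" and "m \<in> carrier (\<Lambda>at a)" and "x = t1 a l" and "y = t2 a m"
    and "n = l \<otimes>\<^bsub>\<Lambda>at a\<^esub> m"
  using assms by (auto simp: sum_coord_def)

lemma sum_class:
  assumes "trivialized_extension I Q \<Lambda> E1 f1 t1" and "trivialized_extension I Q \<Lambda> E2 f2 t2"
    and a: "a \<in> carrier Q" and l: "l \<in> carrier (\<Lambda>at a)" and m: "m \<in> carrier (\<Lambda>at a)"
  shows "sum_rel I Q \<Lambda> E1 E2 `` {(t1 a l, t2 a m)} = sum_coord t1 t2 a (l \<otimes>\<^bsub>\<Lambda>at a\<^esub> m)"
proof -
  interpret E1: trivialized_extension I Q \<Lambda> E1 f1 t1 by fact
  interpret E2: trivialized_extension I Q \<Lambda> E2 f2 t2 by fact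
  interpret comm_group "\<Lambda>at a" using a by (rule comm_group_at)
  show ?thesis
  proof (intro equalityI subsetI)
    fix q assume "q \<in> sum_rel I Q \<Lambda> E1 E2 `` {(t1 a l, t2 a m)}"
    then obtain i k x where i: "i \<in> I" and k: "k \<in> carrier (\<Lambda> i)" and x: "x \<in> total_part Q E1 i"
      and tal: "t1 a l = act E1 i k x" and q: "q = (x, act E2 i k (t2 a m))"
      by (auto simp: sum_rel_def)
    obtain b l' where b: "b \<in> carrier Q" "i = grade I Q b" "l' \<in> carrier (\<Lambda>at b)" "x = t1 b l'"
      using i x by (rule E1.total_part_cases)
    interpret b: group "\<Lambda>at b" using b(1) by (rule group_at)
    have tal': "t1 a l = t1 b (k \<otimes>\<^bsub>\<Lambda>at b\<^esub> l')"
      using tal b k by auto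
    then have ab: "a = b"
      using a l b k E1.proj_t[of a l] E1.proj_t[of b "k \<otimes>\<^bsub>\<Lambda>at b\<^esub> l'"] by auto
    then have b': "i = grade I Q a" "k \<in> carrier (\<Lambda>at a)" "l' \<in> carrier (\<Lambda>at a)" "x = t1 a l'"
      using b k by auto
    have "l = k \<otimes>\<^bsub>\<Lambda>at a\<^esub> l'"
      using tal' a l b' E1.t_inj[of a l "k \<otimes>\<^bsub>\<Lambda>at a\<^esub> l'"] unfolding ab[symmetric] by simp
    then have "q = (t1 a l', t2 a (k \<otimes>\<^bsub>\<Lambda>at a\<^esub> m))" "l' \<otimes>\<^bsub>\<Lambda>at a\<^esub> (k \<otimes>\<^bsub>\<Lambda>at a\<^esub> m) = l \<otimes>\<^bsub>\<Lambda>at a\<^esub> m"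
      using a b' m by (simp_all add: q m_ac)
    then show "q \<in> sum_coord t1 t2 a (l \<otimes>\<^bsub>\<Lambda>at a\<^esub> m)"
      using b' m unfolding sum_coord_def by blast
  next
    fix q assume "q \<in> sum_coord t1 t2 a (l \<otimes>\<^bsub>\<Lambda>at a\<^esub> m)"
    then obtain l' m' where q: "q = (t1 a l', t2 a m')" "l' \<in> carrier (\<Lambda>at a)" "m' \<in> carrier (\<Lambda>at a)"
      and eq: "l' \<otimes>\<^bsub>\<Lambda>at a\<^esub> m' = l \<otimes>\<^bsub>\<Lambda>at a\<^esub> m"
      by (auto simp: sum_coord_def)
    \<comment> \<open>the only group element that can move \<open>t1 a l'\<close> to \<open>t1 a l\<close>\<close>
    define k where "k = l \<otimes>\<^bsub>\<Lambda>at a\<^esub> inv\<^bsub>\<Lambda>at a\<^esub> l'"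
    have k: "k \<in> carrier (\<Lambda>at a)" "act E1 (grade I Q a) k (t1 a l') = t1 a l"
      using a l q by (simp_all add: k_def m_assoc)
    have "k \<otimes>\<^bsub>\<Lambda>at a\<^esub> m = inv\<^bsub>\<Lambda>at a\<^esub> l' \<otimes>\<^bsub>\<Lambda>at a\<^esub> (l \<otimes>\<^bsub>\<Lambda>at a\<^esub> m)"
      using l m q by (simp add: k_def m_ac)
    also have "\<dots> = m'"
      using q by (simp flip: eq m_assoc)
    finally have "act E2 (grade I Q a) k (t2 a m) = t2 a m'"
      using a k m by simp
    moreover have "(t1 a l', t2 a m) \<in> fibre_product E1 E2"
      using a m q by (simp add: fibre_product_def)
    ultimately have "((act E1 (grade I Q a) k (t1 a l'), t2 a m), (t1 a l', t2 a m')) \<in> sum_rel I Q \<Lambda> E1 E2"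
      unfolding sum_rel_def mem_Collect_eq using a q k
      by (intro exI[of _ "grade I Q a"] exI[of _ k] exI[of _ "t1 a l'"] exI[of _ "t2 a m"]) simp
    then show "q \<in> sum_rel I Q \<Lambda> E1 E2 `` {(t1 a l, t2 a m)}"
      using k q by simp
  qed
qed

text \<open>
  The predicate \<open>P\<close> restricts the base points, so that the carrier of the sum and the domains of the
  actions in each degree are covered together.
\<close>

lemma sum_quotient:
  assumes "trivialized_extension I Q \<Lambda> E1 f1 t1" and "trivialized_extension I Q \<Lambda> E2 f2 t2"
  shows "{p \<in> fibre_product E1 E2. P (proj E1 (fst p))} // sum_rel I Q \<Lambda> E1 E2 =
    {sum_coord t1 t2 a n | a n. a \<in> carrier Q \<and> P a \<and> n \<in> carrier (\<Lambda>at a)}" (is "?L = ?R")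
proof -
  interpret E1: trivialized_extension I Q \<Lambda> E1 f1 t1 by fact
  interpret E2: trivialized_extension I Q \<Lambda> E2 f2 t2 by fact
  show ?thesis
  proof (intro equalityI subsetI)
    fix U assume "U \<in> ?L"
    then obtain x y where xy: "x \<in> carrier E1" "y \<in> carrier E2" "proj E1 x = proj E2 y" "P (proj E1 x)"
      and U: "U = sum_rel I Q \<Lambda> E1 E2 `` {(x, y)}"
      by (auto simp: quotient_def fibre_product_def)
    obtain a l where a: "a \<in> carrier Q" "l \<in> carrier (\<Lambda>at a)" "x = t1 a l"
      using xy(1) by (rule E1.t_cases)
    obtain b m where b: "b \<in> carrier Q" "m \<in> carrier (\<Lambda>at b)" "y = t2 b m"
      using xy(2) by (rule E2.t_cases)
    interpret group "\<Lambda>at a" using a(1) by (rule group_at)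
    have "b = a"
      using xy a b by simp
    then have "P a" "m \<in> carrier (\<Lambda>at a)" "U = sum_coord t1 t2 a (l \<otimes>\<^bsub>\<Lambda>at a\<^esub> m)"
      using U a b xy sum_class[OF assms a(1,2), of m] by auto
    then show "U \<in> ?R"
      using a by blast
  next
    fix U assume "U \<in> ?R"
    then obtain a n where a: "a \<in> carrier Q" "P a" "n \<in> carrier (\<Lambda>at a)" "U = sum_coord t1 t2 a n"
      by blast
    interpret group "\<Lambda>at a" using a(1) by (rule group_at)
    have "U = sum_rel I Q \<Lambda> E1 E2 `` {(t1 a n, t2 a \<one>\<^bsub>\<Lambda>at a\<^esub>)}"
      using sum_class[OF assms a(1), of n "\<one>\<^bsub>\<Lambda>at a\<^esub>"] a by simp
    moreover have "(t1 a n, t2 a \<one>\<^bsub>\<Lambda>at a\<^esub>) \<in> {p \<in> fibre_product E1 E2. P (proj E1 (fst p))}"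
      using a by (simp add: fibre_product_def)
    ultimately show "U \<in> ?L"
      by (simp only: quotientI)
  qed
qed

lemma trivialized_ext_sum:
  assumes "trivialized_extension I Q \<Lambda> E1 f1 t1" and "trivialized_extension I Q \<Lambda> E2 f2 t2"
  shows "trivialized_extension I Q \<Lambda> (ext_sum I Q \<Lambda> E1 E2) (cochain_mult I Q \<Lambda> f1 f2) (sum_coord t1 t2)"
proof -
  interpret E1: trivialized_extension I Q \<Lambda> E1 f1 t1 by fact
  interpret E2: trivialized_extension I Q \<Lambda> E2 f2 t2 by fact
  let ?r = "sum_rel I Q \<Lambda> E1 E2" and ?S = "ext_sum I Q \<Lambda> E1 E2" and ?t = "sum_coord t1 t2"
  have nonempty: "(t1 a n, t2 a \<one>\<^bsub>\<Lambda>at a\<^esub>) \<in> ?t a n"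
    if a: "a \<in> carrier Q" and n: "n \<in> carrier (\<Lambda>at a)" for a n
  proof -
    interpret group "\<Lambda>at a" using a by (rule group_at)
    show ?thesis unfolding sum_coord_def using n r_one[OF n] one_closed by blast
  qed
  have carrier: "carrier ?S = {?t a n | a n. a \<in> carrier Q \<and> n \<in> carrier (\<Lambda>at a)}"
    using sum_quotient[OF assms, of "\<lambda>_. True"] by (simp add: ext_sum_def Let_def)
  have proj: "proj ?S (?t a n) = a" if a: "a \<in> carrier Q" and n: "n \<in> carrier (\<Lambda>at a)" for a n
  proof -
    have "(\<lambda>(x, y). proj E1 x) ` ?t a n = {a}"
      using a nonempty[OF a n] by (force simp: sum_coord_def)
    then show ?thesis
      by (simp add: ext_sum_def Let_def)
  qed
  have quotient: "(fibre_product E1 E2 \<inter> (total_part Q E1 i \<times> total_part Q E2 i)) // ?r =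
      {?t a n | a n. a \<in> carrier Q \<and> a \<in> part Q i \<and> n \<in> carrier (\<Lambda>at a)}" for i
  proof -
    have "fibre_product E1 E2 \<inter> (total_part Q E1 i \<times> total_part Q E2 i)
        = {p \<in> fibre_product E1 E2. proj E1 (fst p) \<in> part Q i}"
      by (auto simp: fibre_product_def total_part_def)
    then show ?thesis
      using sum_quotient[OF assms, of "\<lambda>a. a \<in> part Q i"] by simp
  qed
  show ?thesis
  proof (unfold_locales, goal_cases)
    case 1
    show ?case by (simp add: cochain_mult_Z2)
  next
    case (5 a l m)
    interpret group "\<Lambda>at a" using 5(1) by (rule group_at)
    have "(t1 a l, t2 a \<one>\<^bsub>\<Lambda>at a\<^esub>) \<in> ?t a m"
      using nonempty[OF 5(1,2)] 5(4) by simp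
    then obtain u v where uv: "u \<in> carrier (\<Lambda>at a)" "v \<in> carrier (\<Lambda>at a)" "t1 a l = t1 a u"
      "t2 a \<one>\<^bsub>\<Lambda>at a\<^esub> = t2 a v" "m = u \<otimes>\<^bsub>\<Lambda>at a\<^esub> v"
      by (rule mem_sum_coordE)
    have "l = u"
      by (rule E1.t_inj[OF 5(1,2) uv(1,3)])
    moreover have "\<one>\<^bsub>\<Lambda>at a\<^esub> = v"
      by (rule E2.t_inj[OF 5(1) _ uv(2,4)]) simp
    ultimately show ?case
      using uv(1,5) by auto
  next
    case (6 a b l m)
    interpret comm_group "\<Lambda>at a" using 6(1) by (rule comm_group_at)
    have "?r `` {(x \<triangleright>\<^bsub>E1\<^esub> x', y \<triangleright>\<^bsub>E2\<^esub> y')} = ?t (a \<triangleright> b) (l \<otimes>\<^bsub>\<Lambda>at a\<^esub> (f1 (a, b) \<otimes>\<^bsub>\<Lambda>at a\<^esub> f2 (a, b)))"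
      if xy: "(x, y) \<in> ?t a l" and xy': "(x', y') \<in> ?t b m" for x y x' y'
    proof -
      obtain u v where u: "u \<in> carrier (\<Lambda>at a)" "v \<in> carrier (\<Lambda>at a)"
        and eqs: "x = t1 a u" "y = t2 a v" "l = u \<otimes>\<^bsub>\<Lambda>at a\<^esub> v"
        using xy by (rule mem_sum_coordE)
      obtain u' v' where u': "u' \<in> carrier (\<Lambda>at b)" "v' \<in> carrier (\<Lambda>at b)"
        and eqs': "x' = t1 b u'" "y' = t2 b v'"
        using xy' by (rule mem_sum_coordE)
      show ?thesis
        using 6(1,2) u u' sum_class[OF assms, of "a \<triangleright> b" "u \<otimes>\<^bsub>\<Lambda>at a\<^esub> f1 (a, b)" "v \<otimes>\<^bsub>\<Lambda>at a\<^esub> f2 (a, b)"]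
        by (simp add: eqs eqs' m_ac)
    qed
    from UN_const_pair2[where F = "\<lambda>x y x' y'. ?r `` {(x \<triangleright>\<^bsub>E1\<^esub> x', y \<triangleright>\<^bsub>E2\<^esub> y')}",
        OF nonempty[OF 6(1,3)] nonempty[OF 6(2,4)] this]
    show ?case
      using 6 by (simp add: ext_sum_def Let_def)
  next
    case (7 a b l m)
    interpret comm_group "\<Lambda>at a" using 7(1) by (rule comm_group_at)
    have "?r `` {(x \<triangleleft>\<^bsub>E1\<^esub> x', y \<triangleleft>\<^bsub>E2\<^esub> y')} =
        ?t (a \<triangleleft> b) (l \<otimes>\<^bsub>\<Lambda>at a\<^esub> inv\<^bsub>\<Lambda>at a\<^esub> (f1 (a \<triangleleft> b, b) \<otimes>\<^bsub>\<Lambda>at a\<^esub> f2 (a \<triangleleft> b, b)))"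
      if xy: "(x, y) \<in> ?t a l" and xy': "(x', y') \<in> ?t b m" for x y x' y'
    proof -
      obtain u v where u: "u \<in> carrier (\<Lambda>at a)" "v \<in> carrier (\<Lambda>at a)"
        and eqs: "x = t1 a u" "y = t2 a v" "l = u \<otimes>\<^bsub>\<Lambda>at a\<^esub> v"
        using xy by (rule mem_sum_coordE)
      obtain u' v' where u': "u' \<in> carrier (\<Lambda>at b)" "v' \<in> carrier (\<Lambda>at b)"
        and eqs': "x' = t1 b u'" "y' = t2 b v'"
        using xy' by (rule mem_sum_coordE)
      show ?thesis
        using 7(1,2) u u' sum_class[OF assms, of "a \<triangleleft> b" "u \<otimes>\<^bsub>\<Lambda>at a\<^esub> inv\<^bsub>\<Lambda>at a\<^esub> f1 (a \<triangleleft> b, b)"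
            "v \<otimes>\<^bsub>\<Lambda>at a\<^esub> inv\<^bsub>\<Lambda>at a\<^esub> f2 (a \<triangleleft> b, b)"]
        by (simp add: eqs eqs' m_ac inv_mult)
    qed
    from UN_const_pair2[where F = "\<lambda>x y x' y'. ?r `` {(x \<triangleleft>\<^bsub>E1\<^esub> x', y \<triangleleft>\<^bsub>E2\<^esub> y')}",
        OF nonempty[OF 7(1,3)] nonempty[OF 7(2,4)] this]
    show ?case
      using 7 by (simp add: ext_sum_def Let_def)
  next
    case (8 a k l)
    interpret comm_group "\<Lambda>at a" using 8(1) by (rule comm_group_at)
    have "?r `` {(act E1 (grade I Q a) k x, y)} = ?t a (k \<otimes>\<^bsub>\<Lambda>at a\<^esub> l)"
      if xy: "(x, y) \<in> ?t a l" for x y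
    proof -
      obtain u v where u: "u \<in> carrier (\<Lambda>at a)" "v \<in> carrier (\<Lambda>at a)"
        and eqs: "x = t1 a u" "y = t2 a v" "l = u \<otimes>\<^bsub>\<Lambda>at a\<^esub> v"
        using xy by (rule mem_sum_coordE)
      show ?thesis
        using 8(1,2) u sum_class[OF assms, of a "k \<otimes>\<^bsub>\<Lambda>at a\<^esub> u" v] by (simp add: eqs m_assoc)
    qed
    then have "(\<Union>(x, y)\<in>?t a l. ?r `` {(act E1 (grade I Q a) k x, y)}) = ?t a (k \<otimes>\<^bsub>\<Lambda>at a\<^esub> l)"
      by (rule UN_const_pair[OF nonempty[OF 8(1,3)]])
    moreover have "?t a l \<in> (fibre_product E1 E2 \<inter>
        (total_part Q E1 (grade I Q a) \<times> total_part Q E2 (grade I Q a))) // ?r"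
      unfolding quotient using 8(1,3) mem_part_grade by blast
    ultimately show ?case
      by (simp add: ext_sum_def Let_def)
  next
    case (9 i k)
    have "total_part Q ?S i = {?t a n | a n. a \<in> carrier Q \<and> a \<in> part Q i \<and> n \<in> carrier (\<Lambda>at a)}"
      by (auto simp: total_part_def carrier proj) blast
    then show ?case
      unfolding quotient[symmetric] by (simp add: ext_sum_def Let_def)
  qed (auto simp: carrier proj)
qed

lemma ext_sum_extension:
  assumes "graded_extension I Q \<Lambda> E1" and "graded_extension I Q \<Lambda> E2"
  shows "graded_extension I Q \<Lambda> (ext_sum I Q \<Lambda> E1 E2)"
    and "Phi I Q \<Lambda> (ext_sum I Q \<Lambda> E1 E2) = Phi I Q \<Lambda> E1 \<otimes>\<^bsub>H2_group I Q \<Lambda>\<^esub> Phi I Q \<Lambda> E2"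
proof -
  obtain f1 t1 where E1: "trivialized_extension I Q \<Lambda> E1 f1 t1"
    using assms(1) by (rule trivialization_exists)
  obtain f2 t2 where E2: "trivialized_extension I Q \<Lambda> E2 f2 t2"
    using assms(2) by (rule trivialization_exists)
  show "graded_extension I Q \<Lambda> (ext_sum I Q \<Lambda> E1 E2)"
    using trivialized_ext_sum[OF E1 E2] by (rule trivialized_extension.is_graded_extension)
  show "Phi I Q \<Lambda> (ext_sum I Q \<Lambda> E1 E2) = Phi I Q \<Lambda> E1 \<otimes>\<^bsub>H2_group I Q \<Lambda>\<^esub> Phi I Q \<Lambda> E2"
    using trivialized_ext_sum[OF E1 E2] E1 E2
    by (simp add: Phi_trivialized H2_mult_coh_class trivialized_extension.cocycle)
qed

end

section \<open>Group structures\<close>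

lemma (in graded_coefficients) cochain_eqI:
  assumes "f \<in> extensional (carrier Q \<times> carrier Q)" and "f' \<in> extensional (carrier Q \<times> carrier Q)"
    and "\<And>a b. \<lbrakk>a \<in> carrier Q; b \<in> carrier Q\<rbrakk> \<Longrightarrow> f (a, b) = f' (a, b)"
  shows "f = f'"
  by (rule extensionalityI[OF assms(1,2)]) (use assms(3) in auto)

lemma (in graded_coefficients) cochain_one_Z2: "cochain_one I Q \<Lambda> \<in> Z2 I Q \<Lambda>"
  using trivialized_trivial_ext by (rule trivialized_extension.cocycle)

context graded_comm_coefficients
begin

lemma H2_mult_closed [simp]:
  "\<lbrakk>c \<in> H2 I Q \<Lambda>; d \<in> H2 I Q \<Lambda>\<rbrakk> \<Longrightarrow> c \<otimes>\<^bsub>H2_group I Q \<Lambda>\<^esub> d \<in> H2 I Q \<Lambda>"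
  by (auto simp: H2_eq H2_mult_coh_class cochain_mult_Z2)

lemma cochain_mult_assoc:
  assumes "f \<in> Z2 I Q \<Lambda>" and "f' \<in> Z2 I Q \<Lambda>" and "f'' \<in> Z2 I Q \<Lambda>"
  shows "cochain_mult I Q \<Lambda> (cochain_mult I Q \<Lambda> f f') f'' = cochain_mult I Q \<Lambda> f (cochain_mult I Q \<Lambda> f' f'')"
proof (rule cochain_eqI[OF cochain_mult_extensional cochain_mult_extensional])
  fix a b assume ab: "a \<in> carrier Q" "b \<in> carrier Q"
  interpret comm_group "\<Lambda>at a" using ab(1) by (rule comm_group_at)
  show "cochain_mult I Q \<Lambda> (cochain_mult I Q \<Lambda> f f') f'' (a, b)
      = cochain_mult I Q \<Lambda> f (cochain_mult I Q \<Lambda> f' f'') (a, b)"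
    using ab assms[THEN Z2_closed] by (simp add: m_assoc)
qed

lemma cochain_mult_comm:
  assumes "f \<in> Z2 I Q \<Lambda>" and "f' \<in> Z2 I Q \<Lambda>"
  shows "cochain_mult I Q \<Lambda> f f' = cochain_mult I Q \<Lambda> f' f"
proof (rule cochain_eqI[OF cochain_mult_extensional cochain_mult_extensional])
  fix a b assume ab: "a \<in> carrier Q" "b \<in> carrier Q"
  interpret comm_group "\<Lambda>at a" using ab(1) by (rule comm_group_at)
  show "cochain_mult I Q \<Lambda> f f' (a, b) = cochain_mult I Q \<Lambda> f' f (a, b)"
    using ab assms[THEN Z2_closed] by (simp add: m_comm)
qed

lemma cochain_mult_one:
  assumes "f \<in> Z2 I Q \<Lambda>"
  shows "cochain_mult I Q \<Lambda> (cochain_one I Q \<Lambda>) f = f"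
proof (rule cochain_eqI[OF cochain_mult_extensional Z2_extensional[OF assms]])
  fix a b assume ab: "a \<in> carrier Q" "b \<in> carrier Q"
  interpret comm_group "\<Lambda>at a" using ab(1) by (rule comm_group_at)
  show "cochain_mult I Q \<Lambda> (cochain_one I Q \<Lambda>) f (a, b) = f (a, b)"
    using ab Z2_closed[OF assms ab] by (simp add: cochain_one_def)
qed

lemma cochain_inverse:
  assumes f: "f \<in> Z2 I Q \<Lambda>"
  shows "\<exists>f'\<in>Z2 I Q \<Lambda>. cochain_mult I Q \<Lambda> f' f = cochain_one I Q \<Lambda>"
proof
  let ?f = "\<lambda>(a, b)\<in>carrier Q \<times> carrier Q. inv\<^bsub>\<Lambda>at a\<^esub> f (a, b)"
  note [simp] = Z2_simps[OF f]
  show "?f \<in> Z2 I Q \<Lambda>"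
  proof (rule Z2I)
    fix a assume a: "a \<in> carrier Q"
    interpret comm_group "\<Lambda>at a" using a by (rule comm_group_at)
    show "?f (a, a) = \<one>\<^bsub>\<Lambda>at a\<^esub>"
      using a by simp
    fix b assume b: "b \<in> carrier Q"
    show "?f (a, b) \<in> carrier (\<Lambda>at a)"
      using a b by simp
    fix c assume c: "c \<in> carrier Q"
    have "inv\<^bsub>\<Lambda>at a\<^esub> (f (a, b) \<otimes>\<^bsub>\<Lambda>at a\<^esub> f (a \<triangleright> b, c)) = inv\<^bsub>\<Lambda>at a\<^esub> (f (a, c) \<otimes>\<^bsub>\<Lambda>at a\<^esub> f (a \<triangleright> c, b \<triangleright> c))"
      by (simp only: Z2_cocycle[OF f a b c])
    then show "?f (a, b) \<otimes>\<^bsub>\<Lambda>at a\<^esub> ?f (a \<triangleright> b, c) = ?f (a, c) \<otimes>\<^bsub>\<Lambda>at a\<^esub> ?f (a \<triangleright> c, b \<triangleright> c)"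
      using a b c by (simp add: inv_mult)
  qed simp
  show "cochain_mult I Q \<Lambda> ?f f = cochain_one I Q \<Lambda>"
  proof (rule cochain_eqI[OF cochain_mult_extensional Z2_extensional[OF cochain_one_Z2]])
    fix a b assume ab: "a \<in> carrier Q" "b \<in> carrier Q"
    interpret comm_group "\<Lambda>at a" using ab(1) by (rule comm_group_at)
    show "cochain_mult I Q \<Lambda> ?f f (a, b) = cochain_one I Q \<Lambda> (a, b)"
      using ab by (simp add: cochain_one_def)
  qed
qed

lemma H2_carrier [simp]: "carrier (H2_group I Q \<Lambda>) = H2 I Q \<Lambda>"
  and H2_one: "\<one>\<^bsub>H2_group I Q \<Lambda>\<^esub> = coh_class I Q \<Lambda> (cochain_one I Q \<Lambda>)"
  by (simp_all add: H2_group_def)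

lemma H2_cases:
  assumes "c \<in> H2 I Q \<Lambda>"
  obtains f where "f \<in> Z2 I Q \<Lambda>" and "c = coh_class I Q \<Lambda> f"
  using assms by (auto simp: H2_eq)

lemma comm_group_H2: "comm_group (H2_group I Q \<Lambda>)"
proof (rule comm_groupI)
  show "\<one>\<^bsub>H2_group I Q \<Lambda>\<^esub> \<in> carrier (H2_group I Q \<Lambda>)"
    by (simp add: H2_one cochain_one_Z2)
next
  fix x y z assume "x \<in> carrier (H2_group I Q \<Lambda>)" "y \<in> carrier (H2_group I Q \<Lambda>)" "z \<in> carrier (H2_group I Q \<Lambda>)"
  then show "x \<otimes>\<^bsub>H2_group I Q \<Lambda>\<^esub> y \<otimes>\<^bsub>H2_group I Q \<Lambda>\<^esub> z = x \<otimes>\<^bsub>H2_group I Q \<Lambda>\<^esub> (y \<otimes>\<^bsub>H2_group I Q \<Lambda>\<^esub> z)"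
    by (auto simp: H2_mult_coh_class cochain_mult_Z2 cochain_mult_assoc elim!: H2_cases)
next
  fix x y assume "x \<in> carrier (H2_group I Q \<Lambda>)" "y \<in> carrier (H2_group I Q \<Lambda>)"
  then obtain f f' where "f \<in> Z2 I Q \<Lambda>" "x = coh_class I Q \<Lambda> f" "f' \<in> Z2 I Q \<Lambda>" "y = coh_class I Q \<Lambda> f'"
    by (auto elim!: H2_cases)
  then show "x \<otimes>\<^bsub>H2_group I Q \<Lambda>\<^esub> y = y \<otimes>\<^bsub>H2_group I Q \<Lambda>\<^esub> x"
    using cochain_mult_comm[of f f'] by (simp add: H2_mult_coh_class)
next
  fix x assume "x \<in> carrier (H2_group I Q \<Lambda>)"
  then obtain f where f: "f \<in> Z2 I Q \<Lambda>" "x = coh_class I Q \<Lambda> f"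
    by (auto elim!: H2_cases)
  then show "\<one>\<^bsub>H2_group I Q \<Lambda>\<^esub> \<otimes>\<^bsub>H2_group I Q \<Lambda>\<^esub> x = x"
    by (simp add: H2_one H2_mult_coh_class cochain_one_Z2 cochain_mult_one)
  obtain f' where "f' \<in> Z2 I Q \<Lambda>" "cochain_mult I Q \<Lambda> f' f = cochain_one I Q \<Lambda>"
    using cochain_inverse[OF f(1)] by blast
  then show "\<exists>y\<in>carrier (H2_group I Q \<Lambda>). y \<otimes>\<^bsub>H2_group I Q \<Lambda>\<^esub> x = \<one>\<^bsub>H2_group I Q \<Lambda>\<^esub>"
    using f by (intro bexI[of _ "coh_class I Q \<Lambda> f'"]) (simp_all add: H2_one H2_mult_coh_class)
qed simp

lemma Ext_mult:
  assumes c: "c \<in> H2 I Q \<Lambda>" and d: "d \<in> H2 I Q \<Lambda>"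
  shows "ext_with_class c \<otimes>\<^bsub>Ext_group I Q \<Lambda>\<^esub> ext_with_class d = ext_with_class (c \<otimes>\<^bsub>H2_group I Q \<Lambda>\<^esub> d)"
proof -
  have "(\<Union>E2\<in>ext_with_class d. ext_class I Q \<Lambda> (ext_sum I Q \<Lambda> E1 E2)) = ext_with_class (c \<otimes>\<^bsub>H2_group I Q \<Lambda>\<^esub> d)"
    if "graded_extension I Q \<Lambda> E1" and "Phi I Q \<Lambda> E1 = c" for E1 :: "('q \<times> 'g, 'q, 'i, 'g) extension"
    by (rule UN_ext_with_class[OF d]) (use that in \<open>simp add: ext_class_eq ext_sum_extension\<close>)
  then have "(\<Union>E1\<in>ext_with_class c. \<Union>E2\<in>ext_with_class d. ext_class I Q \<Lambda> (ext_sum I Q \<Lambda> E1 E2))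
      = ext_with_class (c \<otimes>\<^bsub>H2_group I Q \<Lambda>\<^esub> d)"
    by (rule UN_ext_with_class[OF c])
  then show ?thesis
    by (simp add: Ext_group_def)
qed

lemma Ext_one: "\<one>\<^bsub>Ext_group I Q \<Lambda>\<^esub> = ext_with_class \<one>\<^bsub>H2_group I Q \<Lambda>\<^esub>"
  using trivialized_extension.is_graded_extension[OF trivialized_trivial_ext]
  by (simp add: Ext_group_def ext_class_eq Phi_trivialized[OF trivialized_trivial_ext] H2_one)

lemma iso_ext_with_class: "ext_with_class \<in> iso (H2_group I Q \<Lambda>) (Ext_group I Q \<Lambda>)"
  by (rule isoI, rule homI)
    (simp_all add: Ext_mult Ext_group_def Ext_eq bij_betw_def inj_ext_with_class flip: Ext_mult)

lemma comm_group_Ext: "comm_group (Ext_group I Q \<Lambda>)"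
  using comm_group.iso_imp_img_comm_group[OF comm_group_H2 iso_ext_with_class]
  by (simp flip: Ext_one)

lemma iso_Phi_Ext: "Phi_Ext I Q \<Lambda> \<in> iso (Ext_group I Q \<Lambda>) (H2_group I Q \<Lambda>)"
proof (rule isoI, rule homI)
  have carrier: "carrier (Ext_group I Q \<Lambda>) = ext_with_class ` H2 I Q \<Lambda>"
    by (simp add: Ext_group_def Ext_eq)
  show "Phi_Ext I Q \<Lambda> U \<in> carrier (H2_group I Q \<Lambda>)" if "U \<in> carrier (Ext_group I Q \<Lambda>)" for U
    using that by (auto simp: carrier)
  show "Phi_Ext I Q \<Lambda> (U \<otimes>\<^bsub>Ext_group I Q \<Lambda>\<^esub> V) = Phi_Ext I Q \<Lambda> U \<otimes>\<^bsub>H2_group I Q \<Lambda>\<^esub> Phi_Ext I Q \<Lambda> V"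
    if "U \<in> carrier (Ext_group I Q \<Lambda>)" "V \<in> carrier (Ext_group I Q \<Lambda>)" for U V
    using that by (auto simp: carrier Ext_mult)
  show "bij_betw (Phi_Ext I Q \<Lambda>) (carrier (Ext_group I Q \<Lambda>)) (carrier (H2_group I Q \<Lambda>))"
    using bij_Phi_Ext by (simp add: Ext_group_def)
qed

end

lemma (in coefficient_hom) H2_push_mult:
  assumes "graded_comm_group I \<Lambda>" and "graded_comm_group I \<Lambda>'"
    and c: "c \<in> H2 I Q \<Lambda>" and d: "d \<in> H2 I Q \<Lambda>"
  shows "H2_push I Q \<Lambda>' h (c \<otimes>\<^bsub>H2_group I Q \<Lambda>\<^esub> d) =
    H2_push I Q \<Lambda>' h c \<otimes>\<^bsub>H2_group I Q \<Lambda>'\<^esub> H2_push I Q \<Lambda>' h d"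
proof -
  interpret comm: graded_comm_coefficients I Q \<Lambda>
    by unfold_locales fact
  interpret comm': graded_comm_coefficients I Q \<Lambda>'
    by unfold_locales fact
  obtain f f' where f: "f \<in> Z2 I Q \<Lambda>" "f' \<in> Z2 I Q \<Lambda>" and cd: "c = coh_class I Q \<Lambda> f" "d = coh_class I Q \<Lambda> f'"
    using c d by (auto simp: H2_eq)
  have "cochain_push I Q h (cochain_mult I Q \<Lambda> f f')
      = cochain_mult I Q \<Lambda>' (cochain_push I Q h f) (cochain_push I Q h f')"
  proof (rule cochain_eqI)
    show "cochain_push I Q h (cochain_mult I Q \<Lambda> f f') (a, b)
        = cochain_mult I Q \<Lambda>' (cochain_push I Q h f) (cochain_push I Q h f') (a, b)"
      if "a \<in> carrier Q" "b \<in> carrier Q" for a b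
      using that by (simp add: Z2_closed[OF f(1)] Z2_closed[OF f(2)])
  qed (simp_all add: cochain_push_def cochain_mult_def)
  then show ?thesis
    using f by (simp add: cd comm.H2_mult_coh_class comm'.H2_mult_coh_class H2_push_coh_class
        comm.cochain_mult_Z2 cochain_push_Z2)
qed

lemma (in quandle_base_change) H2_pull_mult:
  assumes "graded_comm_group I \<Lambda>" and c: "c \<in> H2 I Q \<Lambda>" and d: "d \<in> H2 I Q \<Lambda>"
  shows "H2_pull I \<Lambda> Q' \<phi> (c \<otimes>\<^bsub>H2_group I Q \<Lambda>\<^esub> d) =
    H2_pull I \<Lambda> Q' \<phi> c \<otimes>\<^bsub>H2_group I Q' \<Lambda>\<^esub> H2_pull I \<Lambda> Q' \<phi> d"
proof -
  interpret comm: graded_comm_coefficients I Q \<Lambda>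
    by unfold_locales fact
  interpret comm': graded_comm_coefficients I Q' \<Lambda>
    by unfold_locales fact
  obtain f f' where f: "f \<in> Z2 I Q \<Lambda>" "f' \<in> Z2 I Q \<Lambda>" and cd: "c = coh_class I Q \<Lambda> f" "d = coh_class I Q \<Lambda> f'"
    using c d by (auto simp: H2_eq)
  have "cochain_pull Q' \<phi> (cochain_mult I Q \<Lambda> f f')
      = cochain_mult I Q' \<Lambda> (cochain_pull Q' \<phi> f) (cochain_pull Q' \<phi> f')"
    by (rule pulled.cochain_eqI) (simp_all add: cochain_pull_def cochain_mult_def)
  then show ?thesis
    using f by (simp add: cd comm.H2_mult_coh_class comm'.H2_mult_coh_class H2_pull_coh_class
        comm.cochain_mult_Z2 cochain_pull_Z2)
qed

section \<open>Module structures\<close>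

lemma left_module_transfer:
  assumes "left_module R N" and \<psi>: "\<psi> \<in> left_module_iso R N M" and zero: "\<psi> \<zero>\<^bsub>N\<^esub> = \<zero>\<^bsub>M\<^esub>"
  shows "left_module R M"
proof -
  interpret N: left_module R N by fact
  have carrier: "carrier M = \<psi> ` carrier N"
    using \<psi> by (simp add: left_module_iso_def bij_betw_def)
  have add: "\<psi> x \<oplus>\<^bsub>M\<^esub> \<psi> y = \<psi> (x \<oplus>\<^bsub>N\<^esub> y)" if "x \<in> carrier N" "y \<in> carrier N" for x y
    using \<psi> that by (simp add: left_module_iso_def left_module_hom_def)
  have smult: "r \<odot>\<^bsub>M\<^esub> \<psi> x = \<psi> (r \<odot>\<^bsub>N\<^esub> x)" if "r \<in> carrier R" "x \<in> carrier N" for r x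
    using \<psi> that by (simp add: left_module_iso_def left_module_hom_def)
  note [simp] = add smult N.smult_closed
  show ?thesis
  proof (intro left_module.intro left_module_axioms.intro abelian_groupI N.R.ring_axioms)
    show "\<exists>y\<in>carrier M. y \<oplus>\<^bsub>M\<^esub> x = \<zero>\<^bsub>M\<^esub>" if "x \<in> carrier M" for x
      using that by (auto simp: carrier N.M.l_neg simp flip: zero intro!: bexI[of _ "\<ominus>\<^bsub>N\<^esub> _"])
  qed (auto simp: carrier N.M.a_ac N.smult_l_distr N.smult_r_distr N.smult_assoc1
      N.smult_one simp flip: zero)
qed

text \<open>
  This reduces all linearity claims about \<open>Ext\<close> to cohomology: in the applications \<open>\<psi>\<close> is
  \<open>ext_with_class\<close>, and \<open>k\<close> is the map corresponding to \<open>H\<close> on cohomology classes.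
\<close>

lemma left_module_hom_transfer:
  assumes "left_module R N" and "\<psi> \<in> left_module_iso R N M" and "\<psi>' \<in> left_module_hom R N' M'"
    and "k \<in> left_module_hom R N N'" and "\<And>x. x \<in> carrier N \<Longrightarrow> H (\<psi> x) = \<psi>' (k x)"
  shows "H \<in> left_module_hom R M M'"
proof -
  interpret N: left_module R N by fact
  have carrier: "carrier M = \<psi> ` carrier N"
    using assms(2) by (simp add: left_module_iso_def bij_betw_def)
  have add: "\<psi> x \<oplus>\<^bsub>M\<^esub> \<psi> y = \<psi> (x \<oplus>\<^bsub>N\<^esub> y)" if "x \<in> carrier N" "y \<in> carrier N" for x y
    using assms(2) that by (simp add: left_module_iso_def left_module_hom_def)
  have smult: "r \<odot>\<^bsub>M\<^esub> \<psi> x = \<psi> (r \<odot>\<^bsub>N\<^esub> x)" if "r \<in> carrier R" "x \<in> carrier N" for r x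
    using assms(2) that by (simp add: left_module_iso_def left_module_hom_def)
  show ?thesis
    using assms(3,4) by (auto simp: left_module_hom_def carrier add smult N.smult_closed assms(5) Pi_iff)
qed

locale graded_module_coefficients = graded_quandle I Q
  for I :: "'i set" and Q :: "('q, 'i) graded_quandle" (structure) +
  fixes R :: "('r, 'k) ring_scheme" and M :: "'i \<Rightarrow> ('r, 'g, 'n) module_scheme"
  assumes ring: "ring R" and modules: "i \<in> I \<Longrightarrow> left_module R (M i)"
begin

lemma comm_modules: "graded_comm_group I (add_grp M)"
  using modules by (simp add: graded_comm_group_def left_module_def abelian_group.a_comm_group)

sublocale graded_comm_coefficients I Q "add_grp M"
proof
  show "graded_group I (add_grp M)"
    using comm_modules by (simp add: graded_group_def graded_comm_group_def comm_group.axioms(2))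
qed (rule comm_modules)

lemma coefficient_hom_scalar:
  assumes "r \<in> carrier R"
  shows "coefficient_hom I Q (add_grp M) (add_grp M) (scalar M r)"
proof
  show "scalar M r \<in> graded_hom I (add_grp M) (add_grp M)"
    using assms
    by (auto simp: graded_hom_def hom_def scalar_def left_module.smult_closed[OF modules]
        left_module.smult_r_distr[OF modules])
qed

lemma module_at: "a \<in> carrier Q \<Longrightarrow> left_module R (M (grade I Q a))"
  using modules by simp

lemma Z2_module_closed:
  "\<lbrakk>f \<in> Z2 I Q (add_grp M); a \<in> carrier Q; b \<in> carrier Q\<rbrakk> \<Longrightarrow> f (a, b) \<in> carrier (M (grade I Q a))"
  using Z2_closed[of f a b] by simp

lemma scalar_push_apply:
  "\<lbrakk>a \<in> carrier Q; b \<in> carrier Q\<rbrakk> \<Longrightarrow> cochain_push I Q (scalar M r) f (a, b) = r \<odot>\<^bsub>M (grade I Q a)\<^esub> f (a, b)"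
  by (simp add: cochain_push_def scalar_def)

lemma scalar_push_Z2:
  "\<lbrakk>r \<in> carrier R; f \<in> Z2 I Q (add_grp M)\<rbrakk> \<Longrightarrow> cochain_push I Q (scalar M r) f \<in> Z2 I Q (add_grp M)"
  by (rule coefficient_hom.cochain_push_Z2[OF coefficient_hom_scalar])

lemma scalar_push_extensional: "cochain_push I Q (scalar M r) f \<in> extensional (carrier Q \<times> carrier Q)"
  by (simp add: cochain_push_def)

lemma H2_module_simps:
  "carrier (H2_module I Q M) = H2 I Q (add_grp M)"
  "\<zero>\<^bsub>H2_module I Q M\<^esub> = \<one>\<^bsub>H2_group I Q (add_grp M)\<^esub>"
  "c \<oplus>\<^bsub>H2_module I Q M\<^esub> d = c \<otimes>\<^bsub>H2_group I Q (add_grp M)\<^esub> d"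
  "r \<odot>\<^bsub>H2_module I Q M\<^esub> c = H2_push I Q (add_grp M) (scalar M r) c"
  by (simp_all add: H2_module_def H2_push_def)

lemma Ext_module_simps:
  "carrier (Ext_module I Q M) = Ext I Q (add_grp M)"
  "\<zero>\<^bsub>Ext_module I Q M\<^esub> = \<one>\<^bsub>Ext_group I Q (add_grp M)\<^esub>"
  "U \<oplus>\<^bsub>Ext_module I Q M\<^esub> V = U \<otimes>\<^bsub>Ext_group I Q (add_grp M)\<^esub> V"
  "r \<odot>\<^bsub>Ext_module I Q M\<^esub> U = Ext_push I Q (add_grp M) (add_grp M) (scalar M r) U"
  by (simp_all add: Ext_module_def)

lemma H2_scalar_coh_class:
  "\<lbrakk>r \<in> carrier R; f \<in> Z2 I Q (add_grp M)\<rbrakk> \<Longrightarrow>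
    H2_push I Q (add_grp M) (scalar M r) (coh_class I Q (add_grp M) f)
      = coh_class I Q (add_grp M) (cochain_push I Q (scalar M r) f)"
  by (rule coefficient_hom.H2_push_coh_class[OF coefficient_hom_scalar])

lemma left_module_H2: "left_module R (H2_module I Q M)"
proof (intro left_module.intro left_module_axioms.intro ring)
  interpret H2: comm_group "H2_group I Q (add_grp M)"
    by (rule comm_group_H2)
  show "abelian_group (H2_module I Q M)"
  proof (rule abelian_groupI)
    fix x y z
    assume "x \<in> carrier (H2_module I Q M)" "y \<in> carrier (H2_module I Q M)" "z \<in> carrier (H2_module I Q M)"
    then show "x \<oplus>\<^bsub>H2_module I Q M\<^esub> y \<oplus>\<^bsub>H2_module I Q M\<^esub> z = x \<oplus>\<^bsub>H2_module I Q M\<^esub> (y \<oplus>\<^bsub>H2_module I Q M\<^esub> z)"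
      using H2.m_assoc by (simp add: H2_module_simps)
  next
    fix x y assume "x \<in> carrier (H2_module I Q M)" "y \<in> carrier (H2_module I Q M)"
    then show "x \<oplus>\<^bsub>H2_module I Q M\<^esub> y = y \<oplus>\<^bsub>H2_module I Q M\<^esub> x"
      using H2.m_comm by (simp add: H2_module_simps)
  next
    fix x assume "x \<in> carrier (H2_module I Q M)"
    then show "\<exists>y\<in>carrier (H2_module I Q M). y \<oplus>\<^bsub>H2_module I Q M\<^esub> x = \<zero>\<^bsub>H2_module I Q M\<^esub>"
      using H2.l_inv_ex by (simp add: H2_module_simps)
  qed (use H2.one_closed H2.l_one in \<open>simp_all add: H2_module_simps\<close>)
next
  fix r c assume "r \<in> carrier R" "c \<in> carrier (H2_module I Q M)"
  then show "r \<odot>\<^bsub>H2_module I Q M\<^esub> c \<in> carrier (H2_module I Q M)"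
    by (simp add: H2_module_simps coefficient_hom.H2_push_closed[OF coefficient_hom_scalar])
next
  fix r s c assume r: "r \<in> carrier R" and s: "s \<in> carrier R" and "c \<in> carrier (H2_module I Q M)"
  then obtain f where f: "f \<in> Z2 I Q (add_grp M)" "c = coh_class I Q (add_grp M) f"
    by (auto simp: H2_module_simps elim!: H2_cases)
  interpret R: ring R by (rule ring)
  have "cochain_push I Q (scalar M (r \<oplus>\<^bsub>R\<^esub> s)) f = cochain_mult I Q (add_grp M)
      (cochain_push I Q (scalar M r) f) (cochain_push I Q (scalar M s) f)"
    by (rule cochain_eqI[OF scalar_push_extensional cochain_mult_extensional])
      (use r s f(1) in \<open>simp add: scalar_push_apply Z2_module_closed left_module.smult_l_distr[OF module_at]\<close>)
  then show "(r \<oplus>\<^bsub>R\<^esub> s) \<odot>\<^bsub>H2_module I Q M\<^esub> c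
      = r \<odot>\<^bsub>H2_module I Q M\<^esub> c \<oplus>\<^bsub>H2_module I Q M\<^esub> s \<odot>\<^bsub>H2_module I Q M\<^esub> c"
    using r s f(1) by (simp add: H2_module_simps f(2) H2_scalar_coh_class H2_mult_coh_class scalar_push_Z2)
  have "cochain_push I Q (scalar M (r \<otimes>\<^bsub>R\<^esub> s)) f
      = cochain_push I Q (scalar M r) (cochain_push I Q (scalar M s) f)"
    by (rule cochain_eqI[OF scalar_push_extensional scalar_push_extensional])
      (use r s f(1) in \<open>simp add: scalar_push_apply Z2_module_closed left_module.smult_assoc1[OF module_at]\<close>)
  then show "(r \<otimes>\<^bsub>R\<^esub> s) \<odot>\<^bsub>H2_module I Q M\<^esub> c = r \<odot>\<^bsub>H2_module I Q M\<^esub> (s \<odot>\<^bsub>H2_module I Q M\<^esub> c)"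
    using r s f(1) by (simp add: H2_module_simps f(2) H2_scalar_coh_class scalar_push_Z2)
next
  fix r c d assume "r \<in> carrier R" "c \<in> carrier (H2_module I Q M)" "d \<in> carrier (H2_module I Q M)"
  then show "r \<odot>\<^bsub>H2_module I Q M\<^esub> (c \<oplus>\<^bsub>H2_module I Q M\<^esub> d)
      = r \<odot>\<^bsub>H2_module I Q M\<^esub> c \<oplus>\<^bsub>H2_module I Q M\<^esub> r \<odot>\<^bsub>H2_module I Q M\<^esub> d"
    by (simp add: H2_module_simps comm_modules coefficient_hom.H2_push_mult[OF coefficient_hom_scalar])
next
  fix c assume "c \<in> carrier (H2_module I Q M)"
  then obtain f where f: "f \<in> Z2 I Q (add_grp M)" "c = coh_class I Q (add_grp M) f"
    by (auto simp: H2_module_simps elim!: H2_cases)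
  interpret R: ring R by (rule ring)
  have "cochain_push I Q (scalar M \<one>\<^bsub>R\<^esub>) f = f"
    by (rule cochain_eqI[OF scalar_push_extensional Z2_extensional[OF f(1)]])
      (use f(1) in \<open>simp add: scalar_push_apply Z2_module_closed left_module.smult_one[OF module_at]\<close>)
  then show "\<one>\<^bsub>R\<^esub> \<odot>\<^bsub>H2_module I Q M\<^esub> c = c"
    using f(1) by (simp add: H2_module_simps f(2) H2_scalar_coh_class)
qed

lemma iso_ext_with_class_module:
  "ext_with_class \<in> left_module_iso R (H2_module I Q M) (Ext_module I Q M)"
  unfolding left_module_iso_def left_module_hom_def
  by (auto simp: H2_module_simps Ext_module_simps Ext_eq Ext_mult bij_betw_def inj_ext_with_class
      coefficient_hom.Ext_push_ext_with_class[OF coefficient_hom_scalar])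

lemma left_module_Ext: "left_module R (Ext_module I Q M)"
  by (rule left_module_transfer[OF left_module_H2 iso_ext_with_class_module])
    (simp add: H2_module_simps Ext_module_simps Ext_one)

lemma iso_Phi_Ext_module:
  "Phi_Ext I Q (add_grp M) \<in> left_module_iso R (Ext_module I Q M) (H2_module I Q M)"
proof -
  have "id \<in> left_module_hom R (H2_module I Q M) (H2_module I Q M)"
    by (simp add: left_module_hom_def)
  then have "Phi_Ext I Q (add_grp M) \<in> left_module_hom R (Ext_module I Q M) (H2_module I Q M)"
    by (rule left_module_hom_transfer[OF left_module_H2 iso_ext_with_class_module, of id])
      (simp_all add: left_module_hom_def H2_module_simps)
  then show ?thesis
    using bij_Phi_Ext by (simp add: left_module_iso_def H2_module_simps Ext_module_simps)
qed

lemma Ext_hom_transfer: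
  assumes "graded_module_coefficients I Q' R M'"
    and "k \<in> left_module_hom R (H2_module I Q M) (H2_module I Q' M')"
    and "\<And>c. c \<in> H2 I Q (add_grp M) \<Longrightarrow>
      H (ext_with_class c) = graded_coefficients.ext_with_class I Q' (add_grp M') (k c)"
  shows "H \<in> left_module_hom R (Ext_module I Q M) (Ext_module I Q' M')"
proof -
  interpret target: graded_module_coefficients I Q' R M' by fact
  show ?thesis
    by (rule left_module_hom_transfer[OF left_module_H2 iso_ext_with_class_module _ assms(2)])
      (use assms(3) target.iso_ext_with_class_module in \<open>simp_all add: left_module_iso_def H2_module_simps\<close>)
qed

text \<open>Linearity of the components \<open>h i\<close> makes pushing along \<open>h\<close> commute with pushing along scalars.\<close>

lemma push_module_hom:
  assumes "graded_module_coefficients I Q R M'" and h: "\<And>i. i \<in> I \<Longrightarrow> h i \<in> left_module_hom R (M i) (M' i)"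
  shows "H2_push I Q (add_grp M') h \<in> left_module_hom R (H2_module I Q M) (H2_module I Q M')"
    and "Ext_push I Q (add_grp M) (add_grp M') h \<in> left_module_hom R (Ext_module I Q M) (Ext_module I Q M')"
proof -
  interpret target: graded_module_coefficients I Q R M' by fact
  interpret push: coefficient_hom I Q "add_grp M" "add_grp M'" h
  proof
    show "h \<in> graded_hom I (add_grp M) (add_grp M')"
      using h by (auto simp: graded_hom_def hom_def left_module_hom_def)
  qed
  have smult: "H2_push I Q (add_grp M') h (H2_push I Q (add_grp M) (scalar M r) c)
      = H2_push I Q (add_grp M') (scalar M' r) (H2_push I Q (add_grp M') h c)"
    if r: "r \<in> carrier R" and c: "c \<in> H2 I Q (add_grp M)" for r c
  proof -
    obtain f where f: "f \<in> Z2 I Q (add_grp M)" "c = coh_class I Q (add_grp M) f"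
      using c by (rule H2_cases)
    have "cochain_push I Q h (cochain_push I Q (scalar M r) f)
        = cochain_push I Q (scalar M' r) (cochain_push I Q h f)"
    proof (rule cochain_eqI)
      fix a b assume ab: "a \<in> carrier Q" "b \<in> carrier Q"
      show "cochain_push I Q h (cochain_push I Q (scalar M r) f) (a, b)
          = cochain_push I Q (scalar M' r) (cochain_push I Q h f) (a, b)"
        using h[of "grade I Q a"] r ab Z2_module_closed[OF f(1) ab]
        by (simp add: scalar_push_apply target.scalar_push_apply left_module_hom_def)
    qed (simp_all add: cochain_push_def)
    then show ?thesis
      using r f(1) by (simp add: f(2) H2_scalar_coh_class target.H2_scalar_coh_class push.H2_push_coh_class
          scalar_push_Z2 push.cochain_push_Z2)
  qed
  show "H2_push I Q (add_grp M') h \<in> left_module_hom R (H2_module I Q M) (H2_module I Q M')"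
    by (auto simp: left_module_hom_def H2_module_simps target.H2_module_simps smult
        push.H2_push_mult[OF comm_modules target.comm_modules])
  then show "Ext_push I Q (add_grp M) (add_grp M') h \<in> left_module_hom R (Ext_module I Q M) (Ext_module I Q M')"
    by (rule Ext_hom_transfer[OF assms(1)]) (rule push.Ext_push_ext_with_class)
qed

lemma pull_module_hom:
  assumes "graded_quandle I Q'" and "\<phi> \<in> graded_quandle_hom I Q' Q"
  shows "H2_pull I (add_grp M) Q' \<phi> \<in> left_module_hom R (H2_module I Q M) (H2_module I Q' M)"
    and "Ext_pull I (add_grp M) Q' \<phi> \<in> left_module_hom R (Ext_module I Q M) (Ext_module I Q' M)"
proof -
  have source: "graded_module_coefficients I Q' R M"
    by (intro graded_module_coefficients.intro graded_module_coefficients_axioms.intro assms(1) ring modules)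
  interpret source: graded_module_coefficients I Q' R M by fact
  interpret pull: quandle_base_change I Q "add_grp M" Q' \<phi>
    by unfold_locales fact
  have smult: "H2_pull I (add_grp M) Q' \<phi> (H2_push I Q (add_grp M) (scalar M r) c)
      = H2_push I Q' (add_grp M) (scalar M r) (H2_pull I (add_grp M) Q' \<phi> c)"
    if r: "r \<in> carrier R" and c: "c \<in> H2 I Q (add_grp M)" for r c
  proof -
    obtain f where f: "f \<in> Z2 I Q (add_grp M)" "c = coh_class I Q (add_grp M) f"
      using c by (rule H2_cases)
    have "cochain_pull Q' \<phi> (cochain_push I Q (scalar M r) f)
        = cochain_push I Q' (scalar M r) (cochain_pull Q' \<phi> f)"
      by (rule source.cochain_eqI)
        (simp_all add: scalar_push_apply source.scalar_push_apply, simp_all add: cochain_pull_def cochain_push_def)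
    then show ?thesis
      using r f(1) by (simp add: f(2) H2_scalar_coh_class source.H2_scalar_coh_class pull.H2_pull_coh_class
          scalar_push_Z2 pull.cochain_pull_Z2)
  qed
  show "H2_pull I (add_grp M) Q' \<phi> \<in> left_module_hom R (H2_module I Q M) (H2_module I Q' M)"
    by (auto simp: left_module_hom_def H2_module_simps source.H2_module_simps smult
        pull.H2_pull_mult[OF comm_modules])
  then show "Ext_pull I (add_grp M) Q' \<phi> \<in> left_module_hom R (Ext_module I Q M) (Ext_module I Q' M)"
    by (rule Ext_hom_transfer[OF source]) (rule pull.Ext_pull_ext_with_class)
qed

end

section \<open>Classification of graded extensions\<close>

theorem theorem9p7:
  fixes I :: "'i set" and Q :: "('q, 'i) graded_quandle"
    and \<Lambda> :: "'i \<Rightarrow> ('g, 'm) monoid_scheme"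
  assumes "graded_quandle I Q" and "graded_group I \<Lambda>"
  shows "
    \<comment> \<open>the cocycle of a section, and independence of its class from the section\<close>
    (\<forall>E :: ('x, 'q, 'i, 'g) extension. graded_extension I Q \<Lambda> E \<longrightarrow>
        (\<exists>s. is_section Q E s) \<and>
        (\<forall>s. is_section Q E s \<longrightarrow> (\<exists>!f. section_cochain I Q \<Lambda> E s f) \<and>
          (\<forall>f. section_cochain I Q \<Lambda> E s f \<longrightarrow> f \<in> Z2 I Q \<Lambda> \<and> Phi I Q \<Lambda> E = coh_class I Q \<Lambda> f))) \<and>
    \<comment> \<open>equivalence of extensions and of cocycles; every extension, over any type, has a class in Ext\<close>
    equiv (Z2 I Q \<Lambda>) (cohomologous I Q \<Lambda>) \<and>
    (\<forall>(E :: ('x, 'q, 'i, 'g) extension) (E' :: ('y, 'q, 'i, 'g) extension).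
        graded_extension I Q \<Lambda> E \<and> graded_extension I Q \<Lambda> E' \<longrightarrow>
        (ext_equiv I Q \<Lambda> E E' \<longleftrightarrow> ext_class I Q \<Lambda> E = ext_class I Q \<Lambda> E') \<and>
        (ext_equiv I Q \<Lambda> E E' \<longleftrightarrow> Phi I Q \<Lambda> E = Phi I Q \<Lambda> E')) \<and>
    (\<forall>E :: ('x, 'q, 'i, 'g) extension. graded_extension I Q \<Lambda> E \<longrightarrow>
        ext_class I Q \<Lambda> E \<in> Ext I Q \<Lambda> \<and> Phi_Ext I Q \<Lambda> (ext_class I Q \<Lambda> E) = Phi I Q \<Lambda> E) \<and>
    \<comment> \<open>the induced bijection\<close>
    bij_betw (Phi_Ext I Q \<Lambda>) (Ext I Q \<Lambda>) (H2 I Q \<Lambda>) \<and>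
    \<comment> \<open>naturality in the coefficients\<close>
    (\<forall>(\<Lambda>' :: 'i \<Rightarrow> ('h, 'n) monoid_scheme) h.
        graded_group I \<Lambda>' \<and> h \<in> graded_hom I \<Lambda> \<Lambda>' \<longrightarrow>
        (\<forall>E :: ('x, 'q, 'i, 'g) extension. graded_extension I Q \<Lambda> E \<longrightarrow>
          graded_extension I Q \<Lambda>' (push_forward I Q \<Lambda> \<Lambda>' h E) \<and>
          ext_class I Q \<Lambda>' (push_forward I Q \<Lambda> \<Lambda>' h E) = Ext_push I Q \<Lambda> \<Lambda>' h (ext_class I Q \<Lambda> E)) \<and>
        (\<forall>f\<in>Z2 I Q \<Lambda>. cochain_push I Q h f \<in> Z2 I Q \<Lambda>' \<and>
          coh_class I Q \<Lambda>' (cochain_push I Q h f) = H2_push I Q \<Lambda>' h (coh_class I Q \<Lambda> f)) \<and>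
        (\<forall>U\<in>Ext I Q \<Lambda>. Phi_Ext I Q \<Lambda>' (Ext_push I Q \<Lambda> \<Lambda>' h U) = H2_push I Q \<Lambda>' h (Phi_Ext I Q \<Lambda> U))) \<and>
    \<comment> \<open>naturality in the quandle\<close>
    (\<forall>(Q' :: ('p, 'i) graded_quandle) \<phi>.
        graded_quandle I Q' \<and> \<phi> \<in> graded_quandle_hom I Q' Q \<longrightarrow>
        (\<forall>E :: ('x, 'q, 'i, 'g) extension. graded_extension I Q \<Lambda> E \<longrightarrow>
          graded_extension I Q' \<Lambda> (pull_back Q' \<phi> E) \<and>
          ext_class I Q' \<Lambda> (pull_back Q' \<phi> E) = Ext_pull I \<Lambda> Q' \<phi> (ext_class I Q \<Lambda> E)) \<and>
        (\<forall>f\<in>Z2 I Q \<Lambda>. cochain_pull Q' \<phi> f \<in> Z2 I Q' \<Lambda> \<and>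
          coh_class I Q' \<Lambda> (cochain_pull Q' \<phi> f) = H2_pull I \<Lambda> Q' \<phi> (coh_class I Q \<Lambda> f)) \<and>
        (\<forall>U\<in>Ext I Q \<Lambda>. Phi_Ext I Q' \<Lambda> (Ext_pull I \<Lambda> Q' \<phi> U) = H2_pull I \<Lambda> Q' \<phi> (Phi_Ext I Q \<Lambda> U))) \<and>
    \<comment> \<open>abelian coefficients: the operations are induced from representatives\<close>
    (graded_comm_group I \<Lambda> \<longrightarrow>
      (\<forall>(E :: ('x, 'q, 'i, 'g) extension) (E' :: ('y, 'q, 'i, 'g) extension).
        graded_extension I Q \<Lambda> E \<and> graded_extension I Q \<Lambda> E' \<longrightarrow>
        graded_extension I Q \<Lambda> (ext_sum I Q \<Lambda> E E') \<and>
        ext_class I Q \<Lambda> (ext_sum I Q \<Lambda> E E') =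
          ext_class I Q \<Lambda> E \<otimes>\<^bsub>Ext_group I Q \<Lambda>\<^esub> ext_class I Q \<Lambda> E') \<and>
      (\<forall>f\<in>Z2 I Q \<Lambda>. \<forall>f'\<in>Z2 I Q \<Lambda>. cochain_mult I Q \<Lambda> f f' \<in> Z2 I Q \<Lambda> \<and>
        coh_class I Q \<Lambda> (cochain_mult I Q \<Lambda> f f') =
          coh_class I Q \<Lambda> f \<otimes>\<^bsub>H2_group I Q \<Lambda>\<^esub> coh_class I Q \<Lambda> f')) \<and>
    (graded_comm_group I \<Lambda> \<longrightarrow>
      comm_group (Ext_group I Q \<Lambda>) \<and> comm_group (H2_group I Q \<Lambda>) \<and>
      Phi_Ext I Q \<Lambda> \<in> iso (Ext_group I Q \<Lambda>) (H2_group I Q \<Lambda>)) \<and>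
    \<comment> \<open>module coefficients\<close>
    (\<forall>(R :: ('r, 'k) ring_scheme) (M :: 'i \<Rightarrow> ('r, 'g) module).
      ring R \<and> (\<forall>i\<in>I. left_module R (M i)) \<longrightarrow>
        left_module R (Ext_module I Q M) \<and> left_module R (H2_module I Q M) \<and>
        Phi_Ext I Q (add_grp M) \<in> left_module_iso R (Ext_module I Q M) (H2_module I Q M)) \<and>
    \<comment> \<open>naturality of the module structures\<close>
    (\<forall>(R :: ('r, 'k) ring_scheme) (M :: 'i \<Rightarrow> ('r, 'g) module) (M' :: 'i \<Rightarrow> ('r, 'h) module) h.
      ring R \<and> (\<forall>i\<in>I. left_module R (M i) \<and> left_module R (M' i) \<and>
        h i \<in> left_module_hom R (M i) (M' i)) \<longrightarrow>
        Ext_push I Q (add_grp M) (add_grp M') h \<in> left_module_hom R (Ext_module I Q M) (Ext_module I Q M') \<and>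
        H2_push I Q (add_grp M') h \<in> left_module_hom R (H2_module I Q M) (H2_module I Q M')) \<and>
    (\<forall>(R :: ('r, 'k) ring_scheme) (M :: 'i \<Rightarrow> ('r, 'g) module) (Q' :: ('p, 'i) graded_quandle) \<phi>.
      ring R \<and> (\<forall>i\<in>I. left_module R (M i)) \<and>
        graded_quandle I Q' \<and> \<phi> \<in> graded_quandle_hom I Q' Q \<longrightarrow>
        Ext_pull I (add_grp M) Q' \<phi> \<in> left_module_hom R (Ext_module I Q M) (Ext_module I Q' M) \<and>
        H2_pull I (add_grp M) Q' \<phi> \<in> left_module_hom R (H2_module I Q M) (H2_module I Q' M))"
proof -
  interpret graded_coefficients I Q \<Lambda>
    by (intro graded_coefficients.intro graded_coefficients_axioms.intro assms)
  show ?thesis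
  proof (intro conjI, goal_cases)
    case 1
    show ?case
      using is_section_exists section_data(1) Phi_section by blast
  next
    case 2
    show ?case
      by (rule equiv_cohomologous)
  next
    case 3
    show ?case
      using ext_equiv_iff_ext_class ext_equiv_iff_Phi by blast
  next
    case 4
    show ?case
      using ext_class_in_Ext by blast
  next
    case 5
    show ?case
      by (rule bij_Phi_Ext)
  next
    case 6
    show ?case
    proof (intro allI impI, elim conjE, goal_cases)
      case (1 \<Lambda>' h)
      interpret push: coefficient_hom I Q \<Lambda> \<Lambda>' h
        using 1 by unfold_locales
      show ?case
        by (auto simp: push.push_forward_extension push.cochain_push_Z2 push.H2_push_coh_class ext_class_eq
            push.target.ext_class_eq push.Ext_push_ext_with_class Phi_in_H2 Ext_eq)
    qed
  next
    case 7
    show ?case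
    proof (intro allI impI, elim conjE, goal_cases)
      case (1 Q' \<phi>)
      interpret pull: quandle_base_change I Q \<Lambda> Q' \<phi>
        using 1 by (intro quandle_base_change.intro quandle_base_change_axioms.intro graded_coefficients_axioms)
      show ?case
        by (auto simp: pull.pull_back_extension pull.cochain_pull_Z2 pull.H2_pull_coh_class ext_class_eq
            pull.pulled.ext_class_eq pull.Ext_pull_ext_with_class Phi_in_H2 Ext_eq)
    qed
  next
    case 8
    show ?case
    proof (rule impI, goal_cases)
      case 1
      interpret graded_comm_coefficients I Q \<Lambda>
        using 1 by unfold_locales
      show ?case
        by (simp add: ext_sum_extension ext_class_eq Ext_mult Phi_in_H2 cochain_mult_Z2 H2_mult_coh_class)
    qed
  next
    case 9
    show ?case
    proof (rule impI, goal_cases)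
      case 1
      interpret graded_comm_coefficients I Q \<Lambda>
        using 1 by unfold_locales
      show ?case
        by (intro conjI comm_group_Ext comm_group_H2 iso_Phi_Ext)
    qed
  next
    case 10
    show ?case
    proof (intro allI impI, elim conjE, goal_cases)
      case (1 R M)
      interpret mod: graded_module_coefficients I Q R M
        using 1 by (intro graded_module_coefficients.intro graded_module_coefficients_axioms.intro
            graded_quandle_axioms) blast+
      show ?case
        by (intro conjI mod.left_module_Ext mod.left_module_H2 mod.iso_Phi_Ext_module)
    qed
  next
    case 11
    show ?case
    proof (intro allI impI, elim conjE, goal_cases)
      case (1 R M M' h)
      interpret mod: graded_module_coefficients I Q R M
        using 1 by (intro graded_module_coefficients.intro graded_module_coefficients_axioms.intro
            graded_quandle_axioms) blast+
      have "graded_module_coefficients I Q R M'"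
        using 1 by (intro graded_module_coefficients.intro graded_module_coefficients_axioms.intro
            graded_quandle_axioms) blast+
      then show ?case
        using 1 mod.push_module_hom[of M' h] by blast
    qed
  next
    case 12
    show ?case
    proof (intro allI impI, elim conjE, goal_cases)
      case (1 R M Q' \<phi>)
      interpret mod: graded_module_coefficients I Q R M
        using 1 by (intro graded_module_coefficients.intro graded_module_coefficients_axioms.intro
            graded_quandle_axioms) blast+
      show ?case
        using 1 mod.pull_module_hom by blast
    qed
  qed
qed

end
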